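(* Let $\mathcal{S}$ denote the class of all stationary autocorrelation functions, and $\mathcal{S}_+$ the subset of nonnegative $A\in\mathcal{S}$. For a centered stationary Gaussian process $\{Z_t\}_{t\ge0}$ of autocorrelation $A(s,t)=A(0,t-s)\in\mathcal{S}_+$, the nonnegative, possibly infinite, limit $$b(A):=-\lim_{T\to\infty}\frac1T\log\mathbb{P}\Bigl(\sup_{t\in[0,T]}Z_t<0\Bigr)$$ exists. Consider centered Gaussian processes $\{Z^{(k)}_t\}_{t\ge0}$, $1\le k\le\infty$ (normalized to have $\mathbb{E}[(Z^{(k)}_t)^2]=1$), of nonnegative autocorrelations $A_k(s,t)$, such that $A_\infty(s,t)\in\mathcal{S}_+$. Suppose that the following three conditions hold: (i) $$\limsup_{k,\tau\to\infty}\ \sup_{s\ge0}\left\{\frac{\log A_k(s,s+\tau)}{\log\tau}\right\}<-1;$$ (ii) for every $\eta>0$, $$\limsup_{M\to\infty}\frac1M\log\mathbb{P}\Bigl(\sup_{t\in[0,M]}Z^{(\infty)}_t<M^{-\eta}\Bigr)=-b(A_\infty);$$ (iii) there exist $\zeta>0$ and $M_1<\infty$ such that for any $z\in[0,\zeta]$ and $M\ge M_1$, $$\mathbb{P}\Bigl(\sup_{t\in[0,M]}Z^{(\infty)}_t<z\Bigr)\le\liminf_{k\to\infty}\inf_{s\ge0}\mathbb{P}\Bigl(\sup_{t\in[0,M]}Z^{(k)}_{s+t}<z\Bigr)\le\limsup_{k\to\infty}\sup_{s\ge0}\mathbb{P}\Bigl(\sup_{t\in[0,M]}Z^{(k)}_{s+t}<z\Bigr)\le\mathbb{P}\Bigl(\sup_{t\in[0,M]}Z^{(\infty)}_t\le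 z\Bigr).$$ Then $$\lim_{k,T\to\infty}\frac1T\log\mathbb{P}\Bigl(\sup_{t\in[0,T]}Z^{(k)}_t<0\Bigr)=-b(A_\infty).$$
   Context: A stationary autocorrelation function is a function $A:[0,\infty)\to[-1,1]$ such that $(s,t)\mapsto A(|t-s|)$ is the covariance of a centered unit-variance stationary Gaussian process on $[0,\infty)$; one writes $A(s,t)=A(0,t-s)$ for $s\le t$, and $A(s,t)\in\mathcal{S}_+$ means that $A(s,t)$ arises in this way from an element of $\mathcal{S}_+$. The autocorrelation of a centered Gaussian process $Z$ is $A(s,t)=\operatorname{corr}(Z_s,Z_t)$. The convention $\log 0=-\infty$ is used. Limits written with $k,\tau\to\infty$ or $k,T\to\infty$ are joint limits in both parameters (with $k$ finite). As is customary, Gaussian processes are taken to be separable versions, so that suprema over intervals are measurable and determined by a countable dense set of times. *)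

theory Defs
  imports "HOL-Probability.Probability"
begin

text \<open>
  Processes are families \<open>Z :: real \<Rightarrow> 'a \<Rightarrow> real\<close> on a probability space \<open>M\<close>; only times \<open>t \<ge> 0\<close>
  are ever inspected. Likewise a function \<open>A :: real \<Rightarrow> real\<close> stands for its restriction to \<open>t \<ge> 0\<close>.
\<close>

text \<open>The almost surely constant case is the degenerate normal law.\<close>

definition gaussian_rv :: "'a measure \<Rightarrow> ('a \<Rightarrow> real) \<Rightarrow> bool" where
  "gaussian_rv M X \<longleftrightarrow> X \<in> borel_measurable M \<and>
     ((\<exists>m. AE \<omega> in M. X \<omega> = m) \<or>
      (\<exists>m \<sigma>. \<sigma> > 0 \<and> distributed M lborel X (\<lambda>x. ennreal (normal_density m \<sigma> x))))"

definition gaussian_process :: "'a measure \<Rightarrow> (real \<Rightarrow> 'a \<Rightarrow> real) \<Rightarrow> bool" where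
  "gaussian_process M Z \<longleftrightarrow> prob_space M \<and>
     (\<forall>F c. finite F \<and> F \<subseteq> {0..} \<longrightarrow> gaussian_rv M (\<lambda>\<omega>. \<Sum>t\<in>F. c t * Z t \<omega>))"

definition centered_process :: "'a measure \<Rightarrow> (real \<Rightarrow> 'a \<Rightarrow> real) \<Rightarrow> bool" where
  "centered_process M Z \<longleftrightarrow> (\<forall>t\<ge>0. integrable M (Z t) \<and> (\<integral>\<omega>. Z t \<omega> \<partial>M) = 0)"

definition unit_variance_process :: "'a measure \<Rightarrow> (real \<Rightarrow> 'a \<Rightarrow> real) \<Rightarrow> bool" where
  "unit_variance_process M Z \<longleftrightarrow> (\<forall>t\<ge>0. prob_space.variance M (Z t) = 1)"

definition stationary_process :: "'a measure \<Rightarrow> (real \<Rightarrow> 'a \<Rightarrow> real) \<Rightarrow> bool" where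
  "stationary_process M Z \<longleftrightarrow> (\<forall>h\<ge>0. \<forall>F. finite F \<and> F \<subseteq> {0..} \<longrightarrow>
     distr M (Pi\<^sub>M F (\<lambda>_. borel)) (\<lambda>\<omega>. \<lambda>t\<in>F. Z (t + h) \<omega>) =
     distr M (Pi\<^sub>M F (\<lambda>_. borel)) (\<lambda>\<omega>. \<lambda>t\<in>F. Z t \<omega>))"

text \<open>
  Separability in the sense of Doob: for almost every path, the graph over a fixed countable set
  \<open>D\<close> of times is dense in the whole graph.
  Outside a null set, suprema over intervals are then countable suprema. Hence events about them are
  in general measurable only for the completion of \<open>M\<close>, and their probabilities are always taken
  in \<open>completion M\<close> (\<open>measure M\<close> would return 0 on a non-measurable set).
\<close>

definition separable_process :: "'a measure \<Rightarrow> (real \<Rightarrow> 'a \<Rightarrow> real) \<Rightarrow> bool" where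
  "separable_process M Z \<longleftrightarrow> (\<exists>D\<subseteq>{0..}. countable D \<and>
     (AE \<omega> in M. \<forall>t\<ge>0. (t, Z t \<omega>) \<in> closure ((\<lambda>d. (d, Z d \<omega>)) ` D)))"

definition cov :: "'a measure \<Rightarrow> ('a \<Rightarrow> real) \<Rightarrow> ('a \<Rightarrow> real) \<Rightarrow> real" where
  "cov M X Y = (\<integral>\<omega>. (X \<omega> - (\<integral>\<omega>'. X \<omega>' \<partial>M)) * (Y \<omega> - (\<integral>\<omega>'. Y \<omega>' \<partial>M)) \<partial>M)"

definition autocorr :: "'a measure \<Rightarrow> (real \<Rightarrow> 'a \<Rightarrow> real) \<Rightarrow> real \<Rightarrow> real \<Rightarrow> real" where
  "autocorr M Z s t = cov M (Z s) (Z t) / sqrt (cov M (Z s) (Z s) * cov M (Z t) (Z t))"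

text \<open>\<open>A\<close> is the one-parameter form \<open>A(s,t) = A(0,t-s)\<close> of the autocorrelation of \<open>Z\<close>.\<close>

definition has_stationary_autocorr :: "'a measure \<Rightarrow> (real \<Rightarrow> 'a \<Rightarrow> real) \<Rightarrow> (real \<Rightarrow> real) \<Rightarrow> bool" where
  "has_stationary_autocorr M Z A \<longleftrightarrow> (\<forall>s t. 0 \<le> s \<and> s \<le> t \<longrightarrow> autocorr M Z s t = A (t - s))"

text \<open>
  Here and in \<open>persistence_exponent\<close> the probability space has the type of paths. This is no
  restriction: a process on any space can be transported to path space along
  \<open>\<omega> \<mapsto> (\<lambda>t. Z t \<omega>)\<close>, taking there the largest sigma-algebra that makes this map
  measurable from the completion.
\<close>

definition stationary_autocorrelations :: "(real \<Rightarrow> real) set" ("\<S>") where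
  "\<S> = {A. (\<forall>t\<ge>0. A t \<in> {-1..1}) \<and>
     (\<exists>(M :: (real \<Rightarrow> real) measure) Z.
        gaussian_process M Z \<and> centered_process M Z \<and> unit_variance_process M Z \<and>
        stationary_process M Z \<and>
        (\<forall>s\<ge>0. \<forall>t\<ge>0. cov M (Z s) (Z t) = A \<bar>t - s\<bar>))}"

definition nonneg_stationary_autocorrelations :: "(real \<Rightarrow> real) set" ("\<S>\<^sub>+") where
  "\<S>\<^sub>+ = {A \<in> \<S>. \<forall>t\<ge>0. 0 \<le> A t}"

text \<open>Only used for nonnegative arguments; \<open>HOL\<close>'s \<open>ln 0 = 0\<close> is replaced by \<open>-\<infinity>\<close>.\<close>

definition eln :: "real \<Rightarrow> ereal" where
  "eln x = (if x \<le> 0 then -\<infinity> else ereal (ln x))"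

text \<open>Suprema are formed in \<^typ>\<open>ereal\<close>, since paths may be unbounded.\<close>

definition log_persistence_rate :: "'a measure \<Rightarrow> (real \<Rightarrow> 'a \<Rightarrow> real) \<Rightarrow> real \<Rightarrow> ereal" where
  "log_persistence_rate M Z T =
     ereal (1 / T) * eln \<P>(\<omega> in completion M. (SUP t\<in>{0..T}. ereal (Z t \<omega>)) < 0)"

text \<open>
  \<open>b(A)\<close>: the common value of the limit over all processes with autocorrelation \<open>A\<close>, negated.
  Existence of the limit is not built into the definition.
\<close>

definition persistence_exponent :: "(real \<Rightarrow> real) \<Rightarrow> ereal" where
  "persistence_exponent A = (THE b. \<forall>(M :: (real \<Rightarrow> real) measure) Z.
     gaussian_process M Z \<and> centered_process M Z \<and> stationary_process M Z \<and>
     separable_process M Z \<and> has_stationary_autocorr M Z A \<longrightarrow>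
     (log_persistence_rate M Z \<longlongrightarrow> - b) at_top)"

end

theory Submission
  imports Defs "HOL-Real_Asymp.Real_Asymp"
begin

text \<open>
  The engine is Slepian's inequality (\<open>slepian\<close>): between centered Gaussian vectors with the same
  variances, larger covariances make it likelier that all coordinates stay below given thresholds.

  \<^emph>\<open>Existence of the limit.\<close> If the correlations are nonnegative, comparing the process on two adjacent
  intervals with two independent copies shows that \<open>p T = P (sup Z < 0 on [0, T])\<close> is
  supermultiplicative (\<open>sup_lt_mult_le\<close>). With stationarity, Fekete's argument gives convergence of
  \<open>ln (p T) / T\<close> to its supremum (\<open>log_persistence_rate_tendsto_SUP\<close>). A centered Gaussian law is
  determined by its covariance, and scaling does not affect signs, so the limit depends on \<open>A\<close> only. For the definite description \<open>persistence_exponent\<close> to denote it, some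
  process on path space must realize \<open>A\<close>; the image of the given process under the path map does
  (\<open>path_space_transport\<close>).

  \<^emph>\<open>Lower bound for the joint limit.\<close> Supermultiplicativity over blocks of length \<open>L\<close> bounds the
  probability for the \<open>k\<close>-th process from below by \<open>q ^ (T / L + 1)\<close>, where \<open>q\<close> is close to the
  probability for the limit process on one block (\<open>persistence_lower\<close>).

  \<^emph>\<open>Upper bound.\<close> Retain only blocks of length \<open>l\<close> separated by gaps \<open>\<delta> * l\<close>. By the decay
  hypothesis the correlation between blocks \<open>i\<close> and \<open>k\<close> is at most \<open>(\<bar>i - k\<bar> \<delta> l) powr (- \<alpha>)\<close> with
  \<open>\<alpha> > 1\<close>. By Slepian the process may be replaced by \<open>sqrt (1 - \<epsilon>) W + sqrt \<epsilon> Y\<close>, where \<open>W\<close> has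
  independent blocks with the original law in each, \<open>\<epsilon>\<close> is of order \<open>l powr (- \<alpha>)\<close>, and \<open>Y\<close> is one
  Gaussian variable \<open>Y i\<close> per block, a moving average of independent normal variables with weights
  \<open>(1 + \<bar>i - j\<bar>) powr (- \<alpha>)\<close>. Because \<open>\<alpha> > 1\<close> these weights are summable, and therefore a positive
  fraction of the \<open>N\<close> variables \<open>Y i\<close> falls below \<open>- D\<close> with probability at most
  \<open>(4 * exp (- c * D\<^sup>2)) ^ N\<close> (\<open>linear_excursion_count_tail\<close>). Take \<open>sqrt \<epsilon> * D\<close> of order
  \<open>z = l powr (- \<eta>)\<close>; then \<open>D\<^sup>2\<close> is of order \<open>l powr (\<alpha> - 2 * \<eta>)\<close>, which for small \<open>\<eta>\<close> dominates \<open>l\<close>,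
  so the exceptional event is negligible against \<open>exp (- b * l)\<close> per block. Outside it, nearly all
  blocks only need \<open>sup W < z\<close>, and the hypotheses on the limit process bound the probability of this
  by about \<open>exp (- b * l)\<close> for each of the independent blocks (\<open>persistence_upper\<close>).
\<close>

section \<open>Laws of Gaussian vectors\<close>

lemma integrable_bounded:
  fixes f :: "'a \<Rightarrow> 'b::{banach, second_countable_topology}"
  assumes "prob_space M" "f \<in> borel_measurable M" "\<And>x. norm (f x) \<le> B"
  shows "integrable M f"
proof -
  interpret prob_space M by fact
  show ?thesis using assms by (intro integrable_const_bound[of _ B]) auto
qed

text \<open>
  Both sides are integrals against finite measures on the line, the images of \<open>g\<close> times \<open>M\<close> and of
  \<open>h\<close> times \<open>N\<close>. After normalization, Levy's uniqueness theorem applies: taking the phase \<open>\<phi>\<close> to be \<open>0\<close> and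
  \<open>- pi / 2\<close>, the hypothesis contains the real and the imaginary part of the characteristic functions.
\<close>

lemma law_unique_density:
  fixes X :: "'a \<Rightarrow> real" and Y :: "'b \<Rightarrow> real"
  assumes M: "prob_space M" and N: "prob_space N"
    and X[measurable]: "X \<in> borel_measurable M" and Y[measurable]: "Y \<in> borel_measurable N"
    and g[measurable]: "g \<in> borel_measurable M" and h[measurable]: "h \<in> borel_measurable N"
    and gb: "\<And>x. 1 \<le> g x \<and> g x \<le> 3" and hb: "\<And>x. 1 \<le> h x \<and> h x \<le> 3"
    and eq: "\<And>s \<phi>. (LINT x|M. g x * cos (s * X x + \<phi>)) = (LINT x|N. h x * cos (s * Y x + \<phi>))"
    and B[measurable]: "B \<in> sets borel"
  shows "(LINT x|M. g x * indicator B (X x)) = (LINT x|N. h x * indicator B (Y x))"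
proof -
  interpret M: prob_space M by fact
  interpret N: prob_space N by fact
  define m where "m = (LINT x|M. g x)"
  have "\<bar>g x\<bar> \<le> 3" "\<bar>h y\<bar> \<le> 3" for x y using gb[of x] hb[of y] by auto
  then have ig: "integrable M g" and ih: "integrable N h"
    by (intro integrable_bounded[OF M, of _ 3] integrable_bounded[OF N, of _ 3]; simp)+
  have m': "m = (LINT x|N. h x)" using eq[of 0 0] by (simp add: m_def)
  have "(LINT x|M. 1) \<le> m" unfolding m_def using ig gb by (intro integral_mono) auto
  then have m1: "m \<ge> 1" by (simp add: M.prob_space)
  have g0: "0 \<le> g x" "0 \<le> h y" for x y using gb[of x] hb[of y] by auto
  have key: "prob_space (density L (\<lambda>x. ennreal (f x / m))) \<and>
     (\<forall>s. char (distr (density L (\<lambda>x. ennreal (f x / m))) borel W) s =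
        Complex ((LINT x|L. f x * cos (s * W x + 0)) / m) ((LINT x|L. f x * cos (s * W x + (-pi/2))) / m)) \<and>
     measure (distr (density L (\<lambda>x. ennreal (f x / m))) borel W) B = (LINT x|L. f x * indicator B (W x)) / m"
    if L: "prob_space L" and [measurable]: "f \<in> borel_measurable L" "W \<in> borel_measurable L"
     and f: "\<And>x. 1 \<le> f x \<and> f x \<le> 3" and fm: "m = (LINT x|L. f x)" for L :: "'c measure" and f W
  proof -
    interpret L: prob_space L by fact
    have f0: "0 \<le> f x" for x using f[of x] by auto
    have i: "integrable L (\<lambda>x. f x * k x)" if [measurable]: "k \<in> borel_measurable L" and "\<And>x. \<bar>k x\<bar> \<le> 1" for k :: "'c \<Rightarrow> real"
    proof (rule integrable_bounded[OF L, of _ 3])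
      show "norm (f x * k x) \<le> 3" for x
        using mult_mono[of "f x" 3 "\<bar>k x\<bar>" 1] f[of x] that(2)[of x] by (simp add: abs_mult)
    qed measurable
    have if': "integrable L f" using i[of "\<lambda>_. 1"] by simp
    have ps: "prob_space (density L (\<lambda>x. ennreal (f x / m)))"
    proof
      have "(\<integral>\<^sup>+ x. ennreal (f x / m) \<partial>L) = ennreal (LINT x|L. f x / m)"
        using if' f0 m1 by (intro nn_integral_eq_integral) auto
      also have "\<dots> = 1" using fm m1 by simp
      finally show "emeasure (density L (\<lambda>x. ennreal (f x / m))) (space (density L (\<lambda>x. ennreal (f x / m)))) = 1"
        by (simp add: emeasure_density cong: nn_integral_cong_simp)
    qed
    have ch: "char (distr (density L (\<lambda>x. ennreal (f x / m))) borel W) s =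
        Complex ((LINT x|L. f x * cos (s * W x + 0)) / m) ((LINT x|L. f x * cos (s * W x + (-pi/2))) / m)" for s
    proof -
      have "char (distr (density L (\<lambda>x. ennreal (f x / m))) borel W) s = (CLINT x|L. (f x / m) *\<^sub>R iexp (s * W x))"
        unfolding char_def using f0 m1 by (subst integral_distr) (auto simp: integral_density)
      also have "\<dots> = Complex ((LINT x|L. f x * cos (s * W x + 0)) / m) ((LINT x|L. f x * cos (s * W x + (-pi/2))) / m)"
      proof -
        have int: "integrable L (\<lambda>x. (f x / m) *\<^sub>R iexp (s * W x))"
        proof (rule integrable_bounded[OF L, of _ 3])
          show "norm ((f x / m) *\<^sub>R iexp (s * W x)) \<le> 3" for x
            using frac_le[of 3 "f x" 1 m] f[of x] f0[of x] m1 by (simp add: norm_mult)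
        qed measurable
        have c: "(\<lambda>x. f x * cos (s * W x + (- pi / 2))) = (\<lambda>x. f x * sin (s * W x))" by (simp add: cos_diff)
        show ?thesis unfolding c
          by (rule complex_eqI; subst integral_Re[symmetric, OF int] integral_Im[symmetric, OF int])
             (simp_all add: Re_exp Im_exp)
      qed
      finally show ?thesis .
    qed
    have "measure (distr (density L (\<lambda>x. ennreal (f x / m))) borel W) B = (LINT x|distr (density L (\<lambda>x. ennreal (f x / m))) borel W. indicator B x)"
      by simp
    also have "\<dots> = (LINT x|L. (f x / m) *\<^sub>R indicator B (W x))"
      using f0 m1 by (subst integral_distr) (auto simp: integral_density)
    also have "\<dots> = (LINT x|L. f x * indicator B (W x)) / m"
      by simp
    finally show ?thesis using ps ch by blast
  qed
  note kM = key[OF M g X gb m_def] and kN = key[OF N h Y hb m']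
  have "distr (density M (\<lambda>x. ennreal (g x / m))) borel X = distr (density N (\<lambda>x. ennreal (h x / m))) borel Y"
  proof (rule Levy_uniqueness)
    show "real_distribution (distr (density M (\<lambda>x. ennreal (g x / m))) borel X)"
      using kM by (intro prob_space.real_distribution_distr) auto
    show "real_distribution (distr (density N (\<lambda>x. ennreal (h x / m))) borel Y)"
      using kN by (intro prob_space.real_distribution_distr) auto
    show "char (distr (density M (\<lambda>x. ennreal (g x / m))) borel X) = char (distr (density N (\<lambda>x. ennreal (h x / m))) borel Y)"
      using kM kN eq by (intro ext) presburger
  qed
  then have "(LINT x|M. g x * indicator B (X x)) / m = (LINT x|N. h x * indicator B (Y x)) / m"
    using kM kN by presburger
  then show ?thesis using m1 by simp
qed

text \<open>
  Signed weights are reduced to positive ones by adding the constant \<open>2\<close>.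
\<close>

lemma law_unique_weighted:
  fixes X :: "'a \<Rightarrow> real" and Y :: "'b \<Rightarrow> real"
  assumes M: "prob_space M" and N: "prob_space N"
    and X[measurable]: "X \<in> borel_measurable M" and Y[measurable]: "Y \<in> borel_measurable N"
    and g[measurable]: "g \<in> borel_measurable M" and h[measurable]: "h \<in> borel_measurable N"
    and gb: "\<And>x. \<bar>g x\<bar> \<le> 1" and hb: "\<And>x. \<bar>h x\<bar> \<le> 1"
    and eq0: "\<And>s \<phi>. (LINT x|M. cos (s * X x + \<phi>)) = (LINT x|N. cos (s * Y x + \<phi>))"
    and eq: "\<And>s \<phi>. (LINT x|M. g x * cos (s * X x + \<phi>)) = (LINT x|N. h x * cos (s * Y x + \<phi>))"
    and B[measurable]: "B \<in> sets borel"
  shows "(LINT x|M. g x * indicator B (X x)) = (LINT x|N. h x * indicator B (Y x))"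
proof -
  have iM: "integrable M k" if "k \<in> borel_measurable M" "\<And>x. \<bar>k x\<bar> \<le> 1" for k :: "'a \<Rightarrow> real"
    using that by (intro integrable_bounded[OF M]) auto
  have iN: "integrable N k" if "k \<in> borel_measurable N" "\<And>x. \<bar>k x\<bar> \<le> 1" for k :: "'b \<Rightarrow> real"
    using that by (intro integrable_bounded[OF N]) auto
  have gk: "\<bar>g x * k\<bar> \<le> 1" if "\<bar>k\<bar> \<le> 1" for x k using gb[of x] that by (simp add: abs_mult mult_le_one)
  have hk: "\<bar>h x * k\<bar> \<le> 1" if "\<bar>k\<bar> \<le> 1" for x k using hb[of x] that by (simp add: abs_mult mult_le_one)
  have "(LINT x|M. (2 + g x) * indicator B (X x)) = (LINT x|N. (2 + h x) * indicator B (Y x))"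
  proof (rule law_unique_density[OF M N X Y _ _ _ _ _ B])
    show "1 \<le> 2 + g x \<and> 2 + g x \<le> 3" for x using gb[of x] by auto
    show "1 \<le> 2 + h x \<and> 2 + h x \<le> 3" for x using hb[of x] by auto
    fix s \<phi>
    have "(LINT x|M. (2 + g x) * cos (s * X x + \<phi>)) = 2 * (LINT x|M. cos (s * X x + \<phi>)) + (LINT x|M. g x * cos (s * X x + \<phi>))"
      by (subst integral_mult_right_zero[symmetric], subst Bochner_Integration.integral_add[symmetric])
         (auto simp: algebra_simps intro!: iM gk)
    also have "\<dots> = (LINT x|N. (2 + h x) * cos (s * Y x + \<phi>))" unfolding eq eq0
      by (subst integral_mult_right_zero[symmetric], subst Bochner_Integration.integral_add[symmetric])
         (auto simp: algebra_simps intro!: iN hk)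
    finally show "(LINT x|M. (2 + g x) * cos (s * X x + \<phi>)) = (LINT x|N. (2 + h x) * cos (s * Y x + \<phi>))" .
  qed auto
  moreover have "(LINT x|M. 2 * indicator B (X x) :: real) = (LINT x|N. 2 * indicator B (Y x))"
  proof (rule law_unique_density[OF M N X Y _ _ _ _ _ B])
    show "(LINT x|M. 2 * cos (s * X x + \<phi>)) = (LINT x|N. 2 * cos (s * Y x + \<phi>))" for s \<phi> using eq0[of s \<phi>] by simp
  qed auto
  moreover have "(LINT x|M. (2 + g x) * indicator B (X x)) = (LINT x|M. 2 * indicator B (X x)) + (LINT x|M. g x * indicator B (X x))"
    by (subst Bochner_Integration.integral_add[symmetric]) (auto simp: algebra_simps intro!: iM gk integrable_bounded[OF M, of "\<lambda>x. 2 * indicator B (X x)" 2] split: split_indicator)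
  moreover have "(LINT x|N. (2 + h x) * indicator B (Y x)) = (LINT x|N. 2 * indicator B (Y x)) + (LINT x|N. h x * indicator B (Y x))"
    by (subst Bochner_Integration.integral_add[symmetric]) (auto simp: algebra_simps intro!: iN hk integrable_bounded[OF N, of "\<lambda>x. 2 * indicator B (Y x)" 2] split: split_indicator)
  ultimately show ?thesis by simp
qed

text \<open>
  Centered Gaussian vectors are described by their joint characteristic function, which treats
  degenerate covariances on the same footing as regular ones. Only the quadratic form of \<open>C\<close> on \<open>F\<close>
  enters.
\<close>

definition gauss_vec :: "'a measure \<Rightarrow> 'i set \<Rightarrow> ('i \<Rightarrow> 'a \<Rightarrow> real) \<Rightarrow> ('i \<Rightarrow> 'i \<Rightarrow> real) \<Rightarrow> bool" where
  "gauss_vec M F X C \<longleftrightarrow> prob_space M \<and> finite F \<and> (\<forall>i\<in>F. X i \<in> borel_measurable M) \<and>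
     (\<forall>c. (CLINT \<omega>|M. iexp (\<Sum>i\<in>F. c i * X i \<omega>)) =
        of_real (exp (- (\<Sum>i\<in>F. \<Sum>j\<in>F. c i * c j * C i j) / 2)))"

text \<open>
  The Cramer-Wold principle. Indicators of the events \<open>X i \<in> B i\<close> replace trigonometric factors one
  coordinate at a time: with the indicators introduced so far and the remaining cosine as a weight,
  the one-dimensional uniqueness theorem introduces the next one. The phase \<open>\<phi>\<close> keeps the induction
  within real cosines, since the product of two of them is a sum of two.
\<close>

lemma rectangle_prob_unique:
  fixes X :: "'i \<Rightarrow> 'a \<Rightarrow> real" and Y :: "'i \<Rightarrow> 'b \<Rightarrow> real"
  assumes M: "prob_space M" and N: "prob_space N" and F: "finite F"
    and X[measurable]: "\<And>i. i \<in> F \<Longrightarrow> X i \<in> borel_measurable M"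
    and Y[measurable]: "\<And>i. i \<in> F \<Longrightarrow> Y i \<in> borel_measurable N"
    and cf: "\<And>c. (CLINT \<omega>|M. iexp (\<Sum>i\<in>F. c i * X i \<omega>)) = (CLINT \<omega>|N. iexp (\<Sum>i\<in>F. c i * Y i \<omega>))"
    and B[measurable]: "\<And>i. i \<in> F \<Longrightarrow> B i \<in> sets borel"
  shows "measure M {\<omega>\<in>space M. \<forall>i\<in>F. X i \<omega> \<in> B i} = measure N {\<omega>\<in>space N. \<forall>i\<in>F. Y i \<omega> \<in> B i}"
proof -
  interpret M: prob_space M by fact
  interpret N: prob_space N by fact
  have base: "(LINT \<omega>|M. cos ((\<Sum>i\<in>F. c i * X i \<omega>) + \<phi>)) = (LINT \<omega>|N. cos ((\<Sum>i\<in>F. c i * Y i \<omega>) + \<phi>))" for c \<phi>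
  proof -
    have *: "(LINT \<omega>|L. cos (W \<omega> + \<phi>)) = Re (iexp \<phi> * (CLINT \<omega>|L. iexp (W \<omega>)))"
      if L: "prob_space L" and [measurable]: "W \<in> borel_measurable L" for L :: "'c measure" and W
    proof -
      have "(LINT \<omega>|L. cos (W \<omega> + \<phi>)) = (LINT \<omega>|L. Re (iexp \<phi> * iexp (W \<omega>)))"
        by (simp add: exp_add[symmetric] Re_exp add.commute)
      also have "\<dots> = Re (CLINT \<omega>|L. iexp \<phi> * iexp (W \<omega>))"
        by (intro integral_Re integrable_bounded[OF L, of _ 1]) (auto simp: norm_mult)
      also have "\<dots> = Re (iexp \<phi> * (CLINT \<omega>|L. iexp (W \<omega>)))" by simp
      finally show ?thesis .
    qed
    show ?thesis using M N cf by (subst (1 2) *) auto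
  qed
  have "(LINT \<omega>|M. (\<Prod>i\<in>I. indicator (B i) (X i \<omega>)) * cos ((\<Sum>i\<in>F. c i * X i \<omega>) + \<phi>)) =
        (LINT \<omega>|N. (\<Prod>i\<in>I. indicator (B i) (Y i \<omega>)) * cos ((\<Sum>i\<in>F. c i * Y i \<omega>) + \<phi>))" if "I \<subseteq> F" for I c \<phi>
    using finite_subset[OF that F] that
  proof (induction I arbitrary: c \<phi> rule: finite_induct)
    case empty then show ?case using base by simp
  next
    case (insert a I)
    then have a: "a \<in> F" and IF: "\<And>i. i \<in> I \<Longrightarrow> i \<in> F" by auto
    have [measurable]: "X a \<in> borel_measurable M" "Y a \<in> borel_measurable N" "B a \<in> sets borel" using a by auto
    have [measurable]: "X i \<in> borel_measurable M" "Y i \<in> borel_measurable N" "B i \<in> sets borel" if "i \<in> I" for i using IF that by auto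
    define P where "P \<omega> = (\<Prod>i\<in>I. indicator (B i) (X i \<omega>) :: real)" for \<omega>
    define Q where "Q \<omega> = (\<Prod>i\<in>I. indicator (B i) (Y i \<omega>) :: real)" for \<omega>
    have Pm[measurable]: "P \<in> borel_measurable M" unfolding P_def by measurable
    have Qm[measurable]: "Q \<in> borel_measurable N" unfolding Q_def by measurable
    have P1: "\<bar>P \<omega>\<bar> \<le> 1" for \<omega> unfolding P_def abs_prod by (rule prod_le_1) (auto simp: indicator_def)
    have Q1: "\<bar>Q \<omega>\<bar> \<le> 1" for \<omega> unfolding Q_def abs_prod by (rule prod_le_1) (auto simp: indicator_def)
    let ?S = "\<lambda>c \<omega>. \<Sum>i\<in>F. c i * X i \<omega>" and ?T = "\<lambda>c \<omega>. \<Sum>i\<in>F. c i * Y i \<omega>"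
    have shift: "(\<Sum>i\<in>F. (c(a := c a + s)) i * V i) = (\<Sum>i\<in>F. c i * V i) + s * V a" for s and V :: "'i \<Rightarrow> real" and c :: "'i \<Rightarrow> real"
    proof -
      have "(\<Sum>i\<in>F. (c(a := c a + s)) i * V i) = (\<Sum>i\<in>F. c i * V i + (if i = a then s * V a else 0))"
        by (intro sum.cong) (auto simp: algebra_simps)
      then show ?thesis using a F by (simp add: sum.distrib)
    qed
    have IH: "(LINT \<omega>|M. P \<omega> * cos (?S c \<omega> + \<phi>)) = (LINT \<omega>|N. Q \<omega> * cos (?T c \<omega> + \<phi>))" for c \<phi>
      using insert.IH[of c \<phi>] insert.prems unfolding P_def Q_def by auto
    have ab: "\<bar>p * cos t\<bar> \<le> 1" if "\<bar>p\<bar> \<le> 1" for p t :: real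
      using that by (simp add: abs_mult mult_le_one)
    have "(LINT \<omega>|M. (P \<omega> * cos (?S c \<omega> + \<phi>)) * indicator (B a) (X a \<omega>)) =
          (LINT \<omega>|N. (Q \<omega> * cos (?T c \<omega> + \<phi>)) * indicator (B a) (Y a \<omega>))"
    proof (rule law_unique_weighted[OF M N])
      show "\<bar>P x * cos (?S c x + \<phi>)\<bar> \<le> 1" for x by (rule ab[OF P1])
      show "\<bar>Q x * cos (?T c x + \<phi>)\<bar> \<le> 1" for x by (rule ab[OF Q1])
      show "(LINT x|M. cos (s * X a x + \<psi>)) = (LINT x|N. cos (s * Y a x + \<psi>))" for s \<psi>
        using base[of "(\<lambda>_. 0)(a := 0 + s)" \<psi>] unfolding shift[of "\<lambda>_. 0"] by simp
      fix s \<psi>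
      have measurableS: "?S c \<in> borel_measurable M" "X a \<in> borel_measurable M"
        "?T c \<in> borel_measurable N" "Y a \<in> borel_measurable N" by measurable
      have IHs: "(LINT x|M. P x * cos (?S c x + s * X a x + \<theta>)) = (LINT x|N. Q x * cos (?T c x + s * Y a x + \<theta>))" for s \<theta>
      proof -
        have "?S (c(a := c a + s)) x = ?S c x + s * X a x" "?T (c(a := c a + s)) y = ?T c y + s * Y a y" for x y
          by (rule shift)+
        then show ?thesis using IH[of "c(a := c a + s)" \<theta>] by presburger
      qed
      have e: "(LINT x|L. (p x * cos (u x + \<phi>)) * cos (s * v x + \<psi>)) =
         ((LINT x|L. p x * cos ((u x + s * v x) + (\<phi>+\<psi>))) + (LINT x|L. p x * cos ((u x + (-s) * v x) + (\<phi>-\<psi>)))) / 2"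
        if L: "prob_space L" and [measurable]: "p \<in> borel_measurable L" "u \<in> borel_measurable L" "v \<in> borel_measurable L"
          and p: "\<And>x. \<bar>p x\<bar> \<le> 1" for L :: "'c measure" and p u v
      proof -
        have "cos (x + \<phi>) * cos (s * y + \<psi>) = (cos ((x + s * y) + (\<phi>+\<psi>)) + cos ((x + (-s) * y) + (\<phi>-\<psi>))) / 2" for x y
          unfolding cos_times_cos by (simp add: algebra_simps)
        then have "(LINT x|L. (p x * cos (u x + \<phi>)) * cos (s * v x + \<psi>)) =
          (LINT x|L. (p x * cos ((u x + s * v x) + (\<phi>+\<psi>)) + p x * cos ((u x + (-s) * v x) + (\<phi>-\<psi>))) / 2)"
          by (intro Bochner_Integration.integral_cong) (simp_all add: mult.assoc ring_distribs)
        also have "\<dots> = ((LINT x|L. p x * cos ((u x + s * v x) + (\<phi>+\<psi>))) + (LINT x|L. p x * cos ((u x + (-s) * v x) + (\<phi>-\<psi>)))) / 2"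
          by (subst Bochner_Integration.integral_add[symmetric]) (auto intro!: integrable_bounded[OF L, of _ 1] ab p)
        finally show ?thesis .
      qed
      show "(LINT x|M. (P x * cos (?S c x + \<phi>)) * cos (s * X a x + \<psi>)) =
         (LINT x|N. (Q x * cos (?T c x + \<phi>)) * cos (s * Y a x + \<psi>))"
        by (simp only: e[OF M Pm _ _ P1] e[OF N Qm _ _ Q1] measurableS IHs)
    qed measurable
    then show ?case using insert.hyps by (simp add: P_def Q_def mult_ac)
  qed
  from this[of F "\<lambda>_. 0" 0]
  have *: "(LINT \<omega>|M. (\<Prod>i\<in>F. indicator (B i) (X i \<omega>) :: real)) = (LINT \<omega>|N. (\<Prod>i\<in>F. indicator (B i) (Y i \<omega>)))" by simp
  have **: "measure L {\<omega>\<in>space L. \<forall>i\<in>F. V i \<omega> \<in> B i} = (LINT \<omega>|L. (\<Prod>i\<in>F. indicator (B i) (V i \<omega>)))"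
    if V[measurable]: "\<And>i. i \<in> F \<Longrightarrow> V i \<in> borel_measurable L" for L :: "'c measure" and V
  proof -
    have "(LINT \<omega>|L. (\<Prod>i\<in>F. indicator (B i) (V i \<omega>) :: real)) = (LINT \<omega>|L. indicator {\<omega>\<in>space L. \<forall>i\<in>F. V i \<omega> \<in> B i} \<omega>)"
      using F by (intro Bochner_Integration.integral_cong) (auto simp: indicator_def prod_zero_iff intro!: prod.neutral)
    also have "{\<omega>\<in>space L. \<forall>i\<in>F. V i \<omega> \<in> B i} \<in> sets L" using F by measurable
    then have "(LINT \<omega>|L. indicator {\<omega>\<in>space L. \<forall>i\<in>F. V i \<omega> \<in> B i} \<omega>) = measure L {\<omega>\<in>space L. \<forall>i\<in>F. V i \<omega> \<in> B i}"
      by simp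
    finally show ?thesis ..
  qed
  show ?thesis using * X Y by (simp add: **)
qed

lemma gauss_vecD:
  assumes "gauss_vec M F X C"
  shows "prob_space M" "finite F" "\<And>i. i \<in> F \<Longrightarrow> X i \<in> borel_measurable M"
    "(CLINT \<omega>|M. iexp (\<Sum>i\<in>F. c i * X i \<omega>)) = of_real (exp (- (\<Sum>i\<in>F. \<Sum>j\<in>F. c i * c j * C i j) / 2))"
  using assms by (auto simp: gauss_vec_def)

lemma gauss_vec_cong:
  assumes "gauss_vec M F X C" "\<And>i \<omega>. i \<in> F \<Longrightarrow> \<omega> \<in> space M \<Longrightarrow> X i \<omega> = Y i \<omega>" "\<And>i j. i \<in> F \<Longrightarrow> j \<in> F \<Longrightarrow> C i j = D i j"
  shows "gauss_vec M F Y D"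
proof -
  have 1: "Y i \<in> borel_measurable M" if "i \<in> F" for i
    using gauss_vecD(3)[OF assms(1) that] assms(2)[OF that] by (simp cong: measurable_cong)
  have 2: "(\<Sum>i\<in>F. \<Sum>j\<in>F. c i * c j * C i j) = (\<Sum>i\<in>F. \<Sum>j\<in>F. c i * c j * D i j)" for c
    using assms(3) by (intro sum.cong) auto
  have 3: "(CLINT \<omega>|M. iexp (\<Sum>i\<in>F. c i * X i \<omega>)) = (CLINT \<omega>|M. iexp (\<Sum>i\<in>F. c i * Y i \<omega>))" for c
    using assms(2) by (intro Bochner_Integration.integral_cong refl arg_cong[where f=iexp] sum.cong) auto
  show ?thesis using assms(1) 1 unfolding gauss_vec_def 2 3 by auto
qed

lemma gauss_vec_rectangle:
  assumes "gauss_vec M F X C" "gauss_vec N F Y C" "\<And>i. i \<in> F \<Longrightarrow> B i \<in> sets borel"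
  shows "measure M {\<omega>\<in>space M. \<forall>i\<in>F. X i \<omega> \<in> B i} = measure N {\<omega>\<in>space N. \<forall>i\<in>F. Y i \<omega> \<in> B i}"
  using assms(3) gauss_vecD[OF assms(1)] gauss_vecD[OF assms(2)]
  by (intro rectangle_prob_unique) auto

lemma gauss_vec_law_unique:
  fixes F :: "'i set"
  assumes G: "gauss_vec M F X C" "gauss_vec N F Y C"
  shows "distr M (PiM F (\<lambda>_. borel)) (\<lambda>\<omega>. \<lambda>i\<in>F. X i \<omega>) = distr N (PiM F (\<lambda>_. borel)) (\<lambda>\<omega>. \<lambda>i\<in>F. Y i \<omega>)"
proof -
  interpret M: prob_space M by (rule gauss_vecD[OF G(1)])
  interpret N: prob_space N by (rule gauss_vecD[OF G(2)])
  note [measurable] = gauss_vecD(3)[OF G(1)] gauss_vecD(3)[OF G(2)]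
  have F[simp]: "finite F" using gauss_vecD[OF G(1)] by simp
  interpret P: prob_space "distr M (PiM F (\<lambda>_. borel)) (\<lambda>\<omega>. \<lambda>i\<in>F. X i \<omega>)"
    by (rule M.prob_space_distr) measurable
  show ?thesis
  proof (rule measure_eqI_PiM_finite[OF F, where A="\<lambda>_. space (PiM F (\<lambda>_. borel))"])
    fix A :: "'i \<Rightarrow> real set" assume A[measurable]: "\<And>i. i \<in> F \<Longrightarrow> A i \<in> sets borel"
    have r: "measure M {\<omega>\<in>space M. \<forall>i\<in>F. X i \<omega> \<in> A i} = measure N {\<omega>\<in>space N. \<forall>i\<in>F. Y i \<omega> \<in> A i}"
      by (rule gauss_vec_rectangle[OF G A])
    have 1: "(\<lambda>\<omega>. \<lambda>i\<in>F. X i \<omega>) -` Pi\<^sub>E F A \<inter> space M = {\<omega>\<in>space M. \<forall>i\<in>F. X i \<omega> \<in> A i}"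
      by (auto simp: PiE_iff)
    have 2: "(\<lambda>\<omega>. \<lambda>i\<in>F. Y i \<omega>) -` Pi\<^sub>E F A \<inter> space N = {\<omega>\<in>space N. \<forall>i\<in>F. Y i \<omega> \<in> A i}"
      by (auto simp: PiE_iff)
    show "emeasure (distr M (PiM F (\<lambda>_. borel)) (\<lambda>\<omega>. \<lambda>i\<in>F. X i \<omega>)) (Pi\<^sub>E F A) =
          emeasure (distr N (PiM F (\<lambda>_. borel)) (\<lambda>\<omega>. \<lambda>i\<in>F. Y i \<omega>)) (Pi\<^sub>E F A)"
      by (subst (1 2) emeasure_distr) (simp_all add: 1 2 M.emeasure_eq_measure N.emeasure_eq_measure r)
  next
    show "range (\<lambda>_. space (PiM F (\<lambda>_. borel :: real measure))) \<subseteq> prod_algebra F (\<lambda>_. borel)"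
      using F by (auto simp: space_PiM prod_algebra_eq_finite)
  qed (auto simp: P.emeasure_eq_measure)
qed

lemma gauss_vec_canonical:
  fixes F :: "'i set"
  assumes G: "gauss_vec M F X C"
  shows "gauss_vec (distr M (PiM F (\<lambda>_. borel)) (\<lambda>\<omega>. \<lambda>i\<in>F. X i \<omega>)) F (\<lambda>i x. x i) C"
proof -
  interpret M: prob_space M by (rule gauss_vecD[OF G])
  note [measurable] = gauss_vecD(3)[OF G]
  have "(CLINT x|distr M (PiM F (\<lambda>_. borel)) (\<lambda>\<omega>. \<lambda>i\<in>F. X i \<omega>). iexp (\<Sum>i\<in>F. c i * x i)) =
    (CLINT \<omega>|M. iexp (\<Sum>i\<in>F. c i * X i \<omega>))" for c
    by (subst integral_distr) auto
  then show ?thesis using G by (auto simp: gauss_vec_def intro!: M.prob_space_distr)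
qed

lemma sum_swap_blocks:
  fixes f :: "'a \<Rightarrow> 'b \<Rightarrow> 'c \<Rightarrow> 'd \<Rightarrow> 'e::comm_monoid_add"
  shows
  "(\<Sum>l\<in>F. \<Sum>m\<in>F'. \<Sum>i\<in>G. \<Sum>j\<in>G'. f l m i j) = (\<Sum>i\<in>G. \<Sum>j\<in>G'. \<Sum>l\<in>F. \<Sum>m\<in>F'. f l m i j)"
proof -
  have A: "(\<Sum>l\<in>A. \<Sum>m\<in>B. g l m) = (\<Sum>p\<in>A\<times>B. g (fst p) (snd p))" for A B and g :: "'x \<Rightarrow> 'y \<Rightarrow> 'e"
    by (simp add: sum.cartesian_product case_prod_beta)
  have "(\<Sum>l\<in>F. \<Sum>m\<in>F'. \<Sum>i\<in>G. \<Sum>j\<in>G'. f l m i j) = (\<Sum>p\<in>F\<times>F'. \<Sum>i\<in>G. \<Sum>j\<in>G'. f (fst p) (snd p) i j)"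
    by (rule A)
  also have "\<dots> = (\<Sum>p\<in>F\<times>F'. \<Sum>q\<in>G\<times>G'. f (fst p) (snd p) (fst q) (snd q))"
    by (intro sum.cong refl A)
  also have "\<dots> = (\<Sum>q\<in>G\<times>G'. \<Sum>p\<in>F\<times>F'. f (fst p) (snd p) (fst q) (snd q))"
    by (rule sum.swap)
  also have "\<dots> = (\<Sum>q\<in>G\<times>G'. \<Sum>l\<in>F. \<Sum>m\<in>F'. f l m (fst q) (snd q))"
    by (intro sum.cong refl A[symmetric])
  also have "\<dots> = (\<Sum>i\<in>G. \<Sum>j\<in>G'. \<Sum>l\<in>F. \<Sum>m\<in>F'. f l m i j)"
    by (rule A[symmetric])
  finally show ?thesis .
qed

lemma gauss_vec_linear:
  assumes G: "gauss_vec M F X C" and G': "finite G"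
  shows "gauss_vec M G (\<lambda>i \<omega>. \<Sum>l\<in>F. b i l * X l \<omega>) (\<lambda>i j. \<Sum>l\<in>F. \<Sum>m\<in>F. b i l * b j m * C l m)"
  unfolding gauss_vec_def
proof (intro conjI allI ballI)
  note [measurable] = gauss_vecD(3)[OF G]
  show "(\<lambda>\<omega>. \<Sum>l\<in>F. b i l * X l \<omega>) \<in> borel_measurable M" for i by measurable
  fix c
  have "(\<Sum>i\<in>G. c i * (\<Sum>l\<in>F. b i l * X l \<omega>)) = (\<Sum>l\<in>F. (\<Sum>i\<in>G. c i * b i l) * X l \<omega>)" for \<omega>
    by (simp add: sum_distrib_left sum_distrib_right mult.assoc) (rule sum.swap)
  then have "(CLINT \<omega>|M. iexp (\<Sum>i\<in>G. c i * (\<Sum>l\<in>F. b i l * X l \<omega>))) = (CLINT \<omega>|M. iexp (\<Sum>l\<in>F. (\<Sum>i\<in>G. c i * b i l) * X l \<omega>))"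
    by simp
  also have "\<dots> = of_real (exp (- (\<Sum>l\<in>F. \<Sum>m\<in>F. (\<Sum>i\<in>G. c i * b i l) * (\<Sum>i\<in>G. c i * b i m) * C l m) / 2))"
    by (rule gauss_vecD(4)[OF G])
  also have "(\<Sum>l\<in>F. \<Sum>m\<in>F. (\<Sum>i\<in>G. c i * b i l) * (\<Sum>i\<in>G. c i * b i m) * C l m) =
    (\<Sum>l\<in>F. \<Sum>m\<in>F. \<Sum>i\<in>G. \<Sum>j\<in>G. c i * c j * (b i l * b j m * C l m))"
    by (intro sum.cong refl, subst sum_product) (simp add: sum_distrib_right sum_distrib_left mult_ac)
  also have "\<dots> = (\<Sum>i\<in>G. \<Sum>j\<in>G. \<Sum>l\<in>F. \<Sum>m\<in>F. c i * c j * (b i l * b j m * C l m))"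
    by (rule sum_swap_blocks)
  also have "\<dots> = (\<Sum>i\<in>G. \<Sum>j\<in>G. c i * c j * (\<Sum>l\<in>F. \<Sum>m\<in>F. b i l * b j m * C l m))"
    by (simp add: sum_distrib_left)
  finally show "(CLINT \<omega>|M. iexp (\<Sum>i\<in>G. c i * (\<Sum>l\<in>F. b i l * X l \<omega>))) =
     of_real (exp (- (\<Sum>i\<in>G. \<Sum>j\<in>G. c i * c j * (\<Sum>l\<in>F. \<Sum>m\<in>F. b i l * b j m * C l m)) / 2))" .
qed (use gauss_vecD[OF G] G' in auto)

lemma gauss_vec_scale:
  fixes F :: "'i set"
  assumes G: "gauss_vec M F X C"
  shows "gauss_vec M F (\<lambda>i \<omega>. a i * X i \<omega>) (\<lambda>i j. a i * a j * C i j)"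
proof -
  have F: "finite F" using gauss_vecD[OF G] by simp
  have s: "(\<Sum>l\<in>F. (if l = i then a i else 0) * f l) = a i * f i" if "i \<in> F" for i and f :: "'i \<Rightarrow> real"
    using that F by (subst sum.mono_neutral_right[of F "{i}"]) auto
  show ?thesis
    by (rule gauss_vec_cong[OF gauss_vec_linear[OF G F, of "\<lambda>i l. if l = i then a i else 0"]])
       (simp_all add: s sum_distrib_left[symmetric] mult.assoc)
qed

lemma gauss_vec_reindex:
  fixes F :: "'i set" and G :: "'j set"
  assumes G: "gauss_vec M F X C" and G': "finite G" "\<And>i. i \<in> G \<Longrightarrow> f i \<in> F"
  shows "gauss_vec M G (\<lambda>i. X (f i)) (\<lambda>i j. C (f i) (f j))"
proof -
  have F: "finite F" using gauss_vecD[OF G] by simp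
  have s: "(\<Sum>l\<in>F. (if l = f i then 1 else 0) * h l) = h (f i)" if "i \<in> G" for i and h :: "'i \<Rightarrow> real"
    using G'(2)[OF that] F by (subst sum.mono_neutral_right[of F "{f i}"]) auto
  show ?thesis
    by (rule gauss_vec_cong[OF gauss_vec_linear[OF G G'(1), of "\<lambda>i l. if l = f i then 1 else 0"]])
       (simp_all add: s sum_distrib_left[symmetric] mult.assoc)
qed

lemma gauss_vec_add:
  fixes F :: "'i set"
  assumes G: "gauss_vec M F X C" "gauss_vec N F Y D"
  shows "gauss_vec (M \<Otimes>\<^sub>M N) F (\<lambda>i (x, y). X i x + Y i y) (\<lambda>i j. C i j + D i j)"
  unfolding gauss_vec_def
proof (intro conjI allI ballI)
  interpret M: prob_space M by (rule gauss_vecD[OF G(1)])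
  interpret N: prob_space N by (rule gauss_vecD[OF G(2)])
  interpret MN: pair_prob_space M N ..
  note [measurable] = gauss_vecD(3)[OF G(1)] gauss_vecD(3)[OF G(2)]
  show ps: "prob_space (M \<Otimes>\<^sub>M N)" by (intro prob_space_pair) unfold_locales
  show "finite F" using gauss_vecD[OF G(1)] by simp
  fix c
  let ?f = "\<lambda>x. iexp (\<Sum>i\<in>F. c i * X i x)" and ?g = "\<lambda>y. iexp (\<Sum>i\<in>F. c i * Y i y)"
  have "(CLINT \<omega>|M \<Otimes>\<^sub>M N. iexp (\<Sum>i\<in>F. c i * (case \<omega> of (x, y) \<Rightarrow> X i x + Y i y))) =
     (CLINT \<omega>|M \<Otimes>\<^sub>M N. (case \<omega> of (x, y) \<Rightarrow> ?f x * ?g y))"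
  proof -
    have "iexp (\<Sum>i\<in>F. c i * (X i x + Y i y)) = ?f x * ?g y" for x y
      by (simp only: distrib_left sum.distrib of_real_add exp_add)
    then show ?thesis by (simp only: case_prod_beta)
  qed
  also have "\<dots> = (CLINT x|M. CLINT y|N. ?f x * ?g y)"
    by (rule MN.integral_fst[symmetric], rule integrable_bounded[OF ps, of _ 1]) (auto simp: norm_mult)
  also have "\<dots> = (CLINT x|M. ?f x) * (CLINT y|N. ?g y)" by simp
  also have "\<dots> = of_real (exp (- (\<Sum>i\<in>F. \<Sum>j\<in>F. c i * c j * C i j) / 2)) * of_real (exp (- (\<Sum>i\<in>F. \<Sum>j\<in>F. c i * c j * D i j) / 2))"
    by (simp only: gauss_vecD(4)[OF G(1)] gauss_vecD(4)[OF G(2)])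
  also have "\<dots> = of_real (exp (- (\<Sum>i\<in>F. \<Sum>j\<in>F. c i * c j * (C i j + D i j)) / 2))"
    unfolding of_real_mult[symmetric] exp_add[symmetric]
    by (intro arg_cong[where f="\<lambda>x. complex_of_real (exp x)"]) (simp add: ring_distribs sum.distrib add_divide_distrib)
  finally show "(CLINT \<omega>|M \<Otimes>\<^sub>M N. iexp (\<Sum>i\<in>F. c i * (case \<omega> of (x, y) \<Rightarrow> X i x + Y i y))) =
    of_real (exp (- (\<Sum>i\<in>F. \<Sum>j\<in>F. c i * c j * (C i j + D i j)) / 2))" .
next
  fix i assume "i \<in> F"
  then have [measurable]: "X i \<in> borel_measurable M" "Y i \<in> borel_measurable N"
    using gauss_vecD(3)[OF G(1)] gauss_vecD(3)[OF G(2)] by auto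
  show "(\<lambda>(x, y). X i x + Y i y) \<in> borel_measurable (M \<Otimes>\<^sub>M N)" by measurable
qed

text \<open>
  Sums of independent Gaussian vectors with \<open>i\<close>-th summand read off the \<open>i\<close>-th coordinate of a product
  space. Independent copies on different blocks and vectors of independent normal variables are both
  obtained from this by letting most components of each summand vanish.
\<close>

lemma gauss_vec_PiM_sum:
  fixes F :: "'i set" and J :: "'j set"
  assumes J: "finite J" and F: "finite F" and G: "\<And>i. gauss_vec (M i) F (X i) (C i)"
  shows "gauss_vec (PiM J M) F (\<lambda>t \<omega>. \<Sum>i\<in>J. X i t (\<omega> i)) (\<lambda>s t. \<Sum>i\<in>J. C i s t)"
  unfolding gauss_vec_def
proof (intro conjI allI ballI)
  interpret prob_space "M i" for i by (rule gauss_vecD[OF G])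
  interpret P: product_prob_space M J ..
  note [measurable] = gauss_vecD(3)[OF G]
  show ps: "prob_space (PiM J M)" by (intro prob_space_PiM) unfold_locales
  have iexp_sum: "iexp (\<Sum>i\<in>J. a i) = (\<Prod>i\<in>J. iexp (a i))" for a :: "'j \<Rightarrow> real"
    using J by (simp add: exp_sum sum_distrib_left)
  fix c
  have "(CLINT \<omega>|PiM J M. iexp (\<Sum>t\<in>F. c t * (\<Sum>i\<in>J. X i t (\<omega> i)))) =
     (CLINT \<omega>|PiM J M. \<Prod>i\<in>J. iexp (\<Sum>t\<in>F. c t * X i t (\<omega> i)))"
  proof (rule Bochner_Integration.integral_cong[OF refl])
    fix \<omega>
    have "(\<Sum>t\<in>F. c t * (\<Sum>i\<in>J. X i t (\<omega> i))) = (\<Sum>i\<in>J. \<Sum>t\<in>F. c t * X i t (\<omega> i))"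
      unfolding sum_distrib_left by (rule sum.swap)
    then show "iexp (\<Sum>t\<in>F. c t * (\<Sum>i\<in>J. X i t (\<omega> i))) = (\<Prod>i\<in>J. iexp (\<Sum>t\<in>F. c t * X i t (\<omega> i)))"
      by (simp only: iexp_sum)
  qed
  also have "\<dots> = (\<Prod>i\<in>J. CLINT x|M i. iexp (\<Sum>t\<in>F. c t * X i t x))"
    by (intro P.product_integral_prod J integrable_bounded[OF gauss_vecD(1)[OF G], where B=1]) auto
  also have "\<dots> = (\<Prod>i\<in>J. of_real (exp (- (\<Sum>s\<in>F. \<Sum>t\<in>F. c s * c t * C i s t) / 2)))"
    by (simp only: gauss_vecD(4)[OF G])
  also have "\<dots> = of_real (exp (\<Sum>i\<in>J. - (\<Sum>s\<in>F. \<Sum>t\<in>F. c s * c t * C i s t) / 2))"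
    by (simp only: exp_sum[OF J] of_real_prod)
  also have "(\<Sum>i\<in>J. - (\<Sum>s\<in>F. \<Sum>t\<in>F. c s * c t * C i s t) / 2) = - (\<Sum>s\<in>F. \<Sum>t\<in>F. c s * c t * (\<Sum>i\<in>J. C i s t)) / 2"
  proof -
    have "(\<Sum>i\<in>J. \<Sum>s\<in>F. \<Sum>t\<in>F. c s * c t * C i s t) = (\<Sum>s\<in>F. \<Sum>t\<in>F. \<Sum>i\<in>J. c s * c t * C i s t)"
      using sum_swap_blocks[where f="\<lambda>_ i s t. c s * c t * C i s t" and F="{()}" and F'=J and G=F and G'=F] by simp
    also have "\<dots> = (\<Sum>s\<in>F. \<Sum>t\<in>F. c s * c t * (\<Sum>i\<in>J. C i s t))"
      by (simp only: sum_distrib_left)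
    finally show ?thesis by (simp only: sum_negf sum_divide_distrib[symmetric])
  qed
  finally show "(CLINT \<omega>|PiM J M. iexp (\<Sum>t\<in>F. c t * (\<Sum>i\<in>J. X i t (\<omega> i)))) =
    of_real (exp (- (\<Sum>s\<in>F. \<Sum>t\<in>F. c s * c t * (\<Sum>i\<in>J. C i s t)) / 2))" .
next
  show "finite F" by (rule F)
  fix t assume "t \<in> F"
  then have [measurable]: "X i t \<in> borel_measurable (M i)" for i
    by (rule gauss_vecD(3)[OF G])
  show "(\<lambda>\<omega>. \<Sum>i\<in>J. X i t (\<omega> i)) \<in> borel_measurable (PiM J M)" by measurable
qed

abbreviation std_normal :: "real measure" where
  "std_normal \<equiv> density lborel (\<lambda>x. ennreal (std_normal_density x))"

lemma gauss_vec_rank_one: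
  fixes F :: "'i set"
  assumes "finite F"
  shows "gauss_vec std_normal F (\<lambda>i x. v i * x) (\<lambda>i j. v i * v j)"
  unfolding gauss_vec_def
proof (intro conjI allI ballI)
  show "prob_space std_normal" by (rule prob_space_normal_density) simp
  fix c :: "'i \<Rightarrow> real"
  have "(CLINT x|std_normal. iexp (\<Sum>i\<in>F. c i * (v i * x))) = char std_normal (\<Sum>i\<in>F. c i * v i)"
  proof -
    have "(\<Sum>i\<in>F. c i * (v i * x)) = (\<Sum>i\<in>F. c i * v i) * x" for x
      by (simp add: sum_distrib_right mult.assoc)
    then show ?thesis unfolding char_def by simp
  qed
  also have "\<dots> = of_real (exp (- ((\<Sum>i\<in>F. c i * v i)^2) / 2))"
    by (simp only: char_std_normal_distribution)
  also have "(\<Sum>i\<in>F. c i * v i)^2 = (\<Sum>i\<in>F. \<Sum>j\<in>F. c i * c j * (v i * v j))"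
    unfolding power2_eq_square sum_product by (simp add: mult_ac)
  finally show "(CLINT x|std_normal. iexp (\<Sum>i\<in>F. c i * (v i * x))) =
    of_real (exp (- (\<Sum>i\<in>F. \<Sum>j\<in>F. c i * c j * (v i * v j)) / 2))" .
qed (use assms in auto)

lemma gauss_vec_iid:
  fixes F :: "'i set"
  assumes "finite F"
  shows "gauss_vec (PiM F (\<lambda>_. std_normal)) F (\<lambda>i x. x i) (\<lambda>i j. if i = j then 1 else 0)"
proof -
  have s: "(\<Sum>i\<in>F. (if s = i then 1 else 0) * f i) = f s" if "s \<in> F" for s and f :: "'i \<Rightarrow> real"
    using that assms by (subst sum.mono_neutral_right[of F "{s}"]) auto
  have r: "gauss_vec std_normal F (\<lambda>s x. (if s = i then 1 else 0) * x) (\<lambda>s t. (if s = i then 1 else 0) * (if t = i then 1 else 0))" for i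
    by (rule gauss_vec_rank_one[OF assms])
  show ?thesis
    by (rule gauss_vec_cong[OF gauss_vec_PiM_sum[where X="\<lambda>i s x. (if s = i then 1 else 0) * x" and C="\<lambda>i s t. (if s = i then 1 else 0) * (if t = i then 1 else 0)", OF assms assms r]]) (simp_all add: s)
qed

section \<open>Covariance matrices and orthant probabilities\<close>

text \<open>
  By uniqueness of the law, a Gaussian vector may be replaced by its covariance, and the probability
  that it lies below \<open>u\<close> is a function of the covariance. Comparison arguments can then pass through
  a chain of covariances realized on different probability spaces.
\<close>

definition gaussian_cov :: "'i set \<Rightarrow> ('i \<Rightarrow> 'i \<Rightarrow> real) \<Rightarrow> bool" where
  "gaussian_cov F C \<longleftrightarrow> (\<exists>M :: ('i \<Rightarrow> real) measure. gauss_vec M F (\<lambda>i x. x i) C)"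

definition orthant :: "'i set \<Rightarrow> ('i \<Rightarrow> 'i \<Rightarrow> real) \<Rightarrow> ('i \<Rightarrow> real) \<Rightarrow> real" where
  "orthant F C u = (let M = (SOME M :: ('i \<Rightarrow> real) measure. gauss_vec M F (\<lambda>i x. x i) C)
     in measure M {x\<in>space M. \<forall>i\<in>F. x i \<le> u i})"

lemma gaussian_covI: "gauss_vec M F X C \<Longrightarrow> gaussian_cov F C"
  unfolding gaussian_cov_def using gauss_vec_canonical by blast

lemma orthant_eq:
  assumes "gauss_vec M F X C"
  shows "measure M {\<omega>\<in>space M. \<forall>i\<in>F. X i \<omega> \<le> u i} = orthant F C u"
proof -
  have "gauss_vec (SOME M. gauss_vec M F (\<lambda>i x. x i) C) F (\<lambda>i x. x i) C"
    using gauss_vec_canonical[OF assms] by (rule someI)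
  from gauss_vec_rectangle[OF assms this, of "\<lambda>i. {..u i}"] show ?thesis
    by (simp add: orthant_def Let_def)
qed

lemma gaussian_cov_finite: "gaussian_cov F C \<Longrightarrow> finite F"
  unfolding gaussian_cov_def using gauss_vecD(2) by blast

lemma gaussian_cov_cong:
  assumes "gaussian_cov F C" "\<And>i j. i \<in> F \<Longrightarrow> j \<in> F \<Longrightarrow> C i j = D i j"
  shows "gaussian_cov F D" and "orthant F C u = orthant F D u"
proof -
  obtain M where M: "gauss_vec M F (\<lambda>i x. x i) C" using assms(1) unfolding gaussian_cov_def by blast
  have D: "gauss_vec M F (\<lambda>i x. x i) D" by (rule gauss_vec_cong[OF M]) (use assms(2) in auto)
  show "gaussian_cov F D" by (rule gaussian_covI[OF D])
  show "orthant F C u = orthant F D u" using orthant_eq[OF D, of u] orthant_eq[OF M, of u] by simp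
qed

lemma gaussian_cov_add:
  assumes "gaussian_cov F C" "gaussian_cov F D"
  shows "gaussian_cov F (\<lambda>i j. C i j + D i j)"
  using assms gauss_vec_add gaussian_covI unfolding gaussian_cov_def by blast

lemma gaussian_cov_rank_one:
  assumes "finite F" shows "gaussian_cov F (\<lambda>i j. v i * v j)"
  using gauss_vec_rank_one[OF assms] by (rule gaussian_covI)

lemma gaussian_cov_scale:
  assumes "gaussian_cov F C" "0 \<le> a"
  shows "gaussian_cov F (\<lambda>i j. a * C i j)"
proof -
  obtain M where M: "gauss_vec M F (\<lambda>i x. x i) C" using assms(1) unfolding gaussian_cov_def by blast
  show ?thesis
    by (rule gaussian_cov_cong(1)[OF gaussian_covI[OF gauss_vec_scale[OF M, of "\<lambda>_. sqrt a"]]]) (use assms in auto)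
qed

lemma gaussian_cov_sum:
  assumes F: "finite F" and "finite P" "\<And>p. p \<in> P \<Longrightarrow> gaussian_cov F (D p)"
  shows "gaussian_cov F (\<lambda>i j. \<Sum>p\<in>P. D p i j)"
  using assms(2,3)
proof (induction P rule: finite_induct)
  case empty show ?case using gaussian_cov_rank_one[OF F, of "\<lambda>_. 0"] by simp
next
  case (insert p P)
  then show ?case using gaussian_cov_add[of F "D p" "\<lambda>i j. \<Sum>p\<in>P. D p i j"] by simp
qed

lemma gaussian_cov_diag:
  fixes F :: "'i set"
  assumes F: "finite F" and d: "\<And>i. i \<in> F \<Longrightarrow> 0 \<le> d i"
  shows "gaussian_cov F (\<lambda>i j. if i = j then d i else 0)"
proof -
  have "gaussian_cov F (\<lambda>i j. \<Sum>k\<in>F. (if i = k then sqrt (d k) else 0) * (if j = k then sqrt (d k) else 0))"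
    by (intro gaussian_cov_sum[OF F F] gaussian_cov_rank_one[OF F, of "\<lambda>i. if i = k then sqrt (d k) else 0" for k])
  moreover have "(\<Sum>k\<in>F. (if i = k then sqrt (d k) else 0) * (if j = k then sqrt (d k) else 0)) = (if i = j then d i else 0)"
    if "i \<in> F" "j \<in> F" for i j
    using F that d[of i] by (subst sum.mono_neutral_right[of F "{i}"]) auto
  ultimately show ?thesis by (rule gaussian_cov_cong(1)) auto
qed

section \<open>Slepian's inequality\<close>

text \<open>
  The vector \<open>e\<^sub>i + s e\<^sub>j\<close>; it is used with \<open>s = 1\<close> and \<open>s = - 1\<close>.
\<close>

definition pair_dir :: "real \<Rightarrow> 'i \<Rightarrow> 'i \<Rightarrow> 'i \<Rightarrow> real" where
  "pair_dir s i j k = (if k = i then 1 else 0) + s * (if k = j then 1 else 0)"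

text \<open>
  The elementary case of Slepian's inequality: one normal variable \<open>y\<close> enters the coordinates \<open>i\<close>
  and \<open>j\<close> with opposite signs on the left and with equal signs on the right. Given the rest of the
  vector, the constraints on \<open>y\<close> are two half-lines. Of two nested half-lines the intersection is the
  smaller one, so equal signs give the minimum of the two probabilities. Reflecting one half-line
  preserves its probability, and no intersection can have more than the minimum.
\<close>

lemma orthant_pair_move:
  fixes F :: "'i set"
  assumes D: "gaussian_cov F D" and w: "0 \<le> w" "i = j \<Longrightarrow> w = 0" and ijF: "i \<in> F" "j \<in> F"
  shows "orthant F (\<lambda>k l. D k l + w * (pair_dir (-1) i j k * pair_dir (-1) i j l)) u
       \<le> orthant F (\<lambda>k l. D k l + w * (pair_dir 1 i j k * pair_dir 1 i j l)) u"
proof -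
  have F: "finite F" using D by (rule gaussian_cov_finite)
  define \<delta> where "\<delta> = sqrt w"
  have \<delta>: "\<delta> \<ge> 0" "\<delta> * \<delta> = w" "i = j \<Longrightarrow> \<delta> = 0" using w by (auto simp: \<delta>_def)
  obtain M where M: "gauss_vec M F (\<lambda>i x. x i) D" using D unfolding gaussian_cov_def by blast
  interpret M: prob_space M by (rule gauss_vecD[OF M])
  interpret S: prob_space std_normal by (rule prob_space_normal_density) simp
  note [measurable] = gauss_vecD(3)[OF M]
  define v where "v s k = \<delta> * pair_dir s i j k" for s k
  have G: "gauss_vec (M \<Otimes>\<^sub>M std_normal) F (\<lambda>k (x, y). x k + v s k * y) (\<lambda>k l. D k l + w * (pair_dir s i j k * pair_dir s i j l))" for s
    by (rule gauss_vec_cong[OF gauss_vec_add[OF M gauss_vec_rank_one[OF F, of "v s"]]])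
       (auto simp: v_def \<delta>(2)[symmetric])
  define B where "B s = {\<omega>\<in>space (M \<Otimes>\<^sub>M std_normal). \<forall>k\<in>F. (case \<omega> of (x, y) \<Rightarrow> x k + v s k * y) \<le> u k}" for s
  have Bm[measurable]: "B s \<in> sets (M \<Otimes>\<^sub>M std_normal)" for s
    unfolding B_def using F by measurable
  have o: "orthant F (\<lambda>k l. D k l + w * (pair_dir s i j k * pair_dir s i j l)) u = measure (M \<Otimes>\<^sub>M std_normal) (B s)" for s
    unfolding B_def by (rule orthant_eq[OF G, symmetric])
  have sym: "measure std_normal {y. - \<delta> * y \<le> b} = measure std_normal {y. \<delta> * y \<le> b}" for b
  proof -
    have 1: "gauss_vec std_normal {()} (\<lambda>_ x. \<delta> * x) (\<lambda>_ _. \<delta> * \<delta>)" by (rule gauss_vec_rank_one) simp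
    have 2: "gauss_vec std_normal {()} (\<lambda>_ x. - \<delta> * x) (\<lambda>_ _. \<delta> * \<delta>)"
      using gauss_vec_rank_one[of "{()}" "\<lambda>_. - \<delta>"] by simp
    show ?thesis using gauss_vec_rectangle[OF 2 1, of "\<lambda>_. {..b}"] by simp
  qed
  have fib: "Pair x -` B s = {y. \<forall>k\<in>F. x k + v s k * y \<le> u k}" if "x \<in> space M" for x s
    using that by (auto simp: B_def space_pair_measure)
  have le: "emeasure std_normal (Pair x -` B (-1)) \<le> emeasure std_normal (Pair x -` B 1)" if x: "x \<in> space M" for x
  proof (cases "i = j")
    case True then show ?thesis unfolding fib[OF x] v_def by (simp add: \<delta>)
  next
    case False
    then have ij: "i \<noteq> j" "i \<in> F" "j \<in> F" using ijF by auto
    define a where "a = u i - x i"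
    define b where "b = u j - x j"
    define R where "R = (\<forall>k\<in>F. k \<noteq> i \<and> k \<noteq> j \<longrightarrow> x k \<le> u k)"
    have E: "{y. \<forall>k\<in>F. x k + v s k * y \<le> u k} = {y. R \<and> \<delta> * y \<le> a \<and> \<delta> * s * y \<le> b}" for s
    proof (intro Collect_cong iffI)
      fix y assume *: "\<forall>k\<in>F. x k + v s k * y \<le> u k"
      from bspec[OF this ij(2)] bspec[OF this ij(3)] have "\<delta> * y \<le> a" "\<delta> * s * y \<le> b"
        using ij(1) by (simp_all add: a_def b_def v_def pair_dir_def)
      moreover have R unfolding R_def
      proof (intro ballI impI)
        fix k assume "k \<in> F" "k \<noteq> i \<and> k \<noteq> j"
        with bspec[OF * this(1)] show "x k \<le> u k" by (simp add: v_def pair_dir_def)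
      qed
      ultimately show "R \<and> \<delta> * y \<le> a \<and> \<delta> * s * y \<le> b" by simp
    next
      fix y assume "R \<and> \<delta> * y \<le> a \<and> \<delta> * s * y \<le> b"
      then show "\<forall>k\<in>F. x k + v s k * y \<le> u k"
        using ij(1) by (auto simp: a_def b_def v_def pair_dir_def R_def)
    qed
    show ?thesis
    proof (cases R)
      case True
      have m: "{y. \<delta> * y \<le> c} \<in> sets std_normal" "{y. - \<delta> * y \<le> c} \<in> sets std_normal" for c by measurable
      have "measure std_normal {y. \<delta> * y \<le> a \<and> - \<delta> * y \<le> b} \<le> measure std_normal {y. \<delta> * y \<le> a}"
        by (intro S.finite_measure_mono m) auto
      moreover have "measure std_normal {y. \<delta> * y \<le> a \<and> - \<delta> * y \<le> b} \<le> measure std_normal {y. - \<delta> * y \<le> b}"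
        by (intro S.finite_measure_mono m) auto
      moreover have "{y. \<delta> * y \<le> a \<and> \<delta> * y \<le> b} = (if a \<le> b then {y. \<delta> * y \<le> a} else {y. \<delta> * y \<le> b})" by auto
      ultimately show ?thesis unfolding fib[OF x] E S.emeasure_eq_measure using True sym[of b] by (simp split: if_splits)
    next
      case False then show ?thesis unfolding fib[OF x] E by simp
    qed
  qed
  interpret P: prob_space "M \<Otimes>\<^sub>M std_normal" by (rule gauss_vecD(1)[OF G])
  have "emeasure (M \<Otimes>\<^sub>M std_normal) (B (-1)) \<le> emeasure (M \<Otimes>\<^sub>M std_normal) (B 1)"
    unfolding S.emeasure_pair_measure_alt[OF Bm] by (intro nn_integral_mono le)
  then show ?thesis unfolding o by (simp add: P.emeasure_eq_measure)
qed

text \<open>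
  A sum of pair moves: the terms of the sum that are not being moved are part of the covariance
  common to both sides.
\<close>

lemma orthant_pair_moves:
  fixes F :: "'i set" and P :: "('i \<times> 'i) set"
  assumes P: "finite P" "P \<subseteq> F \<times> F" and D: "gaussian_cov F D" and w: "\<And>p. 0 \<le> w p" "\<And>i. w (i, i) = 0"
  shows "orthant F (\<lambda>k l. D k l + (\<Sum>p\<in>P. w p * (pair_dir (-1) (fst p) (snd p) k * pair_dir (-1) (fst p) (snd p) l))) u
       \<le> orthant F (\<lambda>k l. D k l + (\<Sum>p\<in>P. w p * (pair_dir 1 (fst p) (snd p) k * pair_dir 1 (fst p) (snd p) l))) u"
  using P D
proof (induction P arbitrary: D rule: finite_induct)
  case empty then show ?case by simp
next
  case (insert p P)
  have F: "finite F" using insert.prems(2) by (rule gaussian_cov_finite)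
  let ?T = "\<lambda>s p k l. w p * (pair_dir s (fst p) (snd p) k * pair_dir s (fst p) (snd p) l)"
  have T: "gaussian_cov F (?T s p)" for s p
    by (intro gaussian_cov_scale w gaussian_cov_rank_one F)
  have "orthant F (\<lambda>k l. (D k l + ?T (-1) p k l) + (\<Sum>p\<in>P. ?T (-1) p k l)) u \<le> orthant F (\<lambda>k l. (D k l + ?T (-1) p k l) + (\<Sum>p\<in>P. ?T 1 p k l)) u"
    using insert.prems by (intro insert.IH gaussian_cov_add T) auto
  also have "\<dots> = orthant F (\<lambda>k l. (D k l + (\<Sum>p\<in>P. ?T 1 p k l)) + ?T (-1) p k l) u"
    by (simp only: add_ac)
  also have "\<dots> \<le> orthant F (\<lambda>k l. (D k l + (\<Sum>p\<in>P. ?T 1 p k l)) + ?T 1 p k l) u"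
  proof (rule orthant_pair_move)
    show "gaussian_cov F (\<lambda>k l. D k l + (\<Sum>p\<in>P. ?T 1 p k l))"
      by (intro gaussian_cov_add gaussian_cov_sum T insert.prems(2) F insert.hyps)
    show "w p = 0" if "fst p = snd p" using w(2)[of "fst p"] that by (metis prod.collapse)
  qed (use insert.prems w in auto)
  finally show ?case using insert.hyps by (simp add: add_ac)
qed

lemma sum_delta_mult:
  fixes f :: "'i \<Rightarrow> real"
  assumes "finite F" "k \<in> F"
  shows "(\<Sum>a\<in>F. f a * (if k = a then 1 else 0)) = f k"
  using assms by (subst sum.mono_neutral_right[of F "{k}"]) auto

text \<open>
  Pair directions with weights \<open>w\<close> change the entry \<open>k, l\<close> by \<open>s * (w k l + w l k)\<close> off the diagonal,
  while their contribution to the diagonal is the same for both signs \<open>s\<close>.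
\<close>

lemma sum_pair_dir:
  fixes w :: "'i \<Rightarrow> 'i \<Rightarrow> real"
  assumes F: "finite F" and kl: "k \<in> F" "l \<in> F" and s: "s * s = 1"
  shows "(\<Sum>p\<in>F\<times>F. w (fst p) (snd p) * (pair_dir s (fst p) (snd p) k * pair_dir s (fst p) (snd p) l)) =
    (if k = l then (\<Sum>b\<in>F. w k b) + (\<Sum>a\<in>F. w a k) else 0) + s * (w k l + w l k)"
proof -
  let ?i = "\<lambda>a b. if a = b then 1 else (0::real)"
  have "(\<Sum>p\<in>F\<times>F. w (fst p) (snd p) * (pair_dir s (fst p) (snd p) k * pair_dir s (fst p) (snd p) l)) =
    (\<Sum>a\<in>F. \<Sum>b\<in>F. w a b * (pair_dir s a b k * pair_dir s a b l))"
    by (simp add: sum.cartesian_product case_prod_beta)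
  also have "\<dots> = (\<Sum>a\<in>F. \<Sum>b\<in>F. (w a b * ?i k a) * ?i l a + s * ((w a b * ?i l b) * ?i k a) + s * ((w a b * ?i k b) * ?i l a) + (w a b * ?i k b) * ?i l b)"
  proof (intro sum.cong refl)
    fix a b
    have "x * ((p + s * q) * (r + s * t)) = (x * p) * r + s * ((x * t) * p) + s * ((x * q) * r) + (x * q) * t" for x p q r t :: real
    proof -
      have "x * ((p + s * q) * (r + s * t)) = (x * p) * r + s * ((x * t) * p) + s * ((x * q) * r) + (s * s) * ((x * q) * t)"
        by algebra
      then show ?thesis using s by simp
    qed
    then show "w a b * (pair_dir s a b k * pair_dir s a b l) = (w a b * ?i k a) * ?i l a + s * ((w a b * ?i l b) * ?i k a) + s * ((w a b * ?i k b) * ?i l a) + (w a b * ?i k b) * ?i l b"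
      unfolding pair_dir_def .
  qed
  also have "\<dots> = (\<Sum>a\<in>F. \<Sum>b\<in>F. (w a b * ?i k a) * ?i l a) + s * (\<Sum>a\<in>F. (\<Sum>b\<in>F. w a b * ?i l b) * ?i k a)
     + s * (\<Sum>a\<in>F. (\<Sum>b\<in>F. w a b * ?i k b) * ?i l a) + (\<Sum>a\<in>F. \<Sum>b\<in>F. (w a b * ?i k b) * ?i l b)"
    by (simp only: sum.distrib sum_distrib_left sum_distrib_right)
  also have "(\<Sum>a\<in>F. \<Sum>b\<in>F. (w a b * ?i k a) * ?i l a) = (\<Sum>a\<in>F. ((\<Sum>b\<in>F. w a b) * ?i k a) * ?i l a)"
    by (simp only: sum_distrib_right)
  also have "\<dots> = (\<Sum>b\<in>F. w l b) * ?i k l" by (rule sum_delta_mult[OF F kl(2)])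
  also have "(\<Sum>a\<in>F. \<Sum>b\<in>F. (w a b * ?i k b) * ?i l b) = (\<Sum>a\<in>F. w a l * ?i k l)"
    by (simp only: sum_delta_mult[OF F kl(2)])
  also have "(\<Sum>a\<in>F. (\<Sum>b\<in>F. w a b * ?i l b) * ?i k a) = w k l" by (simp only: sum_delta_mult[OF F kl(2)] sum_delta_mult[OF F kl(1)])
  also have "(\<Sum>a\<in>F. (\<Sum>b\<in>F. w a b * ?i k b) * ?i l a) = w l k" by (simp only: sum_delta_mult[OF F kl(2)] sum_delta_mult[OF F kl(1)])
  finally show ?thesis by (auto simp: algebra_simps)
qed

text \<open>
  Moving along the segment from \<open>C\<close> to \<open>C'\<close> by a small step \<open>h\<close>. Both end points of the step arise from
  its midpoint by pair moves, with opposite signs, of weight proportional to the increments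
  \<open>C' i j - C i j\<close>. Pair moves add the same positive amount to the diagonal at both ends, which has to be
  subtracted from the midpoint; the diagonal term \<open>\<sigma>\<close> leaves room for this if \<open>h\<close> is small.
\<close>

lemma orthant_small_step:
  fixes F :: "'i set"
  assumes C: "gaussian_cov F C" and C': "gaussian_cov F C'"
    and sym: "\<And>i j. i \<in> F \<Longrightarrow> j \<in> F \<Longrightarrow> C i j = C j i" "\<And>i j. i \<in> F \<Longrightarrow> j \<in> F \<Longrightarrow> C' i j = C' j i"
    and diag: "\<And>i. i \<in> F \<Longrightarrow> C i i = C' i i"
    and le: "\<And>i j. i \<in> F \<Longrightarrow> j \<in> F \<Longrightarrow> C i j \<le> C' i j"
    and h: "0 \<le> h" "0 \<le> \<theta>" "\<theta> + h \<le> 1" "h * (\<Sum>i\<in>F. \<Sum>j\<in>F. C' i j - C i j) \<le> \<sigma>"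
  shows "orthant F (\<lambda>i j. (1 - \<theta>) * C i j + \<theta> * C' i j + (if i = j then \<sigma> else 0)) u
       \<le> orthant F (\<lambda>i j. (1 - (\<theta> + h)) * C i j + (\<theta> + h) * C' i j + (if i = j then \<sigma> else 0)) u"
proof -
  have F: "finite F" using C by (rule gaussian_cov_finite)
  \<comment> \<open>Each unordered pair occurs twice, and the midpoint is half a step away: hence the divisor 4.\<close>
  define w where "w i j = (if i \<in> F \<and> j \<in> F then h * (C' i j - C i j) / 4 else 0)" for i j
  have w0: "0 \<le> w i j" for i j using le[of i j] h(1) by (auto simp: w_def)
  have wd: "w i i = 0" for i using diag by (auto simp: w_def)
  have ws: "w i j = w j i" for i j using sym[of i j] by (auto simp: w_def)
  define r where "r k = (\<Sum>b\<in>F. w k b)" for k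
  have r2: "2 * r k \<le> \<sigma>" if k: "k \<in> F" for k
  proof -
    have "r k \<le> (\<Sum>i\<in>F. \<Sum>j\<in>F. w i j)" unfolding r_def
      using k by (intro member_le_sum[of k F "\<lambda>k. \<Sum>b\<in>F. w k b"] F sum_nonneg w0) auto
    also have "\<dots> = (\<Sum>i\<in>F. \<Sum>j\<in>F. h / 4 * (C' i j - C i j))"
      by (intro sum.cong refl) (simp add: w_def)
    also have "\<dots> = h * (\<Sum>i\<in>F. \<Sum>j\<in>F. C' i j - C i j) / 4"
      by (simp add: sum_distrib_left sum_divide_distrib)
    finally have "4 * r k \<le> \<sigma>" using h(4) by simp
    moreover have "0 \<le> r k" unfolding r_def by (intro sum_nonneg w0)
    ultimately show ?thesis by simp
  qed
  define D where "D i j = (1 - (\<theta> + h / 2)) * C i j + (\<theta> + h / 2) * C' i j + (if i = j then \<sigma> - 2 * r i else 0)" for i j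
  have D: "gaussian_cov F D" unfolding D_def
    using h r2 by (intro gaussian_cov_add gaussian_cov_scale C C' gaussian_cov_diag F) auto
  let ?T = "\<lambda>s k l. \<Sum>p\<in>F\<times>F. w (fst p) (snd p) * (pair_dir s (fst p) (snd p) k * pair_dir s (fst p) (snd p) l)"
  have T: "D k l + ?T s k l = (1 - (\<theta> + h / 2 + s * h / 2)) * C k l + (\<theta> + h / 2 + s * h / 2) * C' k l + (if k = l then \<sigma> else 0)"
    if kl: "k \<in> F" "l \<in> F" and s: "s * s = 1" for k l s
  proof -
    have "(\<Sum>a\<in>F. w a k) = r k" unfolding r_def using ws by (intro sum.cong) auto
    then have "?T s k l = (if k = l then 2 * r k else 0) + s * (2 * w k l)"
      unfolding sum_pair_dir[OF F kl s] using ws[of k l] by (auto simp: r_def)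
    then have Ts: "?T s k l = (if k = l then 2 * r k else 0) + s * (h * (C' k l - C k l) / 2)"
      using kl by (simp add: w_def)
    have lin: "(1 - a) * c + a * c' + s * (h * (c' - c) / 2) = (1 - (a + s * h / 2)) * c + (a + s * h / 2) * c'" for a c c' :: real
      by (simp add: algebra_simps add_divide_distrib diff_divide_distrib)
    have "D k l + ?T s k l = ((1 - (\<theta> + h / 2)) * C k l + (\<theta> + h / 2) * C' k l + s * (h * (C' k l - C k l) / 2)) + (if k = l then \<sigma> else 0)"
      unfolding Ts D_def by simp
    then show ?thesis unfolding lin .
  qed
  have G: "gaussian_cov F (\<lambda>k l. D k l + ?T s k l)" for s
    by (intro gaussian_cov_add D gaussian_cov_sum gaussian_cov_scale gaussian_cov_rank_one F) (use F w0 in auto)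
  have "orthant F (\<lambda>k l. D k l + ?T (-1) k l) u \<le> orthant F (\<lambda>k l. D k l + ?T 1 k l) u"
    using F D w0 wd by (intro orthant_pair_moves) auto
  moreover have "orthant F (\<lambda>k l. D k l + ?T (-1) k l) u = orthant F (\<lambda>i j. (1 - \<theta>) * C i j + \<theta> * C' i j + (if i = j then \<sigma> else 0)) u"
    by (rule gaussian_cov_cong(2)[OF G]) (subst T, simp_all add: algebra_simps)
  moreover have "orthant F (\<lambda>k l. D k l + ?T 1 k l) u = orthant F (\<lambda>i j. (1 - (\<theta> + h)) * C i j + (\<theta> + h) * C' i j + (if i = j then \<sigma> else 0)) u"
    by (rule gaussian_cov_cong(2)[OF G]) (subst T, simp_all add: algebra_simps)
  ultimately show ?thesis by simp
qed

lemma slepian_regularized: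
  fixes F :: "'i set"
  assumes C: "gaussian_cov F C" and C': "gaussian_cov F C'"
    and sym: "\<And>i j. i \<in> F \<Longrightarrow> j \<in> F \<Longrightarrow> C i j = C j i" "\<And>i j. i \<in> F \<Longrightarrow> j \<in> F \<Longrightarrow> C' i j = C' j i"
    and diag: "\<And>i. i \<in> F \<Longrightarrow> C i i = C' i i"
    and le: "\<And>i j. i \<in> F \<Longrightarrow> j \<in> F \<Longrightarrow> C i j \<le> C' i j"
    and \<sigma>: "0 < \<sigma>"
  shows "orthant F (\<lambda>i j. C i j + (if i = j then \<sigma> else 0)) u \<le> orthant F (\<lambda>i j. C' i j + (if i = j then \<sigma> else 0)) u"
proof -
  define S where "S = (\<Sum>i\<in>F. \<Sum>j\<in>F. C' i j - C i j)"
  \<comment> \<open>With \<open>m\<close> steps of length \<open>1 / m\<close>, the diagonal term \<open>\<sigma>\<close> is large enough for every step.\<close>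
  obtain m :: nat where m: "S / \<sigma> < real m" using reals_Archimedean2 by blast
  have "0 \<le> S" unfolding S_def using le by (intro sum_nonneg) auto
  then have "0 \<le> S / \<sigma>" using \<sigma> by simp
  then have m0: "0 < real m" using m by linarith
  have mS: "1 / real m * S \<le> \<sigma>" using m m0 \<sigma> by (simp add: field_simps)
  let ?O = "\<lambda>\<theta>. orthant F (\<lambda>i j. (1 - \<theta>) * C i j + \<theta> * C' i j + (if i = j then \<sigma> else 0)) u"
  have "?O 0 \<le> ?O (real n / real m)" if "n \<le> m" for n
    using that
  proof (induction n)
    case (Suc n)
    have "real (Suc n) \<le> real m" using Suc.prems by (simp only: of_nat_le_iff)
    then have "real n / real m + 1 / real m \<le> 1" using m0 by (simp add: field_simps)
    then have "?O (real n / real m) \<le> ?O (real n / real m + 1 / real m)"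
      using m0 mS by (intro orthant_small_step[OF C C' sym diag le]) (simp_all add: S_def)
    also have "real n / real m + 1 / real m = real (Suc n) / real m" by (simp add: add_divide_distrib)
    finally show ?case using Suc by linarith
  qed simp
  from this[of m] show ?thesis using m0 by simp
qed

lemma sets_orthant:
  assumes "finite F" "\<And>i. i \<in> F \<Longrightarrow> X i \<in> borel_measurable M"
  shows "{\<omega>\<in>space M. \<forall>i\<in>F. X i \<omega> \<le> (u i :: real)} \<in> sets M"
proof -
  note [measurable] = assms(2)
  show ?thesis using assms(1) by measurable
qed

text \<open>
  The probability that independent normal noise of standard deviation \<open>1 / Suc n\<close> exceeds \<open>\<eta>\<close> in some
  coordinate.
\<close>

definition noise_tail :: "'i set \<Rightarrow> real \<Rightarrow> nat \<Rightarrow> real" where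
  "noise_tail F \<eta> n = measure (PiM F (\<lambda>_. std_normal))
     {x\<in>space (PiM F (\<lambda>_. std_normal)). \<exists>i\<in>F. \<eta> * real (Suc n) < \<bar>x i\<bar>}"

lemma noise_tail_tendsto_0:
  fixes F :: "'i set"
  assumes F: "finite F" and \<eta>: "0 < \<eta>"
  shows "noise_tail F \<eta> \<longlonglongrightarrow> 0"
proof -
  let ?M = "PiM F (\<lambda>_. std_normal) :: ('i \<Rightarrow> real) measure"
  let ?A = "\<lambda>n. {x\<in>space ?M. \<exists>i\<in>F. \<eta> * real (Suc n) < \<bar>x i\<bar>}"
  interpret prob_space ?M by (rule gauss_vecD(1)[OF gauss_vec_iid[OF F]])
  have "(\<lambda>n. measure ?M (?A n)) \<longlonglongrightarrow> measure ?M (\<Inter>n. ?A n)"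
  proof (rule finite_Lim_measure_decseq)
    have "?A n \<in> sets ?M" for n using F by measurable
    then show "range ?A \<subseteq> sets ?M" by blast
    show "decseq ?A"
    proof (rule decseq_SucI, rule subsetI)
      fix n x assume "x \<in> ?A (Suc n)"
      moreover have "\<eta> * real (Suc n) \<le> \<eta> * real (Suc (Suc n))" using \<eta> by simp
      ultimately show "x \<in> ?A n" by (auto intro: le_less_trans)
    qed
  qed
  moreover have "(\<Inter>n. ?A n) = {}"
  proof (rule ccontr)
    assume "(\<Inter>n. ?A n) \<noteq> {}"
    then obtain x where x: "\<And>n. \<exists>i\<in>F. \<eta> * real (Suc n) < \<bar>x i\<bar>" by auto
    obtain n :: nat where n: "(\<Sum>i\<in>F. \<bar>x i\<bar>) / \<eta> < real n" using reals_Archimedean2 by blast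
    obtain i where i: "i \<in> F" "\<eta> * real (Suc n) < \<bar>x i\<bar>" using x by blast
    have "\<bar>x i\<bar> \<le> (\<Sum>i\<in>F. \<bar>x i\<bar>)" using i F by (intro member_le_sum) auto
    also have "\<dots> < \<eta> * real n" using n \<eta> by (simp add: field_simps)
    also have "\<dots> \<le> \<eta> * real (Suc n)" using \<eta> by simp
    finally show False using i by simp
  qed
  ultimately show ?thesis unfolding noise_tail_def[abs_def] by simp
qed

text \<open>
  Independent noise of variance \<open>(1 / Suc n)\<^sup>2\<close> in each coordinate shifts the thresholds by at most \<open>\<eta>\<close>,
  except on the event measured by \<open>noise_tail\<close>.
\<close>

lemma orthant_noise:
  fixes F :: "'i set"
  assumes C: "gaussian_cov F C" and \<eta>: "0 < \<eta>"
  defines "Q n \<equiv> (\<lambda>i j. C i j + (if i = j then (1 / real (Suc n))^2 else 0))"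
  shows "orthant F C u \<le> orthant F (Q n) (\<lambda>i. u i + \<eta>) + noise_tail F \<eta> n"
    and "orthant F (Q n) u \<le> orthant F C (\<lambda>i. u i + \<eta>) + noise_tail F \<eta> n"
proof -
  have F: "finite F" using C by (rule gaussian_cov_finite)
  obtain M where M: "gauss_vec M F (\<lambda>i x. x i) C" using C unfolding gaussian_cov_def by blast
  let ?N = "PiM F (\<lambda>_. std_normal) :: ('i \<Rightarrow> real) measure"
  let ?P = "M \<Otimes>\<^sub>M ?N"
  define s where "s = 1 / real (Suc n)"
  have s: "s > 0" by (simp add: s_def)
  have N: "gauss_vec ?N F (\<lambda>i x. s * x i) (\<lambda>i j. if i = j then s^2 else 0)"
    by (rule gauss_vec_cong[OF gauss_vec_scale[OF gauss_vec_iid[OF F], of "\<lambda>_. s"]]) (auto simp: power2_eq_square)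
  have G: "gauss_vec ?P F (\<lambda>i (x, y). x i + s * y i) (Q n)"
    by (rule gauss_vec_cong[OF gauss_vec_add[OF M N]]) (auto simp: Q_def s_def)
  interpret M: prob_space M by (rule gauss_vecD[OF M])
  interpret N: prob_space ?N by (rule gauss_vecD[OF N])
  interpret P: prob_space ?P by (rule gauss_vecD[OF G])
  interpret MN: pair_prob_space M ?N ..
  let ?E = "{x\<in>space ?N. \<exists>i\<in>F. \<eta> * real (Suc n) < \<bar>x i\<bar>}"
  have E[measurable]: "?E \<in> sets ?N" using F by measurable
  have tail: "measure ?P (space M \<times> ?E) = noise_tail F \<eta> n"
    using N.emeasure_pair_measure_Times[of "space M" M ?E] E by (simp add: measure_def noise_tail_def M.emeasure_space_1)
  have cyl: "measure ?P ({x\<in>space M. \<forall>i\<in>F. x i \<le> u i} \<times> space ?N) = orthant F C u" for u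
  proof -
    have "{x\<in>space M. \<forall>i\<in>F. x i \<le> u i} \<in> sets M" by (rule sets_orthant[OF F gauss_vecD(3)[OF M]])
    then show ?thesis
      using N.emeasure_pair_measure_Times[of "{x\<in>space M. \<forall>i\<in>F. x i \<le> u i}" M "space ?N"] orthant_eq[OF M, of u]
      by (simp add: measure_def N.emeasure_space_1)
  qed
  have noisy: "measure ?P {\<omega>\<in>space ?P. \<forall>i\<in>F. (case \<omega> of (x, y) \<Rightarrow> x i + s * y i) \<le> u i} = orthant F (Q n) u" for u
    by (rule orthant_eq[OF G])
  have small: "\<bar>s * y i\<bar> \<le> \<eta>" if "y \<in> space ?N - ?E" "i \<in> F" for y i
  proof -
    have "\<bar>y i\<bar> \<le> \<eta> * real (Suc n)" using that by auto
    then show ?thesis using s by (simp add: abs_mult s_def field_simps)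
  qed
  have m1: "{\<omega>\<in>space ?P. \<forall>i\<in>F. (case \<omega> of (x, y) \<Rightarrow> x i + s * y i) \<le> u i} \<in> sets ?P" for u
    by (rule sets_orthant[OF F gauss_vecD(3)[OF G]])
  have m2: "{x\<in>space M. \<forall>i\<in>F. x i \<le> u i} \<times> space ?N \<in> sets ?P" for u
    by (intro pair_measureI sets_orthant[OF F gauss_vecD(3)[OF M]]) auto
  have m3: "space M \<times> ?E \<in> sets ?P" by measurable
  have "measure ?P ({x\<in>space M. \<forall>i\<in>F. x i \<le> u i} \<times> space ?N) \<le>
    measure ?P ({\<omega>\<in>space ?P. \<forall>i\<in>F. (case \<omega> of (x, y) \<Rightarrow> x i + s * y i) \<le> u i + \<eta>} \<union> space M \<times> ?E)"
  proof (intro P.finite_measure_mono sets.Un m1 m3 subsetI)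
    fix z assume z: "z \<in> {x\<in>space M. \<forall>i\<in>F. x i \<le> u i} \<times> space ?N"
    then obtain x y where xy: "z = (x, y)" "x \<in> space M" "\<forall>i\<in>F. x i \<le> u i" "y \<in> space ?N" by auto
    show "z \<in> {\<omega>\<in>space ?P. \<forall>i\<in>F. (case \<omega> of (x, y) \<Rightarrow> x i + s * y i) \<le> u i + \<eta>} \<union> space M \<times> ?E"
    proof (cases "y \<in> ?E")
      case True then show ?thesis using xy by blast
    next
      case False
      have "x i + s * y i \<le> u i + \<eta>" if "i \<in> F" for i
      proof -
        have "\<bar>s * y i\<bar> \<le> \<eta>" using small[of y i] xy(4) False that by blast
        then show ?thesis using xy(3) that by (fastforce simp: abs_le_iff)
      qed
      then show ?thesis using xy by (auto simp: space_pair_measure)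
    qed
  qed
  also have "\<dots> \<le> orthant F (Q n) (\<lambda>i. u i + \<eta>) + noise_tail F \<eta> n"
    using measure_Un_le[OF m1[of "\<lambda>i. u i + \<eta>"] m3] unfolding noisy tail .
  finally show "orthant F C u \<le> orthant F (Q n) (\<lambda>i. u i + \<eta>) + noise_tail F \<eta> n" unfolding cyl .
  have "measure ?P {\<omega>\<in>space ?P. \<forall>i\<in>F. (case \<omega> of (x, y) \<Rightarrow> x i + s * y i) \<le> u i} \<le>
    measure ?P ({x\<in>space M. \<forall>i\<in>F. x i \<le> u i + \<eta>} \<times> space ?N \<union> space M \<times> ?E)"
  proof (intro P.finite_measure_mono sets.Un m2 m3 subsetI)
    fix z assume z: "z \<in> {\<omega>\<in>space ?P. \<forall>i\<in>F. (case \<omega> of (x, y) \<Rightarrow> x i + s * y i) \<le> u i}"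
    then obtain x y where xy: "z = (x, y)" "x \<in> space M" "\<forall>i\<in>F. x i + s * y i \<le> u i" "y \<in> space ?N"
      by (auto simp: space_pair_measure)
    show "z \<in> {x\<in>space M. \<forall>i\<in>F. x i \<le> u i + \<eta>} \<times> space ?N \<union> space M \<times> ?E"
    proof (cases "y \<in> ?E")
      case True then show ?thesis using xy by blast
    next
      case False
      have "x i \<le> u i + \<eta>" if "i \<in> F" for i
      proof -
        have "\<bar>s * y i\<bar> \<le> \<eta>" using small[of y i] xy(4) False that by blast
        then show ?thesis using xy(3) that by (fastforce simp: abs_le_iff)
      qed
      then show ?thesis using xy by auto
    qed
  qed
  also have "\<dots> \<le> orthant F C (\<lambda>i. u i + \<eta>) + noise_tail F \<eta> n"
    using measure_Un_le[OF m2[of "\<lambda>i. u i + \<eta>"] m3] unfolding cyl tail .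
  finally show "orthant F (Q n) u \<le> orthant F C (\<lambda>i. u i + \<eta>) + noise_tail F \<eta> n" unfolding noisy .
qed

text \<open>
  The diagonal regularization is removed by letting the noise tend to \<open>0\<close> at the cost of raising the
  thresholds by \<open>2 * \<eta>\<close>, and then letting \<open>\<eta>\<close> tend to \<open>0\<close>.
\<close>

theorem slepian:
  fixes F :: "'i set"
  assumes C: "gaussian_cov F C" and C': "gaussian_cov F C'"
    and sym: "\<And>i j. i \<in> F \<Longrightarrow> j \<in> F \<Longrightarrow> C i j = C j i" "\<And>i j. i \<in> F \<Longrightarrow> j \<in> F \<Longrightarrow> C' i j = C' j i"
    and diag: "\<And>i. i \<in> F \<Longrightarrow> C i i = C' i i"
    and le: "\<And>i j. i \<in> F \<Longrightarrow> j \<in> F \<Longrightarrow> C i j \<le> C' i j"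
  shows "orthant F C u \<le> orthant F C' u"
proof -
  have F: "finite F" using C by (rule gaussian_cov_finite)
  have 1: "orthant F C u \<le> orthant F C' (\<lambda>i. u i + 2 * \<eta>)" if \<eta>: "0 < \<eta>" for \<eta>
  proof -
    let ?T = "noise_tail F \<eta>"
    have "orthant F C u \<le> orthant F C' (\<lambda>i. u i + 2 * \<eta>) + 2 * ?T n" for n
    proof -
      have "orthant F C u \<le> orthant F (\<lambda>i j. C i j + (if i = j then (1 / real (Suc n))^2 else 0)) (\<lambda>i. u i + \<eta>) + ?T n"
        by (rule orthant_noise(1)[OF C \<eta>])
      moreover have "orthant F (\<lambda>i j. C i j + (if i = j then (1 / real (Suc n))^2 else 0)) (\<lambda>i. u i + \<eta>) \<le>
         orthant F (\<lambda>i j. C' i j + (if i = j then (1 / real (Suc n))^2 else 0)) (\<lambda>i. u i + \<eta>)"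
        by (rule slepian_regularized[OF C C' sym diag le]) auto
      moreover have "orthant F (\<lambda>i j. C' i j + (if i = j then (1 / real (Suc n))^2 else 0)) (\<lambda>i. u i + \<eta>) \<le>
         orthant F C' (\<lambda>i. u i + 2 * \<eta>) + ?T n"
      proof -
        have e: "(\<lambda>i. u i + 2 * \<eta>) = (\<lambda>i. (u i + \<eta>) + \<eta>)" by (simp add: algebra_simps)
        show ?thesis unfolding e by (rule orthant_noise(2)[OF C' \<eta>])
      qed
      ultimately show ?thesis by linarith
    qed
    moreover have "(\<lambda>n. orthant F C' (\<lambda>i. u i + 2 * \<eta>) + 2 * ?T n) \<longlonglongrightarrow> orthant F C' (\<lambda>i. u i + 2 * \<eta>) + 2 * 0"
      by (intro tendsto_intros noise_tail_tendsto_0 F \<eta>)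
    ultimately show ?thesis by (intro LIMSEQ_le_const[where a="orthant F C u"]) auto
  qed
  obtain M where M: "gauss_vec M F (\<lambda>i x. x i) C'" using C' unfolding gaussian_cov_def by blast
  interpret M: prob_space M by (rule gauss_vecD[OF M])
  note [measurable] = gauss_vecD(3)[OF M]
  let ?A = "\<lambda>n. {x\<in>space M. \<forall>i\<in>F. x i \<le> u i + 2 * (1 / real (Suc n))}"
  have "(\<lambda>n. measure M (?A n)) \<longlonglongrightarrow> measure M (\<Inter>n. ?A n)"
  proof (rule M.finite_Lim_measure_decseq)
    have "?A n \<in> sets M" for n by (rule sets_orthant[OF F gauss_vecD(3)[OF M]])
    then show "range ?A \<subseteq> sets M" by blast
    have "2 * (1 / real (Suc (Suc n))) \<le> 2 * (1 / real (Suc n))" for n by (simp add: field_simps)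
    then show "decseq ?A" by (intro decseq_SucI subsetI) (auto intro: order_trans add_left_mono)
  qed
  moreover have "(\<Inter>n. ?A n) = {x\<in>space M. \<forall>i\<in>F. x i \<le> u i}"
  proof -
    have "x i \<le> u i" if "\<And>n. x i \<le> u i + 2 * (1 / real (Suc n))" for x :: "'i \<Rightarrow> real" and i
    proof (rule LIMSEQ_le_const)
      have "(\<lambda>n. u i + 2 * (1 / real (Suc n))) \<longlonglongrightarrow> u i + 2 * 0"
        by (intro tendsto_intros LIMSEQ_Suc[OF lim_1_over_n])
      then show "(\<lambda>n. u i + 2 * (1 / real (Suc n))) \<longlonglongrightarrow> u i" by simp
    qed (use that in auto)
    moreover have "u i \<le> u i + 2 * (1 / real (Suc n))" for i n by simp
    ultimately show ?thesis by (auto intro: order_trans)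
  qed
  ultimately have "(\<lambda>n. orthant F C' (\<lambda>i. u i + 2 * (1 / real (Suc n)))) \<longlonglongrightarrow> orthant F C' u"
    by (simp only: orthant_eq[OF M])
  then show ?thesis by (rule LIMSEQ_le_const) (intro exI[of _ 0] allI impI 1, simp)
qed

section \<open>Suprema of separable Gaussian processes\<close>

text \<open>
  Taken in the completion, in which the supremum of a separable process is measurable.
\<close>

definition sup_le :: "'a measure \<Rightarrow> (real \<Rightarrow> 'a \<Rightarrow> real) \<Rightarrow> real \<Rightarrow> real \<Rightarrow> real \<Rightarrow> real" where
  "sup_le M Z a b z = \<P>(\<omega> in completion M. (SUP t\<in>{a..b}. ereal (Z t \<omega>)) \<le> ereal z)"

definition sup_lt :: "'a measure \<Rightarrow> (real \<Rightarrow> 'a \<Rightarrow> real) \<Rightarrow> real \<Rightarrow> real \<Rightarrow> real \<Rightarrow> real" where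
  "sup_lt M Z a b z = \<P>(\<omega> in completion M. (SUP t\<in>{a..b}. ereal (Z t \<omega>)) < ereal z)"

text \<open>
  The covariance \<open>K\<close> is only constrained at nonnegative times.
\<close>

definition gauss_proc :: "'a measure \<Rightarrow> (real \<Rightarrow> 'a \<Rightarrow> real) \<Rightarrow> (real \<Rightarrow> real \<Rightarrow> real) \<Rightarrow> bool" where
  "gauss_proc M Z K \<longleftrightarrow> separable_process M Z \<and> (\<forall>F. finite F \<and> F \<subseteq> {0..} \<longrightarrow> gauss_vec M F Z K)"

lemma gauss_procD:
  assumes "gauss_proc M Z K"
  shows "prob_space M" "separable_process M Z" "\<And>t. 0 \<le> t \<Longrightarrow> Z t \<in> borel_measurable M"
    "\<And>F. finite F \<Longrightarrow> F \<subseteq> {0..} \<Longrightarrow> gauss_vec M F Z K"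
    "prob_space (completion M)"
proof -
  show s: "separable_process M Z" "\<And>F. finite F \<Longrightarrow> F \<subseteq> {0..} \<Longrightarrow> gauss_vec M F Z K"
    using assms unfolding gauss_proc_def by auto
  show M: "prob_space M" using gauss_vecD(1)[OF s(2)[of "{}"]] by simp
  then show "prob_space (completion M)" by (rule prob_space.prob_space_completion)
  show "Z t \<in> borel_measurable M" if "0 \<le> t" for t using gauss_vecD(3)[OF s(2)[of "{t}"], of t] that by simp
qed

text \<open>
  In the open interval the graph over the separating set is dense in the whole graph. At the end
  points nearby times may lie outside the interval, so these two are added to the countable set.
\<close>

lemma separable_sup:
  assumes "separable_process M Z" "0 \<le> a" "a \<le> b"
  obtains D where "D \<subseteq> {a..b}" "countable D" "D \<noteq> {}"
    "AE \<omega> in M. (SUP t\<in>{a..b}. ereal (Z t \<omega>)) = (SUP t\<in>D. ereal (Z t \<omega>))"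
proof -
  obtain D where D: "countable D" "AE \<omega> in M. \<forall>t\<ge>0. (t, Z t \<omega>) \<in> closure ((\<lambda>d. (d, Z d \<omega>)) ` D)"
    using assms(1) unfolding separable_process_def by blast
  define D' where "D' = (D \<inter> {a<..<b}) \<union> {a, b}"
  show ?thesis
  proof (rule that[of D'])
    show "D' \<subseteq> {a..b}" "countable D'" "D' \<noteq> {}" using D(1) assms by (auto simp: D'_def)
    show "AE \<omega> in M. (SUP t\<in>{a..b}. ereal (Z t \<omega>)) = (SUP t\<in>D'. ereal (Z t \<omega>))"
      using D(2)
    proof eventually_elim
      case (elim \<omega>)
      show ?case
      proof (rule antisym)
        show "(SUP t\<in>D'. ereal (Z t \<omega>)) \<le> (SUP t\<in>{a..b}. ereal (Z t \<omega>))"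
          using \<open>D' \<subseteq> {a..b}\<close> by (rule SUP_subset_mono) simp
        show "(SUP t\<in>{a..b}. ereal (Z t \<omega>)) \<le> (SUP t\<in>D'. ereal (Z t \<omega>))"
        proof (rule SUP_least)
          fix t assume t: "t \<in> {a..b}"
          show "ereal (Z t \<omega>) \<le> (SUP t\<in>D'. ereal (Z t \<omega>))"
          proof (cases "t \<in> D'")
            case True then show ?thesis by (rule SUP_upper)
          next
            case False
            then have t': "a < t" "t < b" using t by (auto simp: D'_def)
            show ?thesis
            proof (rule ccontr)
              assume "\<not> ?thesis"
              then have lt: "(SUP t\<in>D'. ereal (Z t \<omega>)) < ereal (Z t \<omega>)" by simp
              let ?S = "(SUP t\<in>D'. ereal (Z t \<omega>))"
              have "open {x. ?S < ereal x}" by (intro open_Collect_less continuous_intros)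
              then have o: "open ({a<..<b} \<times> {x. ?S < ereal x})" by (intro open_Times) auto
              have "(t, Z t \<omega>) \<in> ({a<..<b} \<times> {x. ?S < ereal x}) \<inter> closure ((\<lambda>d. (d, Z d \<omega>)) ` D)"
                using elim t' assms(2) lt by auto
              then have "({a<..<b} \<times> {x. ?S < ereal x}) \<inter> (\<lambda>d. (d, Z d \<omega>)) ` D \<noteq> {}"
                using open_Int_closure_eq_empty[OF o, of "(\<lambda>d. (d, Z d \<omega>)) ` D"] by blast
              then obtain d where d: "d \<in> D" "a < d" "d < b" "?S < ereal (Z d \<omega>)"
                by fastforce
              then have "d \<in> D'" by (auto simp: D'_def)
              then have "ereal (Z d \<omega>) \<le> ?S" by (rule SUP_upper)
              with d(4) show False by simp
            qed
          qed
        qed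
      qed
    qed
  qed
qed

lemma completion_set:
  assumes M: "prob_space M" and A: "A \<in> sets M" and B: "B \<subseteq> space M" and ae: "AE x in M. x \<in> A \<longleftrightarrow> x \<in> B"
  shows "B \<in> sets (completion M)" "measure (completion M) B = measure M A"
proof -
  interpret C: prob_space "completion M" using M by (rule prob_space.prob_space_completion)
  have ae': "AE x in completion M. x \<in> A \<longleftrightarrow> x \<in> B" using ae by (rule AE_completion)
  show Bs: "B \<in> sets (completion M)"
    by (rule completion.in_sets_AE[OF ae']) (use A B in auto)
  have "measure (completion M) B = measure (completion M) A"
    by (rule measure_eq_AE) (use ae' A Bs in auto)
  then show "measure (completion M) B = measure M A" using A by simp
qed

lemma sup_le_countable:
  assumes P: "gauss_proc M Z K" and ab: "0 \<le> a" "a \<le> b"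
  obtains D where "D \<subseteq> {a..b}" "countable D" "D \<noteq> {}"
    "\<And>z. {\<omega>\<in>space M. (SUP t\<in>{a..b}. ereal (Z t \<omega>)) \<le> ereal z} \<in> sets (completion M)"
    "\<And>z. sup_le M Z a b z = measure M {\<omega>\<in>space M. \<forall>t\<in>D. Z t \<omega> \<le> z}"
proof -
  obtain D where D: "D \<subseteq> {a..b}" "countable D" "D \<noteq> {}"
    "AE \<omega> in M. (SUP t\<in>{a..b}. ereal (Z t \<omega>)) = (SUP t\<in>D. ereal (Z t \<omega>))"
    by (rule separable_sup[OF gauss_procD(2)[OF P] ab])
  have [measurable]: "Z t \<in> borel_measurable M" if "t \<in> D" for t
    using D(1) ab that by (intro gauss_procD(3)[OF P]) auto
  have A: "{\<omega>\<in>space M. \<forall>t\<in>D. Z t \<omega> \<le> z} \<in> sets M" for z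
    using D(2) by measurable
  have "AE \<omega> in M. \<omega> \<in> {\<omega>\<in>space M. \<forall>t\<in>D. Z t \<omega> \<le> z} \<longleftrightarrow> \<omega> \<in> {\<omega>\<in>space M. (SUP t\<in>{a..b}. ereal (Z t \<omega>)) \<le> ereal z}" for z
    using D(4)
  proof eventually_elim
    case (elim \<omega>)
    have "(SUP t\<in>{a..b}. ereal (Z t \<omega>)) \<le> ereal z \<longleftrightarrow> (\<forall>t\<in>D. Z t \<omega> \<le> z)"
      unfolding elim by (simp add: SUP_le_iff)
    then show ?case by blast
  qed
  from completion_set[OF gauss_procD(1)[OF P] A _ this]
  show ?thesis by (intro that[OF D(1-3)]) (auto simp: sup_le_def)
qed

lemma sup_le_sets:
  assumes "gauss_proc M Z K" "0 \<le> a" "a \<le> b"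
  shows "{\<omega>\<in>space M. (SUP t\<in>{a..b}. ereal (Z t \<omega>)) \<le> ereal z} \<in> sets (completion M)"
  by (rule sup_le_countable[OF assms]) blast

lemma sup_le_le_orthant:
  assumes P: "gauss_proc M Z K" and ab: "0 \<le> a" "a \<le> b" and F: "finite F" "F \<subseteq> {a..b}"
  shows "sup_le M Z a b z \<le> orthant F K (\<lambda>_. z)"
proof -
  interpret C: prob_space "completion M" by (rule gauss_procD(5)[OF P])
  have G: "gauss_vec M F Z K" using F ab by (intro gauss_procD(4)[OF P]) auto
  have s: "{\<omega>\<in>space M. \<forall>i\<in>F. Z i \<omega> \<le> z} \<in> sets M"
    by (rule sets_orthant[OF F(1) gauss_vecD(3)[OF G]])
  have "sup_le M Z a b z \<le> measure (completion M) {\<omega>\<in>space M. \<forall>i\<in>F. Z i \<omega> \<le> z}"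
    unfolding sup_le_def using F s by (intro C.finite_measure_mono) (auto simp: SUP_le_iff)
  then show ?thesis using orthant_eq[OF G, of "\<lambda>_. z"] s by simp
qed

text \<open>
  Together with \<open>sup_le_le_orthant\<close> this says that \<open>sup_le\<close> is the infimum of the probabilities over
  finite sets of times. It carries comparisons of finite-dimensional laws over to suprema.
\<close>

lemma sup_le_geI:
  assumes P: "gauss_proc M Z K" and ab: "0 \<le> a" "a \<le> b"
    and r: "\<And>F. finite F \<Longrightarrow> F \<subseteq> {a..b} \<Longrightarrow> r \<le> orthant F K (\<lambda>_. z)"
  shows "r \<le> sup_le M Z a b z"
proof -
  obtain D where D: "D \<subseteq> {a..b}" "countable D" "D \<noteq> {}"
    "\<And>z. {\<omega>\<in>space M. (SUP t\<in>{a..b}. ereal (Z t \<omega>)) \<le> ereal z} \<in> sets (completion M)"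
    "\<And>z. sup_le M Z a b z = measure M {\<omega>\<in>space M. \<forall>t\<in>D. Z t \<omega> \<le> z}"
    by (rule sup_le_countable[OF P ab]) (rule that, assumption+)
  interpret M: prob_space M by (rule gauss_procD[OF P])
  define F where "F n = from_nat_into D ` {..n}" for n
  have F: "finite (F n)" "F n \<subseteq> D" for n using from_nat_into[OF D(3)] by (auto simp: F_def)
  have G: "gauss_vec M (F n) Z K" for n using F[of n] D(1) ab by (intro gauss_procD(4)[OF P]) auto
  let ?A = "\<lambda>n. {\<omega>\<in>space M. \<forall>t\<in>F n. Z t \<omega> \<le> z}"
  have "(\<lambda>n. measure M (?A n)) \<longlonglongrightarrow> measure M (\<Inter>n. ?A n)"
  proof (rule M.finite_Lim_measure_decseq)
    have "?A n \<in> sets M" for n by (rule sets_orthant[OF F(1) gauss_vecD(3)[OF G]])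
    then show "range ?A \<subseteq> sets M" by blast
    show "decseq ?A" by (intro decseq_SucI) (auto simp: F_def)
  qed
  moreover have "(\<Inter>n. ?A n) = {\<omega>\<in>space M. \<forall>t\<in>D. Z t \<omega> \<le> z}"
  proof -
    have "D = (\<Union>n. F n)" using from_nat_into_surj[OF D(2)] F(2) unfolding F_def by blast
    then show ?thesis by auto
  qed
  ultimately have "(\<lambda>n. orthant (F n) K (\<lambda>_. z)) \<longlonglongrightarrow> sup_le M Z a b z"
    unfolding D(5) by (simp only: orthant_eq[OF G])
  then show ?thesis
    by (rule LIMSEQ_le_const) (intro exI[of _ 0] allI impI r F(1) order_trans[OF F(2) D(1)])
qed

text \<open>
  Comparisons are proved for the weak inequality, which passes to infinite sets of times, and then
  transferred to the strict one by this limit.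
\<close>

lemma sup_lt_tendsto:
  assumes P: "gauss_proc M Z K" and ab: "0 \<le> a" "a \<le> b"
  shows "(\<lambda>n. sup_le M Z a b (z - 1 / real (Suc n))) \<longlonglongrightarrow> sup_lt M Z a b z"
    and "{\<omega>\<in>space M. (SUP t\<in>{a..b}. ereal (Z t \<omega>)) < ereal z} \<in> sets (completion M)"
proof -
  interpret C: prob_space "completion M" by (rule gauss_procD(5)[OF P])
  let ?S = "\<lambda>\<omega>. SUP t\<in>{a..b}. ereal (Z t \<omega>)"
  let ?A = "\<lambda>n. {\<omega>\<in>space M. ?S \<omega> \<le> ereal (z - 1 / real (Suc n))}"
  have s: "range ?A \<subseteq> sets (completion M)" using sup_le_sets[OF P ab] by blast
  have U: "(\<Union>n. ?A n) = {\<omega>\<in>space M. ?S \<omega> < ereal z}"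
  proof (intro equalityI subsetI)
    fix \<omega> assume "\<omega> \<in> (\<Union>n. ?A n)"
    then obtain n where "\<omega> \<in> space M" "?S \<omega> \<le> ereal (z - 1 / real (Suc n))" by blast
    moreover have "ereal (z - 1 / real (Suc n)) < ereal z" by simp
    ultimately show "\<omega> \<in> {\<omega>\<in>space M. ?S \<omega> < ereal z}" using le_less_trans by blast
  next
    fix \<omega> assume w: "\<omega> \<in> {\<omega>\<in>space M. ?S \<omega> < ereal z}"
    then obtain y where y: "?S \<omega> < ereal y" "y < z" using ereal_dense2[of "?S \<omega>" "ereal z"] by auto
    then obtain n where "inverse (real (Suc n)) < z - y" using reals_Archimedean[of "z - y"] by auto
    then have "ereal y \<le> ereal (z - 1 / real (Suc n))" by (simp add: inverse_eq_divide)
    with y w have "\<omega> \<in> ?A n" by (auto intro: order_trans less_imp_le)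
    then show "\<omega> \<in> (\<Union>n. ?A n)" by blast
  qed
  have inc: "incseq ?A"
  proof (rule incseq_SucI, rule subsetI)
    fix n \<omega> assume "\<omega> \<in> ?A n"
    moreover have "ereal (z - 1 / real (Suc n)) \<le> ereal (z - 1 / real (Suc (Suc n)))" by (simp add: frac_le)
    ultimately show "\<omega> \<in> ?A (Suc n)" using order_trans by blast
  qed
  show "(\<lambda>n. sup_le M Z a b (z - 1 / real (Suc n))) \<longlonglongrightarrow> sup_lt M Z a b z"
    using C.finite_Lim_measure_incseq[OF s inc] unfolding U by (simp add: sup_le_def sup_lt_def)
  show "{\<omega>\<in>space M. ?S \<omega> < ereal z} \<in> sets (completion M)"
    unfolding U[symmetric] using s by (intro sets.countable_UN) auto
qed

lemma sup_lt_leI: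
  assumes P: "gauss_proc M Z K" and ab: "0 \<le> a" "a \<le> b"
    and r: "\<And>y. y < z \<Longrightarrow> sup_le M Z a b y \<le> r"
  shows "sup_lt M Z a b z \<le> r"
  using sup_lt_tendsto(1)[OF P ab] by (rule LIMSEQ_le_const2) (intro exI[of _ 0] allI impI r, simp)

lemma sup_lt_le_sup_le:
  assumes P: "gauss_proc M Z K" and ab: "0 \<le> a" "a \<le> b"
  shows "sup_lt M Z a b z \<le> sup_le M Z a b z"
proof -
  interpret C: prob_space "completion M" by (rule gauss_procD(5)[OF P])
  show ?thesis unfolding sup_lt_def sup_le_def
    using sup_le_sets[OF P ab] by (intro C.finite_measure_mono) auto
qed

lemma sup_le_le_sup_lt:
  assumes P: "gauss_proc M Z K" and ab: "0 \<le> a" "a \<le> b" and z: "y < z"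
  shows "sup_le M Z a b y \<le> sup_lt M Z a b z"
proof -
  interpret C: prob_space "completion M" by (rule gauss_procD(5)[OF P])
  show ?thesis unfolding sup_lt_def sup_le_def
    using sup_lt_tendsto(2)[OF P ab, of z] z by (intro C.finite_measure_mono) (auto intro: le_less_trans)
qed

lemma sup_lt_antimono:
  assumes P: "gauss_proc M Z K" and ab: "0 \<le> a'" "a' \<le> a" "a \<le> b" "b \<le> b'"
  shows "sup_lt M Z a' b' z \<le> sup_lt M Z a b z"
proof -
  interpret C: prob_space "completion M" by (rule gauss_procD(5)[OF P])
  have "(SUP t\<in>{a..b}. ereal (Z t \<omega>)) \<le> (SUP t\<in>{a'..b'}. ereal (Z t \<omega>))" for \<omega>
    using ab by (intro SUP_subset_mono) auto
  then show ?thesis unfolding sup_lt_def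
    using sup_lt_tendsto(2)[OF P, of a b z] ab by (intro C.finite_measure_mono) (auto intro: le_less_trans)
qed

lemma sup_lt_bounds:
  assumes P: "gauss_proc M Z K"
  shows "0 \<le> sup_lt M Z a b z" "sup_lt M Z a b z \<le> 1"
proof -
  interpret C: prob_space "completion M" by (rule gauss_procD(5)[OF P])
  show "0 \<le> sup_lt M Z a b z" "sup_lt M Z a b z \<le> 1" unfolding sup_lt_def by simp_all
qed

lemma sup_le_bounds:
  assumes P: "gauss_proc M Z K"
  shows "0 \<le> sup_le M Z a b z" "sup_le M Z a b z \<le> 1"
proof -
  interpret C: prob_space "completion M" by (rule gauss_procD(5)[OF P])
  show "0 \<le> sup_le M Z a b z" "sup_le M Z a b z \<le> 1" unfolding sup_le_def by simp_all
qed

lemma sup_lt_mono_cov: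
  assumes P: "gauss_proc M Z K" and P': "gauss_proc N W K'" and ab: "0 \<le> a" "a \<le> b" "0 \<le> a'" "a' \<le> b'"
    and le: "\<And>F y. finite F \<Longrightarrow> F \<subseteq> {a'..b'} \<Longrightarrow> \<exists>G. finite G \<and> G \<subseteq> {a..b} \<and> orthant G K (\<lambda>_. y) \<le> orthant F K' (\<lambda>_. y)"
  shows "sup_lt M Z a b z \<le> sup_lt N W a' b' z"
proof (rule LIMSEQ_le[OF sup_lt_tendsto(1)[OF P ab(1,2)] sup_lt_tendsto(1)[OF P' ab(3,4)]])
  have "sup_le M Z a b y \<le> sup_le N W a' b' y" for y
  proof (rule sup_le_geI[OF P' ab(3,4)])
    fix F assume "finite F" "F \<subseteq> {a'..b'}"
    from le[OF this] obtain G where "finite G" "G \<subseteq> {a..b}" "orthant G K (\<lambda>_. y) \<le> orthant F K' (\<lambda>_. y)" by blast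
    then show "sup_le M Z a b y \<le> orthant F K' (\<lambda>_. y)"
      using sup_le_le_orthant[OF P ab(1,2), of G y] by linarith
  qed
  then show "\<exists>N'. \<forall>n\<ge>N'. sup_le M Z a b (z - 1 / real (Suc n)) \<le> sup_le N W a' b' (z - 1 / real (Suc n))" by blast
qed

lemma sup_lt_stationary:
  assumes P: "gauss_proc M Z K" and ab: "0 \<le> a" "a \<le> b" and h: "0 \<le> h"
    and K: "\<And>s t. 0 \<le> s \<Longrightarrow> 0 \<le> t \<Longrightarrow> K (s + h) (t + h) = K s t"
  shows "sup_lt M Z (a + h) (b + h) z = sup_lt M Z a b z"
proof -
  have *: "orthant ((\<lambda>t. t + h) ` F) K (\<lambda>_. y) = orthant F K (\<lambda>_. y)" if F: "finite F" "F \<subseteq> {0..}" for F y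
  proof -
    have G1: "gauss_vec M ((\<lambda>t. t + h) ` F) Z K" using F h by (intro gauss_procD(4)[OF P]) auto
    have G2: "gauss_vec M F (\<lambda>t. Z (t + h)) K"
      by (rule gauss_vec_cong[OF gauss_vec_reindex[OF G1 F(1), of "\<lambda>t. t + h"]]) (use K F in \<open>auto simp: subset_iff\<close>)
    show ?thesis unfolding orthant_eq[OF G1, symmetric] orthant_eq[OF G2, symmetric] by simp
  qed
  show ?thesis
  proof (rule antisym)
    show "sup_lt M Z (a + h) (b + h) z \<le> sup_lt M Z a b z"
    proof (rule sup_lt_mono_cov[OF P P])
      fix F y assume F: "finite F" "F \<subseteq> {a..b}"
      then have "F \<subseteq> {0..}" using ab by fastforce
      with F show "\<exists>G. finite G \<and> G \<subseteq> {a + h..b + h} \<and> orthant G K (\<lambda>_. y) \<le> orthant F K (\<lambda>_. y)"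
        using *[of F y] ab by (intro exI[of _ "(\<lambda>t. t + h) ` F"]) (auto simp: subset_iff)
    qed (use ab h in auto)
    show "sup_lt M Z a b z \<le> sup_lt M Z (a + h) (b + h) z"
    proof (rule sup_lt_mono_cov[OF P P])
      fix F y assume F: "finite F" "F \<subseteq> {a + h..b + h}"
      define G where "G = (\<lambda>t. t - h) ` F"
      have "F = (\<lambda>t. t + h) ` G" by (auto simp: G_def image_image)
      moreover have "finite G" "G \<subseteq> {a..b}" using F by (auto simp: G_def)
      moreover from this have "G \<subseteq> {0..}" using ab by fastforce
      ultimately show "\<exists>G. finite G \<and> G \<subseteq> {a..b} \<and> orthant G K (\<lambda>_. y) \<le> orthant F K (\<lambda>_. y)"
        using *[of G y] ab by (intro exI[of _ G]) (auto simp: subset_iff)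
    qed (use ab h in auto)
  qed
qed

section \<open>Independent blocks and supermultiplicativity\<close>

lemma gauss_vec_blocks:
  fixes F :: "'i set" and J :: "'j set"
  assumes G: "gauss_vec M F X K" and J: "finite J" and \<beta>: "\<And>t. t \<in> F \<Longrightarrow> \<beta> t \<in> J"
  shows "gauss_vec (PiM J (\<lambda>_. M)) F (\<lambda>t \<omega>. X t (\<omega> (\<beta> t))) (\<lambda>s t. if \<beta> s = \<beta> t then K s t else 0)"
proof -
  have F: "finite F" by (rule gauss_vecD(2)[OF G])
  have s: "(\<Sum>i\<in>J. (if \<beta> t = i then 1 else 0) * f i) = f (\<beta> t)" if "t \<in> F" for t and f :: "'j \<Rightarrow> real"
    using \<beta>[OF that] J by (subst sum.mono_neutral_right[of J "{\<beta> t}"]) auto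
  have g: "gauss_vec M F (\<lambda>t x. (if \<beta> t = i then 1 else 0) * X t x) (\<lambda>s t. (if \<beta> s = i then 1 else 0) * (if \<beta> t = i then 1 else 0) * K s t)" for i
    by (rule gauss_vec_scale[OF G])
  show ?thesis
    by (rule gauss_vec_cong[OF gauss_vec_PiM_sum[where X="\<lambda>i t x. (if \<beta> t = i then 1 else 0) * X t x" and
            C="\<lambda>i s t. (if \<beta> s = i then 1 else 0) * (if \<beta> t = i then 1 else 0) * K s t", OF J F g]])
       (simp_all add: s mult.assoc)
qed

lemma orthant_blocks:
  fixes F :: "'i set" and J :: "'j set"
  assumes K: "gaussian_cov F K" and J: "finite J" and \<beta>: "\<And>t. t \<in> F \<Longrightarrow> \<beta> t \<in> J"
  shows "gaussian_cov F (\<lambda>s t. if \<beta> s = \<beta> t then K s t else 0)"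
    and "orthant F (\<lambda>s t. if \<beta> s = \<beta> t then K s t else 0) u = (\<Prod>i\<in>J. orthant {t\<in>F. \<beta> t = i} K u)"
proof -
  obtain M where G: "gauss_vec M F (\<lambda>i x. x i) K" using K unfolding gaussian_cov_def by blast
  have F: "finite F" by (rule gauss_vecD(2)[OF G])
  interpret M: prob_space M by (rule gauss_vecD[OF G])
  interpret P: finite_product_prob_space "\<lambda>_. M" J by standard (rule J)
  have B: "gauss_vec (PiM J (\<lambda>_. M)) F (\<lambda>t \<omega>. \<omega> (\<beta> t) t) (\<lambda>s t. if \<beta> s = \<beta> t then K s t else 0)"
    by (rule gauss_vec_blocks[OF G J \<beta>])
  show "gaussian_cov F (\<lambda>s t. if \<beta> s = \<beta> t then K s t else 0)" by (rule gaussian_covI[OF B])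
  have Gi: "gauss_vec M {t\<in>F. \<beta> t = i} (\<lambda>i x. x i) K" for i
    by (rule gauss_vec_reindex[OF G, of "{t\<in>F. \<beta> t = i}" "\<lambda>t. t"]) (use F in auto)
  let ?A = "\<lambda>i. {x\<in>space M. \<forall>t\<in>{t\<in>F. \<beta> t = i}. x t \<le> u t}"
  have box: "{\<omega>\<in>space (PiM J (\<lambda>_. M)). \<forall>t\<in>F. \<omega> (\<beta> t) t \<le> u t} = Pi\<^sub>E J ?A"
    using \<beta> by (auto simp: space_PiM PiE_iff extensional_def)
  have "orthant F (\<lambda>s t. if \<beta> s = \<beta> t then K s t else 0) u = measure (PiM J (\<lambda>_. M)) (Pi\<^sub>E J ?A)"
    unfolding orthant_eq[OF B, symmetric] by (simp only: box)
  also have "\<dots> = (\<Prod>i\<in>J. measure M (?A i))"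
  proof (rule P.prob_times)
    show "?A i \<in> sets M" for i by (rule sets_orthant[OF gauss_vecD(2)[OF Gi] gauss_vecD(3)[OF Gi]])
  qed
  also have "\<dots> = (\<Prod>i\<in>J. orthant {t\<in>F. \<beta> t = i} K u)"
    unfolding orthant_eq[OF Gi, symmetric] ..
  finally show "orthant F (\<lambda>s t. if \<beta> s = \<beta> t then K s t else 0) u = (\<Prod>i\<in>J. orthant {t\<in>F. \<beta> t = i} K u)" .
qed

text \<open>
  Removing the nonnegative covariances between the two parts of \<open>F\<close> makes the parts independent, and
  by Slepian's inequality it does not increase the probability.
\<close>

lemma orthant_split:
  fixes F :: "'i set"
  assumes K: "gaussian_cov F K" and sym: "\<And>s t. s \<in> F \<Longrightarrow> t \<in> F \<Longrightarrow> K s t = K t s"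
    and nonneg: "\<And>s t. s \<in> F \<Longrightarrow> t \<in> F \<Longrightarrow> 0 \<le> K s t"
  shows "orthant (F \<inter> A) K u * orthant (F - A) K u \<le> orthant F K u"
proof -
  have "(\<Prod>i\<in>(UNIV::bool set). orthant {t\<in>F. (t \<in> A) = i} K u) = orthant F (\<lambda>s t. if (s \<in> A) = (t \<in> A) then K s t else 0) u"
    by (rule orthant_blocks(2)[OF K, symmetric]) auto
  also have "\<dots> \<le> orthant F K u"
    by (rule slepian[OF orthant_blocks(1)[OF K, of UNIV] K]) (use sym nonneg in auto)
  finally have "orthant {t\<in>F. t \<notin> A} K u * orthant {t\<in>F. t \<in> A} K u \<le> orthant F K u"
    by (simp add: UNIV_bool mult.commute)
  moreover have "{t\<in>F. t \<notin> A} = F - A" "{t\<in>F. t \<in> A} = F \<inter> A" by auto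
  ultimately show ?thesis by (simp add: mult.commute)
qed

lemma orthant_bounds:
  assumes "gaussian_cov F K"
  shows "0 \<le> orthant F K u" "orthant F K u \<le> 1"
proof -
  obtain M where G: "gauss_vec M F (\<lambda>i x. x i) K" using assms unfolding gaussian_cov_def by blast
  interpret M: prob_space M by (rule gauss_vecD[OF G])
  show "0 \<le> orthant F K u" "orthant F K u \<le> 1" unfolding orthant_eq[OF G, symmetric] by simp_all
qed

lemma sup_lt_mult_le:
  assumes P: "gauss_proc M Z K" and ab: "0 \<le> a" "a \<le> b" "b \<le> c"
    and sym: "\<And>s t. 0 \<le> s \<Longrightarrow> 0 \<le> t \<Longrightarrow> K s t = K t s"
    and nonneg: "\<And>s t. 0 \<le> s \<Longrightarrow> 0 \<le> t \<Longrightarrow> 0 \<le> K s t"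
  shows "sup_lt M Z a b z * sup_lt M Z b c z \<le> sup_lt M Z a c z"
proof (rule LIMSEQ_le)
  have b0: "0 \<le> b" "a \<le> c" using ab by auto
  show "(\<lambda>n. sup_le M Z a b (z - 1 / real (Suc n)) * sup_le M Z b c (z - 1 / real (Suc n))) \<longlonglongrightarrow> sup_lt M Z a b z * sup_lt M Z b c z"
    by (intro tendsto_mult sup_lt_tendsto(1)[OF P] ab b0)
  show "(\<lambda>n. sup_le M Z a c (z - 1 / real (Suc n))) \<longlonglongrightarrow> sup_lt M Z a c z"
    by (intro sup_lt_tendsto(1)[OF P] ab b0)
  have "sup_le M Z a b y * sup_le M Z b c y \<le> sup_le M Z a c y" for y
  proof (rule sup_le_geI[OF P ab(1) b0(2)])
    fix F assume F: "finite F" "F \<subseteq> {a..c}"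
    have F0: "F \<subseteq> {0..}" using F ab by fastforce
    have K: "gaussian_cov F K" by (rule gaussian_covI[OF gauss_procD(4)[OF P F(1) F0]])
    have "sup_le M Z a b y \<le> orthant (F \<inter> {..b}) K (\<lambda>_. y)"
      using F by (intro sup_le_le_orthant[OF P ab(1,2)]) auto
    moreover have "sup_le M Z b c y \<le> orthant (F - {..b}) K (\<lambda>_. y)"
      using F by (intro sup_le_le_orthant[OF P b0(1) ab(3)]) auto
    ultimately have "sup_le M Z a b y * sup_le M Z b c y \<le> orthant (F \<inter> {..b}) K (\<lambda>_. y) * orthant (F - {..b}) K (\<lambda>_. y)"
      by (intro mult_mono order_trans[OF sup_le_bounds(1)[OF P]] sup_le_bounds(1)[OF P])
    also have "\<dots> \<le> orthant F K (\<lambda>_. y)"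
      using F0 by (intro orthant_split[OF K] sym nonneg) auto
    finally show "sup_le M Z a b y * sup_le M Z b c y \<le> orthant F K (\<lambda>_. y)" .
  qed
  then show "\<exists>N. \<forall>n\<ge>N. sup_le M Z a b (z - 1 / real (Suc n)) * sup_le M Z b c (z - 1 / real (Suc n)) \<le> sup_le M Z a c (z - 1 / real (Suc n))"
    by blast
qed

text \<open>
  The exponent starts at \<open>1\<close>: an interval of length \<open>0\<close> already constrains the value at one time.
\<close>

lemma sup_lt_power_le:
  assumes P: "gauss_proc M Z K"
    and sym: "\<And>s t. 0 \<le> s \<Longrightarrow> 0 \<le> t \<Longrightarrow> K s t = K t s"
    and nonneg: "\<And>s t. 0 \<le> s \<Longrightarrow> 0 \<le> t \<Longrightarrow> 0 \<le> K s t"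
    and L: "0 \<le> L" and q: "0 \<le> q" "\<And>s. 0 \<le> s \<Longrightarrow> q \<le> sup_lt M Z s (s + L) z"
  shows "q ^ Suc n \<le> sup_lt M Z 0 (real (Suc n) * L) z"
proof (induction n)
  case 0 show ?case using q(2)[of 0] by simp
next
  case (Suc n)
  have e: "real (Suc n) * L + L = real (Suc (Suc n)) * L" by (simp add: algebra_simps)
  have n: "0 \<le> real (Suc n) * L" using L by simp
  have "q ^ Suc (Suc n) = q ^ Suc n * q" by simp
  also have "\<dots> \<le> sup_lt M Z 0 (real (Suc n) * L) z * sup_lt M Z (real (Suc n) * L) (real (Suc n) * L + L) z"
    using Suc q n by (intro mult_mono sup_lt_bounds[OF P]) auto
  also have "\<dots> \<le> sup_lt M Z 0 (real (Suc n) * L + L) z"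
    using n L by (intro sup_lt_mult_le[OF P] sym nonneg) auto
  finally show ?case unfolding e .
qed

text \<open>
  The number of blocks of length \<open>L\<close> needed to cover \<open>[0, T]\<close> is at most \<open>T / L + 1\<close>.
\<close>

lemma sup_lt_exp_lower:
  assumes P: "gauss_proc M Z K"
    and sym: "\<And>s t. 0 \<le> s \<Longrightarrow> 0 \<le> t \<Longrightarrow> K s t = K t s"
    and nonneg: "\<And>s t. 0 \<le> s \<Longrightarrow> 0 \<le> t \<Longrightarrow> 0 \<le> K s t"
    and L: "0 < L" and \<beta>: "0 \<le> \<beta>" "\<And>s. 0 \<le> s \<Longrightarrow> exp (- \<beta> * L) \<le> sup_lt M Z s (s + L) z"
    and T: "0 \<le> T"
  shows "exp (- \<beta> * (T + L)) \<le> sup_lt M Z 0 T z"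
proof -
  define n where "n = nat \<lfloor>T / L\<rfloor>"
  have n: "real n \<le> T / L" "T / L < real n + 1"
    unfolding n_def using T L by (auto simp: of_nat_nat)
  have "T \<le> real (Suc n) * L" using n(2) L by (simp add: field_simps)
  moreover have "real (Suc n) * L \<le> T + L" using n(1) L by (simp add: field_simps)
  ultimately have nT: "T \<le> real (Suc n) * L" "real (Suc n) * L \<le> T + L" by auto
  have "exp (- \<beta> * (T + L)) \<le> exp (- \<beta> * (real (Suc n) * L))"
    using mult_left_mono[OF nT(2) \<beta>(1)] by simp
  also have "\<dots> = exp (- \<beta> * L) ^ Suc n"
    by (subst exp_of_nat_mult[symmetric]) (simp add: mult_ac)
  also have "\<dots> \<le> sup_lt M Z 0 (real (Suc n) * L) z"
    using L \<beta> by (intro sup_lt_power_le[OF P] sym nonneg) auto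
  also have "\<dots> \<le> sup_lt M Z 0 T z"
    using T nT(1) by (intro sup_lt_antimono[OF P]) auto
  finally show ?thesis .
qed

section \<open>Fekete's argument\<close>

lemma eln_less_iff: "eln x < ereal y \<longleftrightarrow> x < exp y"
proof (cases "x \<le> 0")
  case True
  then have "x < exp y" using exp_gt_zero[of y] by linarith
  then show ?thesis using True by (simp add: eln_def)
next
  case False
  then show ?thesis by (simp add: eln_def) (metis exp_less_cancel_iff exp_ln not_le)
qed

lemma less_eln_iff: "ereal y < eln x \<longleftrightarrow> exp y < x"
proof (cases "x \<le> 0")
  case True
  then have "\<not> exp y < x" using exp_gt_zero[of y] by linarith
  then show ?thesis using True by (simp add: eln_def)
next
  case False
  then show ?thesis by (simp add: eln_def) (metis exp_less_cancel_iff exp_ln not_le)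
qed

lemma rate_less_iff:
  assumes "0 < T"
  shows "ereal (1 / T) * eln x < ereal y \<longleftrightarrow> x < exp (T * y)"
proof -
  have "ereal (1 / T) * eln x < ereal y \<longleftrightarrow> eln x < ereal (T * y)"
    using assms by (cases "eln x") (simp_all add: field_simps)
  then show ?thesis by (simp only: eln_less_iff)
qed

lemma less_rate_iff:
  assumes "0 < T"
  shows "ereal y < ereal (1 / T) * eln x \<longleftrightarrow> exp (T * y) < x"
proof -
  have "ereal y < ereal (1 / T) * eln x \<longleftrightarrow> ereal (T * y) < eln x"
    using assms by (cases "eln x") (simp_all add: field_simps)
  then show ?thesis by (simp only: less_eln_iff)
qed

lemma log_persistence_rate_eq:
  "log_persistence_rate M Z T = ereal (1 / T) * eln (sup_lt M Z 0 T 0)"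
  by (simp add: log_persistence_rate_def sup_lt_def zero_ereal_def)

lemma rate_nonpos:
  assumes "0 < T" "x \<le> 1"
  shows "ereal (1 / T) * eln x \<le> 0"
proof (rule ccontr)
  assume "\<not> ?thesis"
  then have "ereal 0 < ereal (1 / T) * eln x" by (simp add: zero_ereal_def)
  then show False using less_rate_iff[OF assms(1), of 0 x] assms(2) by simp
qed

lemma log_persistence_rate_tendsto_SUP:
  assumes P: "gauss_proc M Z K"
    and sym: "\<And>s t. 0 \<le> s \<Longrightarrow> 0 \<le> t \<Longrightarrow> K s t = K t s"
    and nonneg: "\<And>s t. 0 \<le> s \<Longrightarrow> 0 \<le> t \<Longrightarrow> 0 \<le> K s t"
    and stat: "\<And>s t h. 0 \<le> s \<Longrightarrow> 0 \<le> t \<Longrightarrow> 0 \<le> h \<Longrightarrow> K (s + h) (t + h) = K s t"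
  shows "(log_persistence_rate M Z \<longlongrightarrow> (SUP L\<in>{0<..}. log_persistence_rate M Z L)) at_top" (is "(_ \<longlongrightarrow> ?l) _")
proof (rule order_tendstoI)
  fix y assume "?l < y"
  moreover have "log_persistence_rate M Z T \<le> ?l" if "0 < T" for T using that by (intro SUP_upper) auto
  ultimately show "\<forall>\<^sub>F T in at_top. log_persistence_rate M Z T < y"
    by (intro eventually_mono[OF eventually_gt_at_top[of 0]]) (rule le_less_trans)
next
  fix y assume "y < ?l"
  then obtain L where L: "0 < L" "y < log_persistence_rate M Z L" by (auto simp: less_SUP_iff)
  obtain y1 where y1: "y < ereal y1" "ereal y1 < log_persistence_rate M Z L"
    using ereal_dense2[OF L(2)] by auto
  obtain y2 where y2: "y < ereal y2" "ereal y2 < ereal y1"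
    using ereal_dense2[OF y1(1)] by auto
  have "log_persistence_rate M Z L \<le> 0"
    unfolding log_persistence_rate_eq using L(1) by (intro rate_nonpos sup_lt_bounds[OF P])
  with y1(2) have "ereal y1 < 0" by (rule less_le_trans)
  then have y10: "y1 < 0" by simp
  have e: "exp (L * y1) < sup_lt M Z 0 L 0"
    using y1(2) unfolding log_persistence_rate_eq less_rate_iff[OF L(1)] .
  have "exp (- (- y1) * L) \<le> sup_lt M Z s (s + L) 0" if s: "0 \<le> s" for s
    using sup_lt_stationary[OF P, of 0 L s 0] s L stat e by (simp add: mult.commute add.commute)
  then have low: "exp (y1 * (T + L)) \<le> sup_lt M Z 0 T 0" if "0 \<le> T" for T
    using sup_lt_exp_lower[OF P sym nonneg L(1), of "- y1" 0 T] y10 that by simp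
  show "\<forall>\<^sub>F T in at_top. y < log_persistence_rate M Z T"
    using eventually_gt_at_top[of "max 0 (L * y1 / (y2 - y1))"]
  proof eventually_elim
    case (elim T)
    then have T: "0 < T" "L * y1 / (y2 - y1) < T" by auto
    have "y2 * T < y1 * (T + L)" using T(2) y2(2) by (simp add: field_simps)
    then have "exp (T * y2) < exp (y1 * (T + L))" by (simp add: mult.commute)
    also have "\<dots> \<le> sup_lt M Z 0 T 0" using T by (intro low) auto
    finally have "ereal y2 < log_persistence_rate M Z T" unfolding log_persistence_rate_eq less_rate_iff[OF T(1)] .
    with y2(1) show ?case by (rule less_trans)
  qed
qed

text \<open>
  The threshold \<open>0\<close> is invariant under scaling, so that only the correlations matter.
\<close>

lemma sup_lt_zero_cov_scale:
  assumes P: "gauss_proc M Z K" and P': "gauss_proc N W K'" and ab: "0 \<le> a" "a \<le> b" and v: "0 < v"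
    and K: "\<And>s t. 0 \<le> s \<Longrightarrow> 0 \<le> t \<Longrightarrow> K s t = v * K' s t"
  shows "sup_lt M Z a b 0 \<le> sup_lt N W a b 0"
proof (rule sup_lt_leI[OF P ab])
  fix y :: real assume y: "y < 0"
  have "sup_le M Z a b y \<le> sup_le N W a b (y / sqrt v)"
  proof (rule sup_le_geI[OF P' ab])
    fix F assume F: "finite F" "F \<subseteq> {a..b}"
    have F0: "F \<subseteq> {0..}" using F ab by fastforce
    have G': "gauss_vec N F W K'" by (rule gauss_procD(4)[OF P' F(1) F0])
    have G: "gauss_vec N F (\<lambda>t x. sqrt v * W t x) K"
      by (rule gauss_vec_cong[OF gauss_vec_scale[OF G', of "\<lambda>_. sqrt v"]]) (use F0 K v in \<open>auto simp: subset_iff\<close>)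
    have "sup_le M Z a b y \<le> orthant F K (\<lambda>_. y)" by (rule sup_le_le_orthant[OF P ab F])
    also have "\<dots> = orthant F K' (\<lambda>_. y / sqrt v)"
      unfolding orthant_eq[OF G, symmetric] orthant_eq[OF G', symmetric] using v by (simp add: field_simps)
    finally show "sup_le M Z a b y \<le> orthant F K' (\<lambda>_. y / sqrt v)" .
  qed
  also have "\<dots> \<le> sup_lt N W a b 0"
    using y v by (intro sup_le_le_sup_lt[OF P' ab]) (simp add: divide_neg_pos)
  finally show "sup_le M Z a b y \<le> sup_lt N W a b 0" .
qed

section \<open>The covariance description of a Gaussian process\<close>

text \<open>
  The almost surely constant case and the case with a density are covered by the same formula.
\<close>

lemma gaussian_rv_centered:
  assumes M: "prob_space M" and X: "gaussian_rv M X" and E: "(\<integral>\<omega>. X \<omega> \<partial>M) = 0"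
  shows "integrable M (\<lambda>\<omega>. (X \<omega>)\<^sup>2)"
    and "(CLINT \<omega>|M. iexp (X \<omega>)) = of_real (exp (- (\<integral>\<omega>. (X \<omega>)\<^sup>2 \<partial>M) / 2))"
proof -
  interpret prob_space M by fact
  have Xm[measurable]: "X \<in> borel_measurable M" using X by (simp add: gaussian_rv_def)
  have "integrable M (\<lambda>\<omega>. (X \<omega>)\<^sup>2) \<and> (CLINT \<omega>|M. iexp (X \<omega>)) = of_real (exp (- (\<integral>\<omega>. (X \<omega>)\<^sup>2 \<partial>M) / 2))"
  proof (cases "\<exists>m. AE \<omega> in M. X \<omega> = m")
    case True
    then obtain m where m: "AE \<omega> in M. X \<omega> = m" by blast
    have "(\<integral>\<omega>. X \<omega> \<partial>M) = (\<integral>\<omega>. m \<partial>M)" using m by (intro integral_cong_AE) auto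
    then have "m = 0" using E by (simp add: prob_space)
    \<comment> \<open>A constant with mean \<open>0\<close> vanishes.\<close>
    with m have ae: "AE \<omega> in M. X \<omega> = 0" by simp
    have sq: "AE \<omega> in M. (X \<omega>)\<^sup>2 = 0" using ae by eventually_elim simp
    have e: "AE \<omega> in M. iexp (X \<omega>) = 1" using ae by eventually_elim simp
    have "(\<integral>\<omega>. (X \<omega>)\<^sup>2 \<partial>M) = (\<integral>\<omega>. 0 \<partial>M)" using sq by (intro integral_cong_AE) auto
    moreover have "(CLINT \<omega>|M. iexp (X \<omega>)) = (CLINT \<omega>|M. 1)" using e by (intro integral_cong_AE) auto
    moreover have "integrable M (\<lambda>\<omega>. (X \<omega>)\<^sup>2) \<longleftrightarrow> integrable M (\<lambda>\<omega>. 0::real)" using sq by (intro integrable_cong_AE) auto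
    ultimately show ?thesis by (simp add: prob_space)
  next
    case False
    then obtain m \<sigma> where \<sigma>: "\<sigma> > 0" and D: "distributed M lborel X (\<lambda>x. ennreal (normal_density m \<sigma> x))"
      using X by (auto simp: gaussian_rv_def)
    have m: "m = 0" using normal_distributed_expectation[OF \<sigma> D] E by simp
    have var: "(\<integral>\<omega>. (X \<omega>)\<^sup>2 \<partial>M) = \<sigma>\<^sup>2" using normal_distributed_variance[OF \<sigma> D] E by simp
    have int: "integrable M (\<lambda>\<omega>. (X \<omega>)\<^sup>2)"
      using distributed_integrable[OF D, of "\<lambda>x. x^2"] integrable_normal_moment[OF \<sigma>, of m 2] m by simp
    have D': "distributed M lborel (\<lambda>x. X x / \<sigma>) std_normal_density"
      using D normal_standard_normal_convert[OF \<sigma>, of X m] m by simp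
    have "(CLINT \<omega>|M. iexp (X \<omega>)) = (CLINT \<omega>|M. iexp (\<sigma> * (X \<omega> / \<sigma>)))" using \<sigma> by simp
    also have "\<dots> = (CLINT x|distr M lborel (\<lambda>x. X x / \<sigma>). iexp (\<sigma> * x))"
      by (subst integral_distr) auto
    also have "\<dots> = char std_normal \<sigma>"
      unfolding char_def using distributed_distr_eq_density[OF D'] by simp
    also have "\<dots> = of_real (exp (- \<sigma>\<^sup>2 / 2))" by (simp only: char_std_normal_distribution)
    finally show ?thesis using int var by simp
  qed
  then show "integrable M (\<lambda>\<omega>. (X \<omega>)\<^sup>2)"
    "(CLINT \<omega>|M. iexp (X \<omega>)) = of_real (exp (- (\<integral>\<omega>. (X \<omega>)\<^sup>2 \<partial>M) / 2))" by auto
qed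

lemma cov_centered:
  assumes "centered_process M Z" "0 \<le> s" "0 \<le> t"
  shows "cov M (Z s) (Z t) = (\<integral>\<omega>. Z s \<omega> * Z t \<omega> \<partial>M)"
  using assms unfolding cov_def centered_process_def by simp

lemma cov_commute: "cov M X Y = cov M Y X"
  unfolding cov_def by (simp add: mult.commute)

lemma cov_diag_nonneg: "0 \<le> cov M X X"
  unfolding cov_def by (intro Bochner_Integration.integral_nonneg) simp

lemma gauss_vec_process:
  assumes Z: "gaussian_process M Z" "centered_process M Z" and F: "finite F" "F \<subseteq> {0..}"
  shows "gauss_vec M F Z (\<lambda>s t. cov M (Z s) (Z t))"
proof -
  have M: "prob_space M" using Z(1) by (simp add: gaussian_process_def)
  interpret prob_space M by fact
  have G: "gaussian_rv M (\<lambda>\<omega>. \<Sum>t\<in>F. c t * Z t \<omega>)" if "finite F" "F \<subseteq> {0..}" for F c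
    using Z(1) that by (simp add: gaussian_process_def)
  have G1: "gaussian_rv M (Z t)" if "0 \<le> t" for t using G[of "{t}" "\<lambda>_. 1"] that by simp
  have i1: "integrable M (Z t)" and E1: "(\<integral>\<omega>. Z t \<omega> \<partial>M) = 0" if "0 \<le> t" for t
    using Z(2) that by (auto simp: centered_process_def)
  have Zm: "Z t \<in> borel_measurable M" if "t \<in> F" for t using i1[of t] that F by auto
  have sq: "integrable M (\<lambda>\<omega>. (Z t \<omega>)\<^sup>2)" if "0 \<le> t" for t
    by (rule gaussian_rv_centered(1)[OF M G1[OF that] E1[OF that]])
  have i2: "integrable M (\<lambda>\<omega>. Z s \<omega> * Z t \<omega>)" if st: "s \<in> F" "t \<in> F" for s t
  proof (rule Bochner_Integration.integrable_bound)
    show "integrable M (\<lambda>\<omega>. (Z s \<omega>)\<^sup>2 + (Z t \<omega>)\<^sup>2)" using st F by (intro Bochner_Integration.integrable_add sq) auto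
    show "(\<lambda>\<omega>. Z s \<omega> * Z t \<omega>) \<in> borel_measurable M" using Zm st by measurable
    have "\<bar>x * y\<bar> \<le> x\<^sup>2 + y\<^sup>2" for x y :: real
    proof -
      have "2 * (\<bar>x\<bar> * \<bar>y\<bar>) \<le> \<bar>x\<bar>\<^sup>2 + \<bar>y\<bar>\<^sup>2" using sum_squares_bound[of "\<bar>x\<bar>" "\<bar>y\<bar>"] by simp
      moreover have "0 \<le> \<bar>x\<bar> * \<bar>y\<bar>" by simp
      ultimately have "\<bar>x\<bar> * \<bar>y\<bar> \<le> \<bar>x\<bar>\<^sup>2 + \<bar>y\<bar>\<^sup>2" by linarith
      then show ?thesis by (simp add: abs_mult)
    qed
    then show "AE \<omega> in M. norm (Z s \<omega> * Z t \<omega>) \<le> norm ((Z s \<omega>)\<^sup>2 + (Z t \<omega>)\<^sup>2)" by simp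
  qed
  show ?thesis unfolding gauss_vec_def
  proof (intro conjI allI ballI)
    fix c
    have E: "(\<integral>\<omega>. (\<Sum>t\<in>F. c t * Z t \<omega>) \<partial>M) = 0"
    proof -
      have "(\<integral>\<omega>. (\<Sum>t\<in>F. c t * Z t \<omega>) \<partial>M) = (\<Sum>t\<in>F. \<integral>\<omega>. c t * Z t \<omega> \<partial>M)"
        using i1 F by (intro Bochner_Integration.integral_sum) auto
      also have "\<dots> = 0" using E1 F by (intro sum.neutral) auto
      finally show ?thesis .
    qed
    have "(\<integral>\<omega>. (\<Sum>t\<in>F. c t * Z t \<omega>)\<^sup>2 \<partial>M) = (\<integral>\<omega>. (\<Sum>s\<in>F. \<Sum>t\<in>F. c s * c t * (Z s \<omega> * Z t \<omega>)) \<partial>M)"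
      unfolding power2_eq_square sum_product by (simp add: mult_ac)
    also have "\<dots> = (\<Sum>s\<in>F. \<integral>\<omega>. (\<Sum>t\<in>F. c s * c t * (Z s \<omega> * Z t \<omega>)) \<partial>M)"
      using i2 by (intro Bochner_Integration.integral_sum Bochner_Integration.integrable_sum integrable_mult_right) auto
    also have "\<dots> = (\<Sum>s\<in>F. \<Sum>t\<in>F. \<integral>\<omega>. c s * c t * (Z s \<omega> * Z t \<omega>) \<partial>M)"
      using i2 by (intro sum.cong refl Bochner_Integration.integral_sum integrable_mult_right) auto
    also have "\<dots> = (\<Sum>s\<in>F. \<Sum>t\<in>F. c s * c t * cov M (Z s) (Z t))"
      using F cov_centered[OF Z(2)] by (intro sum.cong refl) (auto simp: subset_iff)
    finally show "(CLINT \<omega>|M. iexp (\<Sum>t\<in>F. c t * Z t \<omega>)) =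
       of_real (exp (- (\<Sum>s\<in>F. \<Sum>t\<in>F. c s * c t * cov M (Z s) (Z t)) / 2))"
      using gaussian_rv_centered(2)[OF M G[OF F, of c] E] by simp
  qed (use M F Zm in auto)
qed

lemma gauss_procI:
  assumes "gaussian_process M Z" "centered_process M Z" "separable_process M Z"
  shows "gauss_proc M Z (\<lambda>s t. cov M (Z s) (Z t))"
  using assms gauss_vec_process unfolding gauss_proc_def by blast

lemma gauss_proc_cong:
  assumes P: "gauss_proc M Z K" and K: "\<And>s t. 0 \<le> s \<Longrightarrow> 0 \<le> t \<Longrightarrow> K s t = K' s t"
  shows "gauss_proc M Z K'"
  unfolding gauss_proc_def
proof (intro conjI allI impI)
  show "separable_process M Z" by (rule gauss_procD[OF P])
  fix F :: "real set" assume F: "finite F \<and> F \<subseteq> {0..}"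
  show "gauss_vec M F Z K'"
    by (rule gauss_vec_cong[OF gauss_procD(4)[OF P]]) (use F K in \<open>auto simp: subset_iff\<close>)
qed

text \<open>
  A centered Gaussian process with shift-invariant covariance is stationary, because covariances
  determine the finite-dimensional laws.
\<close>

lemma stationary_processI:
  assumes Z: "gaussian_process M Z" "centered_process M Z"
    and stat: "\<And>s t h. 0 \<le> s \<Longrightarrow> 0 \<le> t \<Longrightarrow> 0 \<le> h \<Longrightarrow> cov M (Z (s + h)) (Z (t + h)) = cov M (Z s) (Z t)"
  shows "stationary_process M Z"
  unfolding stationary_process_def
proof (intro allI impI)
  fix h :: real and F :: "real set" assume h: "0 \<le> h" and F: "finite F \<and> F \<subseteq> {0..}"
  have G: "gauss_vec M F Z (\<lambda>s t. cov M (Z s) (Z t))" using F by (intro gauss_vec_process[OF Z]) auto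
  have G0: "gauss_vec M ((\<lambda>t. t + h) ` F) Z (\<lambda>s t. cov M (Z s) (Z t))"
    using F h by (intro gauss_vec_process[OF Z]) auto
  have G1: "gauss_vec M F (\<lambda>t. Z (t + h)) (\<lambda>s t. cov M (Z s) (Z t))"
    by (rule gauss_vec_cong[OF gauss_vec_reindex[OF G0, of F "\<lambda>t. t + h"]]) (use F h stat in \<open>auto simp: subset_iff\<close>)
  show "distr M (Pi\<^sub>M F (\<lambda>_. borel)) (\<lambda>\<omega>. \<lambda>t\<in>F. Z (t + h) \<omega>) = distr M (Pi\<^sub>M F (\<lambda>_. borel)) (\<lambda>\<omega>. \<lambda>t\<in>F. Z t \<omega>)"
    by (rule gauss_vec_law_unique[OF G1 G])
qed

section \<open>Transport to path space\<close>

text \<open>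
  The largest sigma-algebra that makes the path map measurable from the completion is used rather than
  the product sigma-algebra, since separability is a property of uncountably many coordinates.
\<close>

definition path_space :: "'a measure \<Rightarrow> (real \<Rightarrow> 'a \<Rightarrow> real) \<Rightarrow> (real \<Rightarrow> real) measure" where
  "path_space M Z = distr (completion M)
     (sigma UNIV {B. (\<lambda>\<omega> t. Z t \<omega>) -` B \<inter> space M \<in> sets (completion M)}) (\<lambda>\<omega> t. Z t \<omega>)"

lemma space_path_space: "space (path_space M Z) = UNIV"
  by (simp add: path_space_def space_measure_of_conv)

lemma sets_path_spaceI: "(\<lambda>\<omega> t. Z t \<omega>) -` B \<inter> space M \<in> sets (completion M) \<Longrightarrow> B \<in> sets (path_space M Z)"
  by (simp add: path_space_def)

lemma measurable_to_path:
  "(\<lambda>\<omega> t. Z t \<omega>) \<in> measurable (completion M) (sigma UNIV {B. (\<lambda>\<omega> t. Z t \<omega>) -` B \<inter> space M \<in> sets (completion M)})"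
  by (rule measurable_measure_of) auto

lemma measurable_path_spaceI:
  assumes "(\<lambda>\<omega>. g (\<lambda>t. Z t \<omega>)) \<in> measurable M N" "\<And>f. g f \<in> space N"
  shows "g \<in> measurable (path_space M Z) N"
proof (rule measurableI)
  fix A assume A: "A \<in> sets N"
  have "(\<lambda>\<omega> t. Z t \<omega>) -` (g -` A) \<inter> space M = (\<lambda>\<omega>. g (\<lambda>t. Z t \<omega>)) -` A \<inter> space M" by auto
  also have "\<dots> \<in> sets M" using assms(1) A by (rule measurable_sets)
  finally show "g -` A \<inter> space (path_space M Z) \<in> sets (path_space M Z)"
    unfolding space_path_space by (intro sets_path_spaceI) simp
qed (rule assms)

lemma distr_path_space:
  assumes g: "(\<lambda>\<omega>. g (\<lambda>t. Z t \<omega>)) \<in> measurable M N" "\<And>f. g f \<in> space N"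
  shows "distr (path_space M Z) N g = distr M N (\<lambda>\<omega>. g (\<lambda>t. Z t \<omega>))"
proof -
  have gm: "g \<in> measurable (sigma UNIV {B. (\<lambda>\<omega> t. Z t \<omega>) -` B \<inter> space M \<in> sets (completion M)}) N"
    using measurable_path_spaceI[OF g] unfolding path_space_def by simp
  have "distr (path_space M Z) N g = distr (completion M) N (g \<circ> (\<lambda>\<omega> t. Z t \<omega>))"
    unfolding path_space_def by (rule distr_distr[OF gm measurable_to_path])
  also have "\<dots> = distr M N (\<lambda>\<omega>. g (\<lambda>t. Z t \<omega>))"
    using distr_completion[OF g(1)] by (simp add: comp_def)
  finally show ?thesis .
qed

lemma integral_path_space:
  fixes g :: "(real \<Rightarrow> real) \<Rightarrow> real"
  assumes g: "(\<lambda>\<omega>. g (\<lambda>t. Z t \<omega>)) \<in> borel_measurable M"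
  shows "(\<integral>f. g f \<partial>path_space M Z) = (\<integral>\<omega>. g (\<lambda>t. Z t \<omega>) \<partial>M)"
    and "integrable (path_space M Z) g \<longleftrightarrow> integrable M (\<lambda>\<omega>. g (\<lambda>t. Z t \<omega>))"
proof -
  have gm: "g \<in> borel_measurable (path_space M Z)" using g by (rule measurable_path_spaceI) simp
  have d: "distr (path_space M Z) borel g = distr M borel (\<lambda>\<omega>. g (\<lambda>t. Z t \<omega>))" using g by (rule distr_path_space) simp
  have "(\<integral>f. g f \<partial>path_space M Z) = (\<integral>x. x \<partial>distr (path_space M Z) borel g)" using gm by (subst integral_distr) auto
  also have "\<dots> = (\<integral>\<omega>. g (\<lambda>t. Z t \<omega>) \<partial>M)" unfolding d using g by (subst integral_distr) auto
  finally show "(\<integral>f. g f \<partial>path_space M Z) = (\<integral>\<omega>. g (\<lambda>t. Z t \<omega>) \<partial>M)" .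
  have "integrable (path_space M Z) g \<longleftrightarrow> integrable (distr (path_space M Z) borel g) (\<lambda>x. x)" using gm by (subst integrable_distr_eq) auto
  also have "\<dots> \<longleftrightarrow> integrable M (\<lambda>\<omega>. g (\<lambda>t. Z t \<omega>))" unfolding d using g by (subst integrable_distr_eq) auto
  finally show "integrable (path_space M Z) g \<longleftrightarrow> integrable M (\<lambda>\<omega>. g (\<lambda>t. Z t \<omega>))" .
qed

text \<open>
  A set of full measure is measurable in the completion, hence its description in terms of paths is
  measurable in path space, however many times it involves.
\<close>

lemma AE_path_space:
  assumes "AE \<omega> in M. P (\<lambda>t. Z t \<omega>)"
  shows "AE f in path_space M Z. P f"
proof -
  have ae: "AE \<omega> in completion M. P (\<lambda>t. Z t \<omega>)" using assms by (rule AE_completion)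
  then have "{\<omega>\<in>space (completion M). \<not> P (\<lambda>t. Z t \<omega>)} \<in> null_sets (completion M)"
    by (subst (asm) completion.AE_iff_null_sets)
  then have "{\<omega>\<in>space M. \<not> P (\<lambda>t. Z t \<omega>)} \<in> sets (completion M)" by auto
  then have "space (completion M) - {\<omega>\<in>space M. \<not> P (\<lambda>t. Z t \<omega>)} \<in> sets (completion M)" by (rule sets.compl_sets)
  also have "space (completion M) - {\<omega>\<in>space M. \<not> P (\<lambda>t. Z t \<omega>)} = (\<lambda>\<omega> t. Z t \<omega>) -` {f. P f} \<inter> space M" by auto
  finally have "{f \<in> UNIV. P f} \<in> sets (sigma UNIV {B. (\<lambda>\<omega> t. Z t \<omega>) -` B \<inter> space M \<in> sets (completion M)})" by simp
  then show ?thesis unfolding path_space_def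
    using ae by (subst AE_distr_iff[OF measurable_to_path]) (simp_all add: space_measure_of_conv)
qed

lemma gaussian_rv_path_space:
  assumes "gaussian_rv M (\<lambda>\<omega>. g (\<lambda>t. Z t \<omega>))"
  shows "gaussian_rv (path_space M Z) g"
proof -
  have gm: "(\<lambda>\<omega>. g (\<lambda>t. Z t \<omega>)) \<in> borel_measurable M" using assms by (simp add: gaussian_rv_def)
  have m: "g \<in> borel_measurable (path_space M Z)" using gm by (rule measurable_path_spaceI) simp
  have lm: "(\<lambda>\<omega>. g (\<lambda>t. Z t \<omega>)) \<in> measurable M lborel" "g \<in> measurable (path_space M Z) lborel" using gm m by auto
  from assms consider (1) c where "AE \<omega> in M. g (\<lambda>t. Z t \<omega>) = c"
    | (2) c \<sigma> where "\<sigma> > 0" "distributed M lborel (\<lambda>\<omega>. g (\<lambda>t. Z t \<omega>)) (\<lambda>x. ennreal (normal_density c \<sigma> x))"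
    by (auto simp: gaussian_rv_def)
  then show ?thesis
  proof cases
    case 1
    then have "AE f in path_space M Z. g f = c" by (rule AE_path_space)
    then show ?thesis using m by (auto simp: gaussian_rv_def)
  next
    case 2
    have "distr (path_space M Z) lborel g = distr M lborel (\<lambda>\<omega>. g (\<lambda>t. Z t \<omega>))" using lm(1) by (rule distr_path_space) simp
    then have "distributed (path_space M Z) lborel g (\<lambda>x. ennreal (normal_density c \<sigma> x))"
      using 2(2) lm(2) by (simp add: distributed_def)
    then show ?thesis using m 2(1) by (auto simp: gaussian_rv_def)
  qed
qed

lemma path_space_transport:
  assumes Z: "gaussian_process M Z" "centered_process M Z" "stationary_process M Z" "separable_process M Z"
    "has_stationary_autocorr M Z A"
  shows "gaussian_process (path_space M Z) (\<lambda>t f. f t)" "centered_process (path_space M Z) (\<lambda>t f. f t)"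
    "stationary_process (path_space M Z) (\<lambda>t f. f t)" "separable_process (path_space M Z) (\<lambda>t f. f t)"
    "has_stationary_autocorr (path_space M Z) (\<lambda>t f. f t) A"
proof -
  have M: "prob_space M" using Z(1) by (simp add: gaussian_process_def)
  interpret prob_space M by fact
  have Zi: "integrable M (Z t)" if "0 \<le> t" for t using Z(2) that by (simp add: centered_process_def)
  have Zm[measurable]: "Z t \<in> borel_measurable M" if "0 \<le> t" for t using Zi[OF that] by simp
  have ps: "prob_space (path_space M Z)" unfolding path_space_def
    by (rule prob_space.prob_space_distr[OF prob_space_completion measurable_to_path])
  show "gaussian_process (path_space M Z) (\<lambda>t f. f t)"
    unfolding gaussian_process_def
    using ps Z(1) by (auto simp: gaussian_process_def intro!: gaussian_rv_path_space)
  show "centered_process (path_space M Z) (\<lambda>t f. f t)"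
    unfolding centered_process_def
  proof (intro allI impI)
    fix t :: real assume t: "0 \<le> t"
    show "integrable (path_space M Z) (\<lambda>f. f t) \<and> (\<integral>f. f t \<partial>path_space M Z) = 0"
      using integral_path_space[of "\<lambda>f. f t" Z M] Zm[OF t] t Z(2) by (simp add: centered_process_def)
  qed
  show "stationary_process (path_space M Z) (\<lambda>t f. f t)"
    unfolding stationary_process_def
  proof (intro allI impI)
    fix h :: real and F :: "real set" assume h: "0 \<le> h" and F: "finite F \<and> F \<subseteq> {0..}"
    have m: "(\<lambda>\<omega>. \<lambda>t\<in>F. Z (t + h') \<omega>) \<in> measurable M (Pi\<^sub>M F (\<lambda>_. borel))" if "0 \<le> h'" for h'
      using F that by (intro measurable_restrict Zm) (auto simp: subset_iff)
    have "distr (path_space M Z) (Pi\<^sub>M F (\<lambda>_. borel)) (\<lambda>f. \<lambda>t\<in>F. f (t + h')) = distr M (Pi\<^sub>M F (\<lambda>_. borel)) (\<lambda>\<omega>. \<lambda>t\<in>F. Z (t + h') \<omega>)" if "0 \<le> h'" for h'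
      using m[OF that] by (rule distr_path_space) (auto simp: space_PiM)
    from this[of h] this[of 0] show "distr (path_space M Z) (Pi\<^sub>M F (\<lambda>_. borel)) (\<lambda>f. \<lambda>t\<in>F. f (t + h)) =
        distr (path_space M Z) (Pi\<^sub>M F (\<lambda>_. borel)) (\<lambda>f. \<lambda>t\<in>F. f t)"
      using Z(3) h F by (simp add: stationary_process_def)
  qed
  show "separable_process (path_space M Z) (\<lambda>t f. f t)"
  proof -
    obtain D where D: "D \<subseteq> {0..}" "countable D" "AE \<omega> in M. \<forall>t\<ge>0. (t, Z t \<omega>) \<in> closure ((\<lambda>d. (d, Z d \<omega>)) ` D)"
      using Z(4) unfolding separable_process_def by blast
    from AE_path_space[of "\<lambda>f. \<forall>t\<ge>0. (t, f t) \<in> closure ((\<lambda>d. (d, f d)) ` D)" Z M, OF D(3)] D(1,2)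
    show ?thesis unfolding separable_process_def by blast
  qed
  have c: "cov (path_space M Z) (\<lambda>f. f s) (\<lambda>f. f t) = cov M (Z s) (Z t)" if "0 \<le> s" "0 \<le> t" for s t
  proof -
    have e: "(\<integral>f. f t \<partial>path_space M Z) = (\<integral>\<omega>. Z t \<omega> \<partial>M)" if "0 \<le> t" for t
      using integral_path_space(1)[of "\<lambda>f. f t" Z M] Zm[OF that] by simp
    show ?thesis unfolding cov_def e[OF that(1)] e[OF that(2)]
      using that by (intro integral_path_space(1)) measurable
  qed
  show "has_stationary_autocorr (path_space M Z) (\<lambda>t f. f t) A"
    using Z(5) by (auto simp: has_stationary_autocorr_def autocorr_def c)
qed

section \<open>The persistence exponent\<close>

lemma stationary_autocorrelation_0:
  assumes "A \<in> \<S>"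
  shows "A 0 = 1"
proof -
  obtain M :: "(real \<Rightarrow> real) measure" and Z where Z: "unit_variance_process M Z" "\<forall>s\<ge>0. \<forall>t\<ge>0. cov M (Z s) (Z t) = A \<bar>t - s\<bar>"
    using assms unfolding stationary_autocorrelations_def by blast
  have "A 0 = cov M (Z 0) (Z 0)" using Z(2)[rule_format, of 0 0] by simp
  also have "\<dots> = 1" using Z(1) by (simp add: cov_def unit_variance_process_def power2_eq_square)
  finally show ?thesis .
qed

text \<open>
  Stationarity makes the variance \<open>v\<close> constant, and \<open>A 0 = 1\<close> excludes \<open>v = 0\<close>, for which the
  autocorrelation would be \<open>0 / 0 = 0\<close>.
\<close>

lemma stationary_gauss_proc:
  assumes A: "A \<in> \<S>" and Z: "gaussian_process M Z" "centered_process M Z" "stationary_process M Z" "separable_process M Z"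
    "has_stationary_autocorr M Z A"
  obtains v where "0 < v" "gauss_proc M Z (\<lambda>s t. v * A \<bar>t - s\<bar>)"
proof -
  define C where "C s t = cov M (Z s) (Z t)" for s t
  have Zm: "Z t \<in> borel_measurable M" if "0 \<le> t" for t using Z(2) that by (auto simp: centered_process_def)
  have diag: "C t t = C 0 0" if t: "0 \<le> t" for t
  proof -
    let ?E = "\<lambda>X. (\<integral>x. (x 0 - (\<integral>x. x 0 \<partial>X)) * (x 0 - (\<integral>x. x 0 \<partial>X)) \<partial>X) :: real"
    have e: "C h h = ?E (distr M (Pi\<^sub>M {0} (\<lambda>_. borel)) (\<lambda>\<omega>. \<lambda>t\<in>{0::real}. Z (t + h) \<omega>))" if h: "0 \<le> h" for h
    proof -
      have m: "(\<lambda>\<omega>. \<lambda>t\<in>{0::real}. Z (t + h) \<omega>) \<in> measurable M (Pi\<^sub>M {0} (\<lambda>_. borel))"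
        using Zm[OF h] by (intro measurable_restrict) auto
      let ?D = "distr M (Pi\<^sub>M {0} (\<lambda>_. borel)) (\<lambda>\<omega>. \<lambda>t\<in>{0::real}. Z (t + h) \<omega>)"
      have "(\<integral>x. x 0 \<partial>?D) = (\<integral>\<omega>. (\<lambda>t\<in>{0::real}. Z (t + h) \<omega>) 0 \<partial>M)"
        by (rule integral_distr[OF m]) measurable
      then have mean: "(\<integral>x. x 0 \<partial>?D) = (\<integral>\<omega>. Z h \<omega> \<partial>M)" by simp
      have "?E ?D = (\<integral>x. (x 0 - (\<integral>\<omega>. Z h \<omega> \<partial>M)) * (x 0 - (\<integral>\<omega>. Z h \<omega> \<partial>M)) \<partial>?D)"
        by (simp only: mean)
      also have "\<dots> = (\<integral>\<omega>. ((\<lambda>t\<in>{0::real}. Z (t + h) \<omega>) 0 - (\<integral>\<omega>. Z h \<omega> \<partial>M)) * ((\<lambda>t\<in>{0::real}. Z (t + h) \<omega>) 0 - (\<integral>\<omega>. Z h \<omega> \<partial>M)) \<partial>M)"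
        by (rule integral_distr[OF m]) measurable
      also have "\<dots> = C h h" unfolding C_def cov_def by simp
      finally show ?thesis ..
    qed
    have "distr M (Pi\<^sub>M {0} (\<lambda>_. borel)) (\<lambda>\<omega>. \<lambda>t'\<in>{0::real}. Z (t' + t) \<omega>) = distr M (Pi\<^sub>M {0} (\<lambda>_. borel)) (\<lambda>\<omega>. \<lambda>t'\<in>{0::real}. Z (t' + 0) \<omega>)"
      using Z(3)[unfolded stationary_process_def, rule_format, OF t, of "{0}"] by simp
    then show ?thesis using e[OF t] e[of 0] by simp
  qed
  have sA: "C s t / sqrt (C s s * C t t) = A (t - s)" if "0 \<le> s" "s \<le> t" for s t
    using Z(5) that by (simp add: has_stationary_autocorr_def autocorr_def C_def)
  have C0: "0 \<le> C 0 0" unfolding C_def by (rule cov_diag_nonneg)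
  have "C 0 0 \<noteq> 0" using sA[of 0 0] stationary_autocorrelation_0[OF A] by auto
  with C0 have pos: "0 < C 0 0" by simp
  have le: "C s t = C 0 0 * A (t - s)" if "0 \<le> s" "s \<le> t" for s t
    using sA[OF that] diag[of s] diag[of t] that pos by (simp add: field_simps)
  have CC: "C s t = C 0 0 * A \<bar>t - s\<bar>" if "0 \<le> s" "0 \<le> t" for s t
  proof (cases "s \<le> t")
    case True then show ?thesis using le[of s t] that by simp
  next
    case False
    then have "C t s = C 0 0 * A (s - t)" using le[of t s] that by simp
    moreover have "C s t = C t s" unfolding C_def by (rule cov_commute)
    ultimately show ?thesis using False by simp
  qed
  show ?thesis
    by (rule that[OF pos[unfolded C_def]], rule gauss_proc_cong[OF gauss_procI[OF Z(1,2,4)]], rule CC[unfolded C_def])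
qed

text \<open>
  All realizations of \<open>A\<close> have the limit \<open>l\<close> of the given one. That \<open>- l\<close> is the only value with this
  property is seen from the realization on path space.
\<close>

lemma persistence_exponent_limit:
  fixes M :: "'b measure"
  assumes A: "A \<in> \<S>\<^sub>+" and Z: "gaussian_process M Z" "centered_process M Z" "stationary_process M Z" "separable_process M Z"
    "has_stationary_autocorr M Z A"
  shows "0 \<le> persistence_exponent A" "(log_persistence_rate M Z \<longlongrightarrow> - persistence_exponent A) at_top"
proof -
  have AS: "A \<in> \<S>" and A0: "\<And>t. 0 \<le> t \<Longrightarrow> 0 \<le> A t" using A by (auto simp: nonneg_stationary_autocorrelations_def)
  obtain v where v: "0 < v" "gauss_proc M Z (\<lambda>s t. v * A \<bar>t - s\<bar>)" by (rule stationary_gauss_proc[OF AS Z])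
  define l where "l = (SUP L\<in>{0<..}. log_persistence_rate M Z L)"
  have lim: "(log_persistence_rate M Z \<longlongrightarrow> l) at_top" unfolding l_def
    by (rule log_persistence_rate_tendsto_SUP[OF v(2)]) (use v A0 in \<open>auto simp: abs_minus_commute\<close>)
  have l0: "l \<le> 0" unfolding l_def
    by (intro SUP_least) (auto simp: log_persistence_rate_eq intro!: rate_nonpos sup_lt_bounds[OF v(2)])
  have same: "(log_persistence_rate N W \<longlongrightarrow> l) at_top"
    if W: "gaussian_process N W" "centered_process N W" "stationary_process N W" "separable_process N W" "has_stationary_autocorr N W A"
    for N :: "(real \<Rightarrow> real) measure" and W
  proof -
    obtain w where w: "0 < w" "gauss_proc N W (\<lambda>s t. w * A \<bar>t - s\<bar>)" by (rule stationary_gauss_proc[OF AS W])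
    have "sup_lt M Z 0 T 0 = sup_lt N W 0 T 0" if "0 \<le> T" for T
      using v(1) w(1) that
      by (intro antisym sup_lt_zero_cov_scale[OF v(2) w(2), of 0 T "v / w"] sup_lt_zero_cov_scale[OF w(2) v(2), of 0 T "w / v"]) auto
    then have "\<forall>\<^sub>F T in at_top. log_persistence_rate M Z T = log_persistence_rate N W T"
      unfolding log_persistence_rate_eq by (intro eventually_mono[OF eventually_ge_at_top[of 0]]) simp
    then show ?thesis using lim by (rule Lim_transform_eventually[rotated])
  qed
  note tr = path_space_transport[OF Z]
  have "persistence_exponent A = - l"
    unfolding persistence_exponent_def
  proof (rule the_equality)
    show "\<forall>(M :: (real \<Rightarrow> real) measure) Z. gaussian_process M Z \<and> centered_process M Z \<and> stationary_process M Z \<and>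
       separable_process M Z \<and> has_stationary_autocorr M Z A \<longrightarrow> (log_persistence_rate M Z \<longlongrightarrow> - (- l)) at_top"
      using same by simp
  next
    fix b assume "\<forall>(M :: (real \<Rightarrow> real) measure) Z. gaussian_process M Z \<and> centered_process M Z \<and> stationary_process M Z \<and>
       separable_process M Z \<and> has_stationary_autocorr M Z A \<longrightarrow> (log_persistence_rate M Z \<longlongrightarrow> - b) at_top"
    then have "(log_persistence_rate (path_space M Z) (\<lambda>t f. f t) \<longlongrightarrow> - b) at_top" using tr by blast
    moreover have "(log_persistence_rate (path_space M Z) (\<lambda>t f. f t) \<longlongrightarrow> l) at_top" by (rule same[OF tr])
    ultimately have "- b = l" by (intro tendsto_unique[of at_top]) auto
    then show "b = - l" by auto
  qed
  then show "0 \<le> persistence_exponent A" "(log_persistence_rate M Z \<longlongrightarrow> - persistence_exponent A) at_top"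
    using l0 lim by (auto simp: ereal_uminus_le_reorder)
qed

section \<open>Large deviations of moving averages\<close>

lemma std_normal_exp_abs:
  "(\<integral>\<^sup>+x. ennreal (exp (a * \<bar>x\<bar>)) \<partial>std_normal) \<le> ennreal (2 * exp (a\<^sup>2 / 2))"
proof -
  have mgf: "(\<integral>\<^sup>+x. ennreal (exp (c * x)) \<partial>std_normal) = ennreal (exp (c\<^sup>2 / 2))" for c :: real
  proof -
    have e: "std_normal_density x * exp (c * x) = exp (c\<^sup>2 / 2) * normal_density c 1 x" for x
    proof -
      have "- x\<^sup>2 / 2 + c * x = c\<^sup>2 / 2 + - (x - c)\<^sup>2 / 2" by (simp add: power2_eq_square field_simps)
      then have "exp (- x\<^sup>2 / 2) * exp (c * x) = exp (c\<^sup>2 / 2) * exp (- (x - c)\<^sup>2 / 2)"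
        unfolding exp_add[symmetric] by (simp only:)
      then show ?thesis by (simp add: normal_density_def)
    qed
    have "(\<integral>\<^sup>+x. ennreal (exp (c * x)) \<partial>std_normal) = (\<integral>\<^sup>+x. ennreal (std_normal_density x) * ennreal (exp (c * x)) \<partial>lborel)"
      by (rule nn_integral_density) measurable
    also have "\<dots> = (\<integral>\<^sup>+x. ennreal (exp (c\<^sup>2 / 2)) * ennreal (normal_density c 1 x) \<partial>lborel)"
      by (simp add: ennreal_mult[symmetric] e)
    also have "\<dots> = ennreal (exp (c\<^sup>2 / 2)) * (\<integral>\<^sup>+x. ennreal (normal_density c 1 x) \<partial>lborel)"
      by (rule nn_integral_cmult) measurable
    also have "(\<integral>\<^sup>+x. ennreal (normal_density c 1 x) \<partial>lborel) = 1"
      by (subst nn_integral_eq_integral) simp_all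
    finally show ?thesis by simp
  qed
  have "(\<integral>\<^sup>+x. ennreal (exp (a * \<bar>x\<bar>)) \<partial>std_normal) \<le> (\<integral>\<^sup>+x. ennreal (exp (a * x)) + ennreal (exp (- a * x)) \<partial>std_normal)"
  proof (rule nn_integral_mono)
    fix x :: real
    have "exp (a * \<bar>x\<bar>) \<le> exp (a * x) + exp (- a * x)" by (cases "x \<ge> 0") auto
    then have "ennreal (exp (a * \<bar>x\<bar>)) \<le> ennreal (exp (a * x) + exp (- a * x))" by (rule ennreal_leI)
    also have "\<dots> = ennreal (exp (a * x)) + ennreal (exp (- a * x))" by (rule ennreal_plus) simp_all
    finally show "ennreal (exp (a * \<bar>x\<bar>)) \<le> ennreal (exp (a * x)) + ennreal (exp (- a * x))" .
  qed
  also have "\<dots> = (\<integral>\<^sup>+x. ennreal (exp (a * x)) \<partial>std_normal) + (\<integral>\<^sup>+x. ennreal (exp (- a * x)) \<partial>std_normal)"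
    by (rule nn_integral_add) measurable
  also have "\<dots> = ennreal (2 * exp (a\<^sup>2 / 2))"
    unfolding mgf by (subst ennreal_plus[symmetric]) simp_all
  finally show ?thesis .
qed

text \<open>
  The exponential Chebyshev inequality.
\<close>

lemma iid_normal_abs_sum_tail:
  fixes J :: "'j set"
  assumes J: "finite J" and a: "0 \<le> a"
  shows "measure (PiM J (\<lambda>_. std_normal)) {g\<in>space (PiM J (\<lambda>_. std_normal)). x \<le> (\<Sum>j\<in>J. \<bar>g j\<bar>)}
    \<le> exp (- a * x) * (2 * exp (a\<^sup>2 / 2)) ^ card J"
proof -
  let ?M = "PiM J (\<lambda>_. std_normal) :: ('j \<Rightarrow> real) measure"
  interpret S: prob_space std_normal by (rule prob_space_normal_density) simp
  interpret P: prob_space ?M by (rule gauss_vecD(1)[OF gauss_vec_iid[OF J]])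
  interpret PP: product_prob_space "\<lambda>_. std_normal" J ..
  let ?A = "{g\<in>space ?M. x \<le> (\<Sum>j\<in>J. \<bar>g j\<bar>)}"
  have A: "?A \<in> sets ?M" by measurable
  have "emeasure ?M ?A = (\<integral>\<^sup>+g. indicator ?A g \<partial>?M)" using A by simp
  also have "\<dots> \<le> (\<integral>\<^sup>+g. ennreal (exp (- a * x)) * (\<Prod>j\<in>J. ennreal (exp (a * \<bar>g j\<bar>))) \<partial>?M)"
  proof (rule nn_integral_mono)
    fix g
    have e: "ennreal (exp (- a * x)) * (\<Prod>j\<in>J. ennreal (exp (a * \<bar>g j\<bar>))) = ennreal (exp (a * ((\<Sum>j\<in>J. \<bar>g j\<bar>) - x)))"
    proof -
      have "(\<Prod>j\<in>J. ennreal (exp (a * \<bar>g j\<bar>))) = ennreal (exp (\<Sum>j\<in>J. a * \<bar>g j\<bar>))"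
        using J by (simp add: prod_ennreal exp_sum)
      then show ?thesis
        by (simp add: ennreal_mult[symmetric] exp_add[symmetric] sum_distrib_left algebra_simps)
    qed
    show "indicator ?A g \<le> ennreal (exp (- a * x)) * (\<Prod>j\<in>J. ennreal (exp (a * \<bar>g j\<bar>)))"
      unfolding e using a by (auto simp: indicator_def)
  qed
  also have "\<dots> = ennreal (exp (- a * x)) * (\<integral>\<^sup>+g. (\<Prod>j\<in>J. ennreal (exp (a * \<bar>g j\<bar>))) \<partial>?M)"
    by (rule nn_integral_cmult) measurable
  also have "(\<integral>\<^sup>+g. (\<Prod>j\<in>J. ennreal (exp (a * \<bar>g j\<bar>))) \<partial>?M) = (\<Prod>j\<in>J. \<integral>\<^sup>+x. ennreal (exp (a * \<bar>x\<bar>)) \<partial>std_normal)"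
    using J by (intro PP.product_nn_integral_prod) auto
  also have "\<dots> \<le> (\<Prod>j\<in>J. ennreal (2 * exp (a\<^sup>2 / 2)))"
    by (intro prod_mono_ennreal std_normal_exp_abs)
  also have "ennreal (exp (- a * x)) * (\<Prod>j\<in>J. ennreal (2 * exp (a\<^sup>2 / 2))) = ennreal (exp (- a * x) * (2 * exp (a\<^sup>2 / 2)) ^ card J)"
  proof -
    have "(\<Prod>j\<in>J. ennreal (2 * exp (a\<^sup>2 / 2))) = ennreal ((2 * exp (a\<^sup>2 / 2)) ^ card J)"
      by (simp only: prod_constant) (rule ennreal_power, simp)
    then show ?thesis by (simp only:) (rule ennreal_mult[symmetric], simp_all)
  qed
  finally have "emeasure ?M ?A \<le> ennreal (exp (- a * x) * (2 * exp (a\<^sup>2 / 2)) ^ card J)"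
    by (simp add: mult_left_mono)
  then show ?thesis unfolding P.emeasure_eq_measure by (simp add: ennreal_le_iff)
qed

text \<open>
  If at least \<open>\<delta> * N\<close> of the linear forms are below \<open>- L\<close>, then the sum of their absolute values is at
  least \<open>\<delta> * N * L\<close>, while it is at most \<open>B\<close> times the sum of the \<open>2 * N\<close> absolute values \<open>\<bar>g j\<bar>\<close>.
\<close>

lemma linear_excursion_count_tail:
  fixes J :: "'j set" and b :: "nat \<Rightarrow> 'j \<Rightarrow> real"
  assumes J: "finite J" "card J = 2 * N" and B: "0 < B" "\<And>j. j \<in> J \<Longrightarrow> (\<Sum>i<N. \<bar>b i j\<bar>) \<le> B"
    and \<delta>: "0 \<le> \<delta>" and L: "0 \<le> L"
  shows "measure (PiM J (\<lambda>_. std_normal)) {g\<in>space (PiM J (\<lambda>_. std_normal)). \<delta> * real N \<le> real (card {i\<in>{..<N}. (\<Sum>j\<in>J. b i j * g j) < - L})}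
    \<le> (4 * exp (- (\<delta> * L)\<^sup>2 / (4 * B\<^sup>2))) ^ N"
proof -
  let ?M = "PiM J (\<lambda>_. std_normal) :: ('j \<Rightarrow> real) measure"
  interpret P: prob_space ?M by (rule gauss_vecD(1)[OF gauss_vec_iid[OF J(1)]])
  define x where "x = \<delta> * real N * L / B"
  \<comment> \<open>The exponent that minimizes the Chernoff bound.\<close>
  define a where "a = \<delta> * L / (2 * B)"
  have a0: "0 \<le> a" using \<delta> L B by (simp add: a_def)
  have sub: "x \<le> (\<Sum>j\<in>J. \<bar>g j\<bar>)" if g: "\<delta> * real N \<le> real (card {i\<in>{..<N}. (\<Sum>j\<in>J. b i j * g j) < - L})" for g
  proof -
    let ?S = "{i\<in>{..<N}. (\<Sum>j\<in>J. b i j * g j) < - L}"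
    have "\<delta> * real N * L \<le> real (card ?S) * L" using g L by (rule mult_right_mono)
    also have "\<dots> = (\<Sum>i\<in>?S. L)" by simp
    also have "\<dots> \<le> (\<Sum>i\<in>?S. \<bar>\<Sum>j\<in>J. b i j * g j\<bar>)" by (intro sum_mono) auto
    also have "\<dots> \<le> (\<Sum>i<N. \<bar>\<Sum>j\<in>J. b i j * g j\<bar>)" by (intro sum_mono2) auto
    also have "\<dots> \<le> (\<Sum>i<N. \<Sum>j\<in>J. \<bar>b i j\<bar> * \<bar>g j\<bar>)"
      by (intro sum_mono order_trans[OF sum_abs]) (simp add: abs_mult)
    also have "\<dots> = (\<Sum>j\<in>J. (\<Sum>i<N. \<bar>b i j\<bar>) * \<bar>g j\<bar>)"
      by (subst sum.swap) (simp add: sum_distrib_right)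
    also have "\<dots> \<le> (\<Sum>j\<in>J. B * \<bar>g j\<bar>)" by (intro sum_mono mult_right_mono B) auto
    also have "\<dots> = B * (\<Sum>j\<in>J. \<bar>g j\<bar>)" by (simp add: sum_distrib_left)
    finally show ?thesis using B(1) by (simp add: x_def field_simps)
  qed
  have "measure ?M {g\<in>space ?M. \<delta> * real N \<le> real (card {i\<in>{..<N}. (\<Sum>j\<in>J. b i j * g j) < - L})} \<le>
     measure ?M {g\<in>space ?M. x \<le> (\<Sum>j\<in>J. \<bar>g j\<bar>)}"
    using sub by (intro P.finite_measure_mono) auto
  also have "\<dots> \<le> exp (- a * x) * (2 * exp (a\<^sup>2 / 2)) ^ card J"
    by (rule iid_normal_abs_sum_tail[OF J(1) a0])
  also have "\<dots> = (4 * exp (- (\<delta> * L)\<^sup>2 / (4 * B\<^sup>2))) ^ N"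
  proof -
    have "exp (- a * x) = exp (- a * (\<delta> * L / B)) ^ N"
      by (subst exp_of_nat_mult[symmetric]) (simp add: x_def mult_ac)
    moreover have "(2 * exp (a\<^sup>2 / 2)) ^ card J = (4 * exp (a\<^sup>2)) ^ N"
    proof -
      have "(2 * exp (a\<^sup>2 / 2))\<^sup>2 = 4 * exp (a\<^sup>2)"
        by (simp add: power_mult_distrib power2_eq_square[of "exp _"] exp_add[symmetric])
      then show ?thesis unfolding J(2) by (simp add: power_mult)
    qed
    moreover have "exp (- a * (\<delta> * L / B)) * (4 * exp (a\<^sup>2)) = 4 * exp (- (\<delta> * L)\<^sup>2 / (4 * B\<^sup>2))"
    proof -
      have "- a * (\<delta> * L / B) + a\<^sup>2 = - (\<delta> * L)\<^sup>2 / (4 * B\<^sup>2)"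
        using B(1) by (simp add: a_def power2_eq_square field_simps)
      then show ?thesis by (simp add: exp_add[symmetric])
    qed
    ultimately show ?thesis by (simp only: power_mult_distrib[symmetric])
  qed
  finally show ?thesis .
qed

definition nat_dist :: "nat \<Rightarrow> nat \<Rightarrow> nat" where
  "nat_dist i l = (i - l) + (l - i)"

text \<open>
  The terms with \<open>l \<le> i\<close> and those with \<open>l > i\<close> are both part of the same convergent series.
\<close>

lemma powr_row_sum_bounded:
  assumes "1 < \<alpha>"
  obtains S where "1 \<le> S" "\<And>i N. (\<Sum>l<N. real (Suc (nat_dist i l)) powr (- \<alpha>)) \<le> S"
proof -
  let ?f = "\<lambda>n. real (Suc n) powr (- \<alpha>)"
  have "summable (\<lambda>n. real n powr (- \<alpha>))" using assms by (simp add: summable_real_powr_iff)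
  then have s: "summable ?f" by (subst summable_Suc_iff)
  have fs: "sum ?f A \<le> suminf ?f" if "finite A" for A by (rule sum_le_suminf[OF s that]) simp
  have "(\<Sum>l<N. ?f (nat_dist i l)) \<le> 2 * suminf ?f" for i N
  proof -
    have "(\<Sum>l<N. ?f (nat_dist i l)) \<le> (\<Sum>l\<in>{..i} \<union> {i<..<N}. ?f (nat_dist i l))"
      by (intro sum_mono2) auto
    also have "\<dots> = (\<Sum>l\<in>{..i}. ?f (nat_dist i l)) + (\<Sum>l\<in>{i<..<N}. ?f (nat_dist i l))"
      by (intro sum.union_disjoint) auto
    also have "(\<Sum>l\<in>{..i}. ?f (nat_dist i l)) = sum ?f ((\<lambda>l. i - l) ` {..i})"
      by (subst sum.reindex) (auto simp: inj_on_def nat_dist_def intro!: sum.cong)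
    also have "(\<Sum>l\<in>{i<..<N}. ?f (nat_dist i l)) = sum ?f ((\<lambda>l. l - i) ` {i<..<N})"
      by (subst sum.reindex) (auto simp: inj_on_def nat_dist_def intro!: sum.cong)
    also have "sum ?f ((\<lambda>l. i - l) ` {..i}) + sum ?f ((\<lambda>l. l - i) ` {i<..<N}) \<le> suminf ?f + suminf ?f"
      by (intro add_mono fs) auto
    finally show ?thesis by simp
  qed
  moreover have "1 \<le> 2 * suminf ?f" using fs[of "{0}"] by simp
  ultimately show ?thesis by (rule that[rotated])
qed

text \<open>
  The form \<open>i\<close> has the coefficients \<open>(1 + \<bar>i - l\<bar>) powr (- \<alpha>)\<close> on the variables \<open>(l, True)\<close>. Keeping only the
  term \<open>l = k\<close> of the covariance of the forms \<open>i\<close> and \<open>k\<close> already gives the lower bound, all terms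
  being nonnegative. The variable \<open>(i, False)\<close>, used by the form \<open>i\<close> alone, raises the variance to the
  same value for all \<open>i\<close>, and division by \<open>sqrt S\<close> makes it \<open>1\<close>.
\<close>

lemma moving_average_weights:
  assumes S: "1 \<le> S" "\<And>i N. (\<Sum>l<N. real (Suc (nat_dist i l)) powr (- \<alpha>)) \<le> S" and \<alpha>: "0 < \<alpha>"
  obtains b :: "nat \<Rightarrow> nat \<times> bool \<Rightarrow> real" where
    "\<And>i. i < N \<Longrightarrow> (\<Sum>j\<in>{..<N} \<times> UNIV. b i j * b i j) = 1"
    "\<And>i k. i < N \<Longrightarrow> k < N \<Longrightarrow> real (Suc (nat_dist i k)) powr (- \<alpha>) / S \<le> (\<Sum>j\<in>{..<N} \<times> UNIV. b i j * b k j)"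
    "\<And>j. j \<in> {..<N} \<times> UNIV \<Longrightarrow> (\<Sum>i<N. \<bar>b i j\<bar>) \<le> sqrt S"
proof -
  define a where "a i l = real (Suc (nat_dist i l)) powr (- \<alpha>)" for i l
  have a0: "0 \<le> a i l" for i l by (simp add: a_def)
  have a1: "a i l \<le> 1" for i l
    unfolding a_def using powr_mono[of "- \<alpha>" 0 "real (Suc (nat_dist i l))"] \<alpha> by simp
  have aS: "(\<Sum>l<N. a i l) \<le> S" for i using S(2) by (simp add: a_def)
  have asym: "a i l = a l i" for i l by (simp add: a_def nat_dist_def add.commute)
  have aa: "(\<Sum>l<N. a i l * a i l) \<le> S" for i
  proof -
    have "(\<Sum>l<N. a i l * a i l) \<le> (\<Sum>l<N. a i l * 1)" by (intro sum_mono mult_left_mono a0 a1)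
    with aS[of i] show ?thesis by simp
  qed
  define f where "f i = sqrt (S - (\<Sum>l<N. a i l * a i l))" for i
  have f0: "0 \<le> f i" for i using aa by (simp add: f_def)
  have ff: "f i * f i = S - (\<Sum>l<N. a i l * a i l)" for i using aa by (simp add: f_def)
  have fS: "f i \<le> sqrt S" for i unfolding f_def by (intro real_sqrt_le_mono) (simp add: sum_nonneg a0)
  define b where "b i j = (if snd j then a i (fst j) / sqrt S else if fst j = i then f i / sqrt S else 0)" for i j
  have b0: "0 \<le> b i j" for i j using a0 f0 S(1) by (simp add: b_def)
  have sp: "(\<Sum>j\<in>{..<N} \<times> UNIV. h j) = (\<Sum>l<N. h (l, True)) + (\<Sum>l<N. h (l, False))" for h :: "nat \<times> bool \<Rightarrow> real"
    by (simp add: sum.cartesian_product' UNIV_bool sum.distrib add.commute)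
  have SS: "sqrt S * sqrt S = S" "0 < sqrt S" using S(1) by auto
  show ?thesis
  proof (rule that[of b])
    fix i assume i: "i < N"
    have "(\<Sum>j\<in>{..<N} \<times> UNIV. b i j * b i j) = (\<Sum>l<N. a i l * a i l / S) + (\<Sum>l<N. if l = i then f i * f i / S else 0)"
      unfolding sp using S(1) by (intro arg_cong2[where f="(+)"] sum.cong) (auto simp: b_def SS)
    also have "\<dots> = (\<Sum>l<N. a i l * a i l) / S + f i * f i / S" using i by (simp add: sum_divide_distrib)
    also have "\<dots> = 1" unfolding ff using S(1) by (simp add: field_simps)
    finally show "(\<Sum>j\<in>{..<N} \<times> UNIV. b i j * b i j) = 1" .
  next
    fix i k assume ik: "i < N" "k < N"
    have "real (Suc (nat_dist i k)) powr (- \<alpha>) / S = b i (k, True) * b k (k, True)"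
      using S(1) by (simp add: b_def SS a_def nat_dist_def)
    also have "\<dots> \<le> (\<Sum>j\<in>{..<N} \<times> UNIV. b i j * b k j)"
      using ik by (intro member_le_sum[of "(k, True)" _ "\<lambda>j. b i j * b k j"]) (auto simp: b0)
    finally show "real (Suc (nat_dist i k)) powr (- \<alpha>) / S \<le> (\<Sum>j\<in>{..<N} \<times> UNIV. b i j * b k j)" .
  next
    fix j assume j: "j \<in> {..<N} \<times> (UNIV :: bool set)"
    obtain l c where lc: "j = (l, c)" by (cases j)
    show "(\<Sum>i<N. \<bar>b i j\<bar>) \<le> sqrt S"
    proof (cases c)
      case True
      have "(\<Sum>i<N. \<bar>b i j\<bar>) = (\<Sum>i<N. a l i) / sqrt S"
        using True a0 SS by (simp add: lc b_def sum_divide_distrib asym[of l])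
      also have "\<dots> \<le> S / sqrt S" using aS[of l] SS by (intro divide_right_mono) auto
      also have "\<dots> = sqrt S" by (rule real_div_sqrt) (use S(1) in simp)
      finally show ?thesis .
    next
      case False
      have "(\<Sum>i<N. \<bar>b i j\<bar>) = (\<Sum>i<N. if i = l then f l / sqrt S else 0)"
        using False f0 SS by (intro sum.cong) (auto simp: lc b_def)
      also have "\<dots> \<le> f l / sqrt S" using f0[of l] SS by simp
      also have "\<dots> \<le> 1" using fS[of l] SS by (simp add: field_simps)
      also have "\<dots> \<le> sqrt S" using S(1) by simp
      finally show ?thesis .
    qed
  qed
qed

section \<open>Comparison with nearly independent blocks\<close>

text \<open>
  The modulus of the characteristic function of \<open>X s - X t\<close> is at most \<open>1\<close>, and hence the variance
  \<open>2 - 2 * K s t\<close> is nonnegative.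
\<close>

lemma correlation_le_1:
  assumes G: "gauss_vec M {s, t} X K" and K: "K s s = 1" "K t t = 1" "K s t = K t s"
  shows "K s t \<le> 1"
proof (cases "s = t")
  case False
  interpret prob_space M by (rule gauss_vecD[OF G])
  let ?c = "\<lambda>i. if i = s then 1 else - 1 :: real"
  have q: "(\<Sum>i\<in>{s, t}. \<Sum>j\<in>{s, t}. ?c i * ?c j * K i j) = 2 - 2 * K s t"
    using False K by simp
  have "norm (CLINT \<omega>|M. iexp (\<Sum>i\<in>{s, t}. ?c i * X i \<omega>)) \<le> (LINT \<omega>|M. norm (iexp (\<Sum>i\<in>{s, t}. ?c i * X i \<omega>)))"
    by (rule integral_norm_bound)
  also have "\<dots> = 1" by (simp add: prob_space)
  finally have "exp (- (2 - 2 * K s t) / 2) \<le> 1"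
    unfolding gauss_vecD(4)[OF G] q by simp
  then show ?thesis by simp
qed (use K in simp)

lemma orthant_mono:
  assumes "gaussian_cov F K" "\<And>i. i \<in> F \<Longrightarrow> u i \<le> v i"
  shows "orthant F K u \<le> orthant F K v"
proof -
  obtain M where G: "gauss_vec M F (\<lambda>i x. x i) K" using assms unfolding gaussian_cov_def by blast
  interpret M: prob_space M by (rule gauss_vecD[OF G])
  show ?thesis unfolding orthant_eq[OF G, symmetric]
    using assms(2) by (intro M.finite_measure_mono sets_orthant[OF gauss_vecD(2)[OF G] gauss_vecD(3)[OF G]]) (auto intro: order_trans)
qed

lemma gaussian_cov_subset:
  assumes "gaussian_cov F K" "E \<subseteq> F"
  shows "gaussian_cov E K"
proof -
  obtain M where G: "gauss_vec M F (\<lambda>i x. x i) K" using assms unfolding gaussian_cov_def by blast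
  have "gauss_vec M E (\<lambda>i x. x i) K"
    by (rule gauss_vec_reindex[OF G, of E "\<lambda>t. t"]) (use assms(2) gauss_vecD(2)[OF G] finite_subset in auto)
  then show ?thesis by (rule gaussian_covI)
qed

text \<open>
  The vector is compared with \<open>sqrt \<epsilon> * Y (\<beta> t) + sqrt (1 - \<epsilon>) * W t\<close>, where \<open>W\<close> consists of independent
  copies of the blocks and the \<open>Y i\<close> are linear forms in independent normal variables \<open>g\<close>. Given \<open>g\<close>,
  the blocks are independent, and a block \<open>i\<close> with \<open>Y i \<ge> - L\<close> contributes at most \<open>p\<close> by the choice of \<open>L\<close>.
  The other blocks are bounded by \<open>1\<close>; unless there are at least \<open>\<delta> * N\<close> of them, the factors \<open>p\<close> number
  at least \<open>(1 - \<delta>) * N\<close>.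
\<close>

lemma orthant_block_upper:
  fixes F :: "'i set" and \<beta> :: "'i \<Rightarrow> nat" and J :: "'j set" and b :: "nat \<Rightarrow> 'j \<Rightarrow> real"
  assumes G: "gauss_vec M F Z K" and sym: "\<And>s t. s \<in> F \<Longrightarrow> t \<in> F \<Longrightarrow> K s t = K t s"
    and diag: "\<And>t. t \<in> F \<Longrightarrow> K t t = 1" and le1: "\<And>s t. s \<in> F \<Longrightarrow> t \<in> F \<Longrightarrow> K s t \<le> 1"
    and \<beta>: "\<And>t. t \<in> F \<Longrightarrow> \<beta> t < N"
    and J: "finite J" "card J = 2 * N" and B: "0 < B" "\<And>j. j \<in> J \<Longrightarrow> (\<Sum>i<N. \<bar>b i j\<bar>) \<le> B"
    and b1: "\<And>i. i < N \<Longrightarrow> (\<Sum>j\<in>J. b i j * b i j) = 1"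
    and \<epsilon>: "0 < \<epsilon>" "\<epsilon> < 1"
    and cross: "\<And>s t. s \<in> F \<Longrightarrow> t \<in> F \<Longrightarrow> \<beta> s \<noteq> \<beta> t \<Longrightarrow> K s t \<le> \<epsilon> * (\<Sum>j\<in>J. b (\<beta> s) j * b (\<beta> t) j)"
    and z: "0 \<le> z" and p: "0 < p" "p \<le> 1" "\<And>i. i < N \<Longrightarrow> orthant {t\<in>F. \<beta> t = i} K (\<lambda>_. z) \<le> p"
    and \<delta>: "0 \<le> \<delta>"
  defines "L \<equiv> z * sqrt (1 - \<epsilon>) / sqrt \<epsilon>"
  shows "orthant F K (\<lambda>_. 0) \<le> p powr ((1 - \<delta>) * real N) + (4 * exp (- (\<delta> * L)\<^sup>2 / (4 * B\<^sup>2))) ^ N"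
proof -
  have F: "finite F" by (rule gauss_vecD(2)[OF G])
  have cK: "gaussian_cov F K" by (rule gaussian_covI[OF G])
  have cKi: "gaussian_cov {t\<in>F. \<beta> t = i} K" for i by (rule gaussian_cov_subset[OF cK]) auto
  have L0: "0 \<le> L" using z \<epsilon> by (simp add: L_def)
  let ?PJ = "PiM J (\<lambda>_. std_normal) :: ('j \<Rightarrow> real) measure"
  let ?PM = "PiM {..<N} (\<lambda>_. M)"
  define Y where "Y i g = (\<Sum>j\<in>J. b i j * g j)" for i and g :: "'j \<Rightarrow> real"
  define R where "R i k = (\<Sum>j\<in>J. b i j * b k j)" for i k
  have dl: "(\<Sum>m\<in>J. c * b k m * (if l = m then 1 else 0)) = c * b k l" if "l \<in> J" for c k l
    using that J(1) by (subst sum.mono_neutral_right[of J "{l}"]) auto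
  have GY: "gauss_vec ?PJ F (\<lambda>t. Y (\<beta> t)) (\<lambda>s t. R (\<beta> s) (\<beta> t))"
    by (rule gauss_vec_cong[OF gauss_vec_linear[OF gauss_vec_iid[OF J(1)] F, of "\<lambda>t. b (\<beta> t)"]])
       (simp_all add: Y_def R_def dl)
  have GW: "gauss_vec ?PM F (\<lambda>t \<omega>. Z t (\<omega> (\<beta> t))) (\<lambda>s t. if \<beta> s = \<beta> t then K s t else 0)"
    by (rule gauss_vec_blocks[OF G]) (use \<beta> in auto)
  define K' where "K' s t = \<epsilon> * R (\<beta> s) (\<beta> t) + (1 - \<epsilon>) * (if \<beta> s = \<beta> t then K s t else 0)" for s t
  have GV: "gauss_vec (?PJ \<Otimes>\<^sub>M ?PM) F (\<lambda>t (g, \<omega>). sqrt \<epsilon> * Y (\<beta> t) g + sqrt (1 - \<epsilon>) * Z t (\<omega> (\<beta> t))) K'"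
    by (rule gauss_vec_cong[OF gauss_vec_add[OF gauss_vec_scale[OF GY, of "\<lambda>_. sqrt \<epsilon>"] gauss_vec_scale[OF GW, of "\<lambda>_. sqrt (1 - \<epsilon>)"]]])
       (use \<epsilon> in \<open>auto simp: K'_def\<close>)
  have R1: "R (\<beta> t) (\<beta> t) = 1" if "t \<in> F" for t using b1[OF \<beta>[OF that]] by (simp add: R_def)
  have Rs: "R i k = R k i" for i k by (simp add: R_def mult.commute)
  have "orthant F K (\<lambda>_. 0) \<le> orthant F K' (\<lambda>_. 0)"
  proof (rule slepian[OF cK gaussian_covI[OF GV]])
    show "K i j \<le> K' i j" if "i \<in> F" "j \<in> F" for i j
    proof (cases "\<beta> i = \<beta> j")
      case True
      have "\<epsilon> * K i j \<le> \<epsilon> * 1" using le1[OF that] \<epsilon> by (intro mult_left_mono) auto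
      then show ?thesis using True R1[OF that(2)] by (simp add: K'_def algebra_simps)
    next
      case False
      then show ?thesis using cross[OF that False] by (simp add: K'_def R_def)
    qed
  qed (use sym diag R1 Rs in \<open>auto simp: K'_def algebra_simps\<close>)
  also have "orthant F K' (\<lambda>_. 0) \<le> p powr ((1 - \<delta>) * real N) + (4 * exp (- (\<delta> * L)\<^sup>2 / (4 * B\<^sup>2))) ^ N"
  proof -
    interpret PJ: prob_space ?PJ by (rule gauss_vecD(1)[OF GY])
    interpret PM: prob_space ?PM by (rule gauss_vecD(1)[OF GW])
    interpret PV: prob_space "?PJ \<Otimes>\<^sub>M ?PM" by (rule gauss_vecD(1)[OF GV])
    define A where "A = {x\<in>space (?PJ \<Otimes>\<^sub>M ?PM). \<forall>t\<in>F. (case x of (g, \<omega>) \<Rightarrow> sqrt \<epsilon> * Y (\<beta> t) g + sqrt (1 - \<epsilon>) * Z t (\<omega> (\<beta> t))) \<le> 0}"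
    have A: "A \<in> sets (?PJ \<Otimes>\<^sub>M ?PM)" unfolding A_def by (rule sets_orthant[OF F gauss_vecD(3)[OF GV]])
    define bad where "bad g = {i\<in>{..<N}. Y i g < - L}" for g
    define E where "E = {g\<in>space ?PJ. \<delta> * real N \<le> real (card (bad g))}"
    have Em: "E \<in> sets ?PJ"
    proof -
      have c: "real (card (bad g)) = (\<Sum>i<N. if Y i g < - L then 1 else 0)" for g
        by (simp add: bad_def sum.If_cases Int_def)
      have [measurable]: "Y i \<in> borel_measurable ?PJ" for i unfolding Y_def by measurable
      show ?thesis unfolding E_def c by measurable
    qed
    have fib: "emeasure ?PM (Pair g -` A) \<le> ennreal (p powr ((1 - \<delta>) * real N)) + indicator E g" if g: "g \<in> space ?PJ" for g
    proof -
      \<comment> \<open>For fixed \<open>g\<close>, block \<open>i\<close> of the independent copies has to stay below the threshold \<open>u i\<close>.\<close>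
      define u where "u i = - sqrt \<epsilon> * Y i g / sqrt (1 - \<epsilon>)" for i
      have e: "Pair g -` A = {\<omega>\<in>space ?PM. \<forall>t\<in>F. Z t (\<omega> (\<beta> t)) \<le> u (\<beta> t)}"
        using g \<epsilon> by (auto simp: A_def space_pair_measure u_def field_simps)
      have m: "measure ?PM (Pair g -` A) = (\<Prod>i<N. orthant {t\<in>F. \<beta> t = i} K (\<lambda>t. u (\<beta> t)))"
        unfolding e orthant_eq[OF GW] by (rule orthant_blocks(2)[OF cK]) (use \<beta> in auto)
      also have "\<dots> \<le> (\<Prod>i<N. if i \<in> bad g then 1 else p)"
      proof (rule prod_mono, intro conjI)
        fix i assume i: "i \<in> {..<N}"
        show "0 \<le> orthant {t\<in>F. \<beta> t = i} K (\<lambda>t. u (\<beta> t))" by (rule orthant_bounds(1)[OF cKi])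
        show "orthant {t\<in>F. \<beta> t = i} K (\<lambda>t. u (\<beta> t)) \<le> (if i \<in> bad g then 1 else p)"
        proof (cases "i \<in> bad g")
          case True then show ?thesis using orthant_bounds(2)[OF cKi] by simp
        next
          case False
          then have "- Y i g \<le> L" using i by (auto simp: bad_def)
          then have "- Y i g * sqrt \<epsilon> \<le> z * sqrt (1 - \<epsilon>)" using \<epsilon> by (simp add: L_def field_simps)
          then have "u i \<le> z" using \<epsilon> by (simp add: u_def field_simps)
          then have "orthant {t\<in>F. \<beta> t = i} K (\<lambda>t. u (\<beta> t)) \<le> orthant {t\<in>F. \<beta> t = i} K (\<lambda>_. z)"
            by (intro orthant_mono[OF cKi]) auto
          also have "\<dots> \<le> p" using i by (intro p) auto
          finally show ?thesis using False by simp
        qed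
      qed
      also have "\<dots> = p ^ card ({..<N} - bad g)"
        by (simp add: prod.If_cases Diff_eq)
      finally have le: "measure ?PM (Pair g -` A) \<le> p ^ card ({..<N} - bad g)" .
      show ?thesis
      proof (cases "g \<in> E")
        case True
        have "emeasure ?PM (Pair g -` A) \<le> 1" by (rule PM.emeasure_le_1)
        then show ?thesis using True by (simp add: add_increasing)
      next
        case False
        then have "real (card (bad g)) < \<delta> * real N" using g by (simp add: E_def)
        moreover have "real (card ({..<N} - bad g)) = real N - real (card (bad g))"
        proof -
          have "bad g \<subseteq> {..<N}" by (auto simp: bad_def)
          then have "card ({..<N} - bad g) = N - card (bad g)" "card (bad g) \<le> N"
            using card_Diff_subset[of "bad g" "{..<N}"] card_mono[of "{..<N}" "bad g"] finite_subset by auto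
          then show ?thesis by simp
        qed
        ultimately have "(1 - \<delta>) * real N \<le> real (card ({..<N} - bad g))" by (simp add: algebra_simps)
        then have "p powr real (card ({..<N} - bad g)) \<le> p powr ((1 - \<delta>) * real N)"
          using p(1,2) by (intro powr_mono') auto
        then have "measure ?PM (Pair g -` A) \<le> p powr ((1 - \<delta>) * real N)" using le p(1) by (simp add: powr_realpow)
        then show ?thesis using False by (simp add: PM.emeasure_eq_measure ennreal_leI)
      qed
    qed
    have "emeasure (?PJ \<Otimes>\<^sub>M ?PM) A = (\<integral>\<^sup>+g. emeasure ?PM (Pair g -` A) \<partial>?PJ)"
      by (rule PM.emeasure_pair_measure_alt[OF A])
    also have "\<dots> \<le> (\<integral>\<^sup>+g. ennreal (p powr ((1 - \<delta>) * real N)) + indicator E g \<partial>?PJ)"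
      by (intro nn_integral_mono fib)
    also have "\<dots> = ennreal (p powr ((1 - \<delta>) * real N)) + emeasure ?PJ E"
      using Em by (subst nn_integral_add) (auto simp: PJ.emeasure_space_1)
    finally have "measure (?PJ \<Otimes>\<^sub>M ?PM) A \<le> p powr ((1 - \<delta>) * real N) + measure ?PJ E"
      unfolding PV.emeasure_eq_measure PJ.emeasure_eq_measure by (simp add: ennreal_plus[symmetric] del: ennreal_plus)
    moreover have "measure ?PJ E \<le> (4 * exp (- (\<delta> * L)\<^sup>2 / (4 * B\<^sup>2))) ^ N"
      unfolding E_def bad_def Y_def by (rule linear_excursion_count_tail[OF J B \<delta> L0])
    moreover have "orthant F K' (\<lambda>_. 0) = measure (?PJ \<Otimes>\<^sub>M ?PM) A"
      unfolding A_def by (rule orthant_eq[OF GV, symmetric])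
    ultimately show ?thesis by linarith
  qed
  finally show ?thesis .
qed

text \<open>
  Points in different blocks \<open>i\<close> and \<open>k\<close> are at distance at least \<open>\<bar>i - k\<bar> * \<delta> * l\<close>, which is at least
  \<open>(1 + \<bar>i - k\<bar>) * \<delta> * l / 2\<close>; the value of \<open>\<epsilon>\<close> is what makes the decay of \<open>K\<close> at that distance no larger
  than \<open>\<epsilon>\<close> times the covariances of the moving average.
\<close>

lemma sup_lt_block_upper:
  assumes P: "gauss_proc M Z K" and sym: "\<And>s t. 0 \<le> s \<Longrightarrow> 0 \<le> t \<Longrightarrow> K s t = K t s"
    and diag: "\<And>t. 0 \<le> t \<Longrightarrow> K t t = 1"
    and l: "0 < l" and \<delta>: "0 < \<delta>" and \<alpha>: "0 < \<alpha>"
    and dec: "\<And>s t. 0 \<le> s \<Longrightarrow> \<delta> * l \<le> t - s \<Longrightarrow> K s t \<le> (t - s) powr (- \<alpha>)"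
    and S: "1 \<le> S" "\<And>i N. (\<Sum>l<N. real (Suc (nat_dist i l)) powr (- \<alpha>)) \<le> S"
    and \<epsilon>_def: "\<epsilon> = S * (2 / (\<delta> * l)) powr \<alpha>" and \<epsilon>: "\<epsilon> < 1"
    and z: "0 \<le> z" and p: "0 < p" "p \<le> 1" "\<And>s. 0 \<le> s \<Longrightarrow> sup_le M Z s (s + l) z < p"
    and T: "real N * ((1 + \<delta>) * l) \<le> T"
  shows "sup_lt M Z 0 T 0 \<le> p powr ((1 - \<delta>) * real N) + (4 * exp (- (\<delta> * (z * sqrt (1 - \<epsilon>) / sqrt \<epsilon>))\<^sup>2 / (4 * S))) ^ N"
proof -
  define h where "h = (1 + \<delta>) * l"
  have "h = l + \<delta> * l" by (simp add: h_def algebra_simps)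
  then have h: "l < h" "0 < h" using l mult_pos_pos[OF \<delta> l] by linarith+
  have hp: "0 \<le> real i * h" for i using h by simp
  have "\<exists>F. finite F \<and> F \<subseteq> {real i * h..real i * h + l} \<and> orthant F K (\<lambda>_. z) < p" for i
  proof (rule ccontr)
    assume "\<not> ?thesis"
    then have "p \<le> sup_le M Z (real i * h) (real i * h + l) z"
      using hp l by (intro sup_le_geI[OF P]) (auto simp: not_less)
    then show False using p(3)[OF hp[of i]] by simp
  qed
  then obtain Fb where Fb: "\<And>i. finite (Fb i)" "\<And>i. Fb i \<subseteq> {real i * h..real i * h + l}" "\<And>i. orthant (Fb i) K (\<lambda>_. z) < p"
    by metis
  define F where "F = (\<Union>i<N. Fb i)"
  \<comment> \<open>Block \<open>i\<close> starts at \<open>i * h\<close> and is shorter than \<open>h\<close>, so the block of a time is found by division.\<close>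
  define \<beta> where "\<beta> t = nat \<lfloor>t / h\<rfloor>" for t
  have \<beta>: "\<beta> t = i" if "t \<in> Fb i" for t i
  proof -
    have "real i * h \<le> t" "t \<le> real i * h + l" using Fb(2)[of i] that by auto
    then have "real i \<le> t / h" "t / h < real i + 1" using h by (auto simp: field_simps)
    then have "\<lfloor>t / h\<rfloor> = int i" by (intro floor_unique) auto
    then show ?thesis by (simp add: \<beta>_def)
  qed
  have F: "finite F" using Fb(1) by (auto simp: F_def)
  have Fbi: "real i * h \<le> t" "t \<le> real i * h + l" "0 \<le> t" if "t \<in> Fb i" for t i
  proof -
    show *: "real i * h \<le> t" "t \<le> real i * h + l" using Fb(2)[of i] that by auto
    show "0 \<le> t" using *(1) hp[of i] by linarith
  qed
  have F0: "F \<subseteq> {0..}" using Fbi(3) by (auto simp: F_def)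
  have T0: "0 \<le> T" using T hp[of N] by (simp add: h_def)
  have FT: "F \<subseteq> {0..T}"
  proof
    fix t assume "t \<in> F"
    then obtain i where i: "i < N" "t \<in> Fb i" by (auto simp: F_def)
    from Fbi[OF i(2)] have "real i * h \<le> t" "t \<le> real i * h + l" "0 \<le> t" .
    moreover have "real i * h + h \<le> real N * h"
      using mult_right_mono[of "real (Suc i)" "real N" h] i h by (simp add: algebra_simps)
    ultimately have "0 \<le> t" "t \<le> T" using h(1) T[folded h_def] by linarith+
    then show "t \<in> {0..T}" by simp
  qed
  have FbE: "Fb i = {t\<in>F. \<beta> t = i}" if "i < N" for i using \<beta> that by (auto simp: F_def)
  have G: "gauss_vec M F Z K" by (rule gauss_procD(4)[OF P F F0])
  have \<epsilon>0: "0 < \<epsilon>" unfolding \<epsilon>_def using S(1) \<delta> l by simp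
  obtain b :: "nat \<Rightarrow> nat \<times> bool \<Rightarrow> real" where b:
    "\<And>i. i < N \<Longrightarrow> (\<Sum>j\<in>{..<N} \<times> UNIV. b i j * b i j) = 1"
    "\<And>i k. i < N \<Longrightarrow> k < N \<Longrightarrow> real (Suc (nat_dist i k)) powr (- \<alpha>) / S \<le> (\<Sum>j\<in>{..<N} \<times> UNIV. b i j * b k j)"
    "\<And>j. j \<in> {..<N} \<times> UNIV \<Longrightarrow> (\<Sum>i<N. \<bar>b i j\<bar>) \<le> sqrt S"
    using moving_average_weights[OF S \<alpha>, where N=N and thesis=thesis] by blast
  have far: "K s t \<le> \<epsilon> * (real (Suc (nat_dist i k)) powr (- \<alpha>) / S)"
    if st: "s \<in> Fb i" "t \<in> Fb k" and ik: "i < k" "k < N" for s t i k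
  proof -
    \<comment> \<open>The points are at distance at least \<open>d * h - l\<close>, where \<open>h = l + \<delta> * l\<close> and \<open>d * l \<ge> l\<close>.\<close>
    define d where "d = k - i"
    have d: "1 \<le> real d" "nat_dist i k = d" "real k = real i + real d" using ik by (auto simp: d_def nat_dist_def)
    have "real k * h \<le> t" "s \<le> real i * h + l" "0 \<le> s" using Fbi[OF st(1)] Fbi[OF st(2)] by auto
    then have "real d * h - l \<le> t - s" using d(3) by (simp add: algebra_simps)
    moreover have "real d * (\<delta> * l) \<le> real d * h - l"
      using mult_right_mono[OF d(1), of l] l by (simp add: h_def algebra_simps)
    ultimately have ts: "real d * (\<delta> * l) \<le> t - s" by linarith
    have dl: "0 < \<delta> * l" using \<delta> l by simp
    have "\<delta> * l \<le> real d * (\<delta> * l)" using mult_right_mono[OF d(1), of "\<delta> * l"] dl by simp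
    with ts have "\<delta> * l \<le> t - s" by linarith
    then have "K s t \<le> (t - s) powr (- \<alpha>)" using \<open>0 \<le> s\<close> by (intro dec)
    also have "\<dots> \<le> (real (Suc d) * (\<delta> * l / 2)) powr (- \<alpha>)"
    proof (rule powr_mono2')
      have "real (Suc d) / 2 \<le> real d" using d(1) by simp
      then have "real (Suc d) / 2 * (\<delta> * l) \<le> real d * (\<delta> * l)" using dl by (intro mult_right_mono) auto
      then show "real (Suc d) * (\<delta> * l / 2) \<le> t - s" using ts by simp
      show "0 < real (Suc d) * (\<delta> * l / 2)" using dl by (intro mult_pos_pos) auto
    qed (use \<alpha> in simp)
    also have "\<dots> = real (Suc d) powr (- \<alpha>) * (\<delta> * l / 2) powr (- \<alpha>)"
      by (rule powr_mult)
    also have "(\<delta> * l / 2) powr (- \<alpha>) = (2 / (\<delta> * l)) powr \<alpha>"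
      using dl by (simp add: powr_minus powr_divide)
    also have "real (Suc d) powr (- \<alpha>) * (2 / (\<delta> * l)) powr \<alpha> = \<epsilon> * (real (Suc (nat_dist i k)) powr (- \<alpha>) / S)"
      using S(1) d(2) by (simp add: \<epsilon>_def)
    finally show ?thesis .
  qed
  have nds: "nat_dist i k = nat_dist k i" for i k by (simp add: nat_dist_def)
  have cross: "K s t \<le> \<epsilon> * (\<Sum>j\<in>{..<N} \<times> UNIV. b (\<beta> s) j * b (\<beta> t) j)"
    if st: "s \<in> F" "t \<in> F" "\<beta> s \<noteq> \<beta> t" for s t
  proof -
    obtain i k where ik: "i < N" "s \<in> Fb i" "k < N" "t \<in> Fb k" using st by (auto simp: F_def)
    have e: "\<beta> s = i" "\<beta> t = k" using \<beta> ik by auto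
    have s0: "0 \<le> s" "0 \<le> t" using st F0 by auto
    have "K s t \<le> \<epsilon> * (real (Suc (nat_dist i k)) powr (- \<alpha>) / S)"
    proof (cases "i < k")
      case True then show ?thesis using far[OF ik(2,4) True ik(3)] by simp
    next
      case False
      then have "k < i" using st(3) e by simp
      then show ?thesis using far[OF ik(4,2) _ ik(1)] sym[OF s0] nds[of i k] by simp
    qed
    also have "\<dots> \<le> \<epsilon> * (\<Sum>j\<in>{..<N} \<times> UNIV. b i j * b k j)"
      using \<epsilon>0 ik by (intro mult_left_mono b(2)) auto
    finally show ?thesis unfolding e .
  qed
  have le1: "K s t \<le> 1" if "s \<in> F" "t \<in> F" for s t
  proof (rule correlation_le_1[where K=K and s=s and t=t and M=M and X=Z])
    show "gauss_vec M {s, t} Z K" using that F0 by (intro gauss_procD(4)[OF P]) auto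
    show "K s s = 1" "K t t = 1" "K s t = K t s" using that F0 by (auto intro!: diag sym)
  qed
  have SS: "(sqrt S)\<^sup>2 = S" "0 < sqrt S" using S(1) by auto
  have "sup_lt M Z 0 T 0 \<le> sup_le M Z 0 T 0" using T0 by (intro sup_lt_le_sup_le[OF P]) auto
  also have "\<dots> \<le> orthant F K (\<lambda>_. 0)" using T0 by (intro sup_le_le_orthant[OF P _ _ F FT]) auto
  also have "\<dots> \<le> p powr ((1 - \<delta>) * real N) + (4 * exp (- (\<delta> * (z * sqrt (1 - \<epsilon>) / sqrt \<epsilon>))\<^sup>2 / (4 * (sqrt S)\<^sup>2))) ^ N"
  proof (rule orthant_block_upper[OF G _ _ le1 _ _ _ SS(2) b(3) b(1) \<epsilon>0 \<epsilon> cross z p(1,2)])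
    show "K s t = K t s" if "s \<in> F" "t \<in> F" for s t using that F0 by (intro sym) auto
    show "K t t = 1" if "t \<in> F" for t using that F0 by (intro diag) auto
    show "\<beta> t < N" if "t \<in> F" for t using that \<beta> by (auto simp: F_def)
    show "finite ({..<N} \<times> (UNIV :: bool set))" by simp
    show "card ({..<N} \<times> (UNIV :: bool set)) = 2 * N" by (simp add: card_cartesian_product UNIV_bool)
    show "orthant {t \<in> F. \<beta> t = i} K (\<lambda>_. z) \<le> p" if "i < N" for i using Fb(3)[of i] FbE[OF that] by simp
    show "0 \<le> \<delta>" using \<delta> by simp
  qed
  finally show ?thesis unfolding SS .
qed

section \<open>The joint limit\<close>

text \<open>
  The requirements on the block length in the proof of the upper bound. The last one makes
  the exceptional event negligible; it holds because the power \<open>\<alpha> - 2 * \<eta>\<close> exceeds \<open>1\<close>.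
\<close>

lemma eventually_block_scale:
  fixes \<alpha> \<eta> \<delta> S \<beta> \<zeta> \<tau> :: real
  assumes \<alpha>: "1 < \<alpha>" and \<eta>: "0 < \<eta>" "1 < \<alpha> - 2 * \<eta>" and \<delta>: "0 < \<delta>" and S: "1 \<le> S" and \<zeta>: "0 < \<zeta>"
  shows "\<forall>\<^sub>F l in at_top. 2 * l powr (- \<eta>) \<le> \<zeta>"
    and "\<forall>\<^sub>F l in at_top. 3 * l powr (- \<eta>) \<le> l powr (- (\<eta> / 2))"
    and "\<forall>\<^sub>F l in at_top. S * (2 / (\<delta> * l)) powr \<alpha> \<le> 1 / 2"
    and "\<forall>\<^sub>F l in at_top. \<tau> \<le> \<delta> * l"
    and "\<forall>\<^sub>F l in at_top. 4 * exp (- (\<delta>\<^sup>2 * (\<delta> / 2) powr \<alpha> / (8 * S\<^sup>2)) * l powr (\<alpha> - 2 * \<eta>)) \<le> exp (- \<beta> * l)"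
proof -
  have lim: "((\<lambda>l. 2 * l powr (- \<eta>)) \<longlongrightarrow> 0) at_top" using \<eta> by real_asymp
  show "\<forall>\<^sub>F l in at_top. 2 * l powr (- \<eta>) \<le> \<zeta>"
    using order_tendstoD(2)[OF lim \<zeta>] by (rule eventually_mono) simp
  show "\<forall>\<^sub>F l in at_top. 3 * l powr (- \<eta>) \<le> l powr (- (\<eta> / 2))" using \<eta> by real_asymp
  have lim': "((\<lambda>l. S * (2 / (\<delta> * l)) powr \<alpha>) \<longlongrightarrow> 0) at_top" using \<alpha> \<delta> S by real_asymp
  show "\<forall>\<^sub>F l in at_top. S * (2 / (\<delta> * l)) powr \<alpha> \<le> 1 / 2"
    using order_tendstoD(2)[OF lim', of "1/2"] by (auto elim!: eventually_mono)
  have "filterlim (\<lambda>l. \<delta> * l) at_top at_top" using \<delta> by real_asymp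
  then show "\<forall>\<^sub>F l in at_top. \<tau> \<le> \<delta> * l" by (simp add: filterlim_at_top)
  define c where "c = \<delta>\<^sup>2 * (\<delta> / 2) powr \<alpha> / (8 * S\<^sup>2)"
  define e where "e = \<alpha> - 2 * \<eta>"
  have c: "0 < c" using \<delta> S by (simp add: c_def)
  have e: "1 < e" using \<eta> by (simp add: e_def)
  have "filterlim (\<lambda>l. c * l powr e - \<beta> * l) at_top at_top" using c e by real_asymp
  then have "\<forall>\<^sub>F l in at_top. ln 4 \<le> c * l powr e - \<beta> * l" by (simp add: filterlim_at_top)
  then show "\<forall>\<^sub>F l in at_top. 4 * exp (- (\<delta>\<^sup>2 * (\<delta> / 2) powr \<alpha> / (8 * S\<^sup>2)) * l powr (\<alpha> - 2 * \<eta>)) \<le> exp (- \<beta> * l)"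
    unfolding c_def[symmetric] e_def[symmetric]
  proof eventually_elim
    case (elim l)
    have "4 * exp (- c * l powr e) = exp (ln 4 + - c * l powr e)" unfolding exp_add by simp
    also have "\<dots> \<le> exp (- \<beta> * l)" using elim by simp
    finally show ?case .
  qed
qed

text \<open>
  A block length \<open>L\<close> is fixed for which the rate of the limit process is nearly \<open>- b\<close>. For large \<open>k\<close> the
  probability of a block of that length, wherever it starts, is nearly as large.
\<close>

lemma persistence_lower:
  fixes M :: "nat \<Rightarrow> 'a measure" and N :: "'b measure"
  assumes P: "\<And>k. 1 \<le> k \<Longrightarrow> gauss_proc (M k) (Z k) (K k)"
    and sym: "\<And>k s t. 1 \<le> k \<Longrightarrow> 0 \<le> s \<Longrightarrow> 0 \<le> t \<Longrightarrow> K k s t = K k t s"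
    and nonneg: "\<And>k s t. 1 \<le> k \<Longrightarrow> 0 \<le> s \<Longrightarrow> 0 \<le> t \<Longrightarrow> 0 \<le> K k s t"
    and lim: "(log_persistence_rate N W \<longlongrightarrow> - b) at_top" and b0: "0 \<le> b"
    and conv: "\<And>L q. Lmin \<le> L \<Longrightarrow> q < sup_lt N W 0 L 0 \<Longrightarrow> \<forall>\<^sub>F k in sequentially. \<forall>s\<ge>0. q \<le> sup_lt (M k) (Z k) s (s + L) 0"
    and y: "y < - b"
  shows "\<forall>\<^sub>F (k, T) in sequentially \<times>\<^sub>F at_top. y < log_persistence_rate (M k) (Z k) T"
proof -
  obtain y2 where y2: "y < ereal y2" "ereal y2 < - b" using ereal_dense2[OF y] by auto
  obtain y1 where y1: "y < ereal y1" "ereal y1 < ereal y2" using ereal_dense2[OF y2(1)] by auto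
  have "- b \<le> 0" using b0 by (simp add: ereal_uminus_le_reorder)
  with y2(2) have "ereal y2 < 0" by (rule less_le_trans)
  then have y20: "y2 < 0" by simp
  have "\<forall>\<^sub>F L in at_top. ereal y2 < log_persistence_rate N W L \<and> max 1 Lmin \<le> L"
    by (intro eventually_conj order_tendstoD(1)[OF lim y2(2)] eventually_ge_at_top)
  then obtain L where L: "ereal y2 < log_persistence_rate N W L" "max 1 Lmin \<le> L"
    using eventually_happens'[OF trivial_limit_at_top_linorder] by blast
  have Lp: "0 < L" using L(2) by simp
  have "exp (L * y2) < sup_lt N W 0 L 0" using L(1) unfolding log_persistence_rate_eq less_rate_iff[OF Lp] .
  then have "\<forall>\<^sub>F k in sequentially. \<forall>s\<ge>0. exp (L * y2) \<le> sup_lt (M k) (Z k) s (s + L) 0"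
    using L(2) by (intro conv) auto
  then have ek: "\<forall>\<^sub>F k in sequentially. 1 \<le> k \<and> (\<forall>s\<ge>0. exp (L * y2) \<le> sup_lt (M k) (Z k) s (s + L) 0)"
    using eventually_ge_at_top[of "1::nat"] by (rule eventually_conj[rotated])
  have eT: "\<forall>\<^sub>F T in at_top. max 0 (L * y2 / (y1 - y2)) < T" by (rule eventually_gt_at_top)
  have "y < log_persistence_rate (M k) (Z k) T"
    if k: "1 \<le> k \<and> (\<forall>s\<ge>0. exp (L * y2) \<le> sup_lt (M k) (Z k) s (s + L) 0)" and T: "max 0 (L * y2 / (y1 - y2)) < T" for k T
  proof -
    have T0: "0 < T" "L * y2 / (y1 - y2) < T" using T by auto
    have "exp (- (- y2) * (T + L)) \<le> sup_lt (M k) (Z k) 0 T 0"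
      using k Lp T0 y20 by (intro sup_lt_exp_lower[OF P] sym nonneg) (auto simp: mult.commute)
    moreover have "y1 * T < y2 * (T + L)" using T0(2) y1(2) by (simp add: field_simps)
    then have "exp (T * y1) < exp (- (- y2) * (T + L))" by (simp add: mult.commute)
    ultimately have "exp (T * y1) < sup_lt (M k) (Z k) 0 T 0" by linarith
    then have "ereal y1 < log_persistence_rate (M k) (Z k) T" unfolding log_persistence_rate_eq less_rate_iff[OF T0(1)] .
    with y1(1) show ?thesis by (rule less_trans)
  qed
  then show ?thesis unfolding eventually_prod_filter using ek eT by (auto intro!: exI)
qed

text \<open>
  The gap ratio \<open>\<delta>\<close> is small enough that neither the gaps nor the \<open>\<delta> * N\<close> sacrificed blocks spoil the
  strict inequality between the exponent \<open>\<beta>\<close> to be proved and the exponent \<open>\<beta>'\<close> available on a block.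
  The block length \<open>l\<close> is fixed next, then \<open>k\<close> is taken large, and finally \<open>T\<close>.
\<close>

lemma persistence_upper:
  fixes M :: "nat \<Rightarrow> 'a measure" and N :: "'b measure"
  assumes P: "\<And>k. 1 \<le> k \<Longrightarrow> gauss_proc (M k) (Z k) (K k)"
    and sym: "\<And>k s t. 1 \<le> k \<Longrightarrow> 0 \<le> s \<Longrightarrow> 0 \<le> t \<Longrightarrow> K k s t = K k t s"
    and diag: "\<And>k t. 1 \<le> k \<Longrightarrow> 0 \<le> t \<Longrightarrow> K k t t = 1"
    and \<alpha>: "1 < \<alpha>" and dec: "\<And>k \<tau> s. kmin \<le> k \<Longrightarrow> \<tau>min \<le> \<tau> \<Longrightarrow> 0 \<le> s \<Longrightarrow> K k s (s + \<tau>) \<le> \<tau> powr (- \<alpha>)"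
    and Q: "gauss_proc N W C"
    and ii: "\<And>\<eta> y. 0 < \<eta> \<Longrightarrow> - b < ereal y \<Longrightarrow> \<forall>\<^sub>F l in at_top. sup_lt N W 0 l (l powr (- \<eta>)) < exp (l * y)"
    and \<zeta>: "0 < \<zeta>"
    and conv: "\<And>L q z. Lmin \<le> L \<Longrightarrow> 0 \<le> z \<Longrightarrow> z \<le> \<zeta> \<Longrightarrow> sup_le N W 0 L z < q \<Longrightarrow> \<forall>\<^sub>F k in sequentially. \<forall>s\<ge>0. sup_lt (M k) (Z k) s (s + L) z < q"
    and y: "- b < y"
  shows "\<forall>\<^sub>F (k, T) in sequentially \<times>\<^sub>F at_top. log_persistence_rate (M k) (Z k) T < y"
proof -
  obtain y1 where y1: "- b < ereal y1" "ereal y1 < y" using ereal_dense2[OF y] by auto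
  have "\<exists>Pk PT. eventually Pk sequentially \<and> eventually PT at_top \<and>
     (\<forall>k T. Pk k \<longrightarrow> PT T \<longrightarrow> log_persistence_rate (M k) (Z k) T \<le> ereal y1)"
  \<comment> \<open>Rates are nonpositive, so only negative \<open>y1\<close> require the block comparison.\<close>
  proof (cases "0 \<le> y1")
    case True
    have "log_persistence_rate (M k) (Z k) T \<le> ereal y1" if "1 \<le> k" "0 < T" for k T
    proof -
      have "log_persistence_rate (M k) (Z k) T \<le> 0"
        unfolding log_persistence_rate_eq using that by (intro rate_nonpos sup_lt_bounds[OF P]) auto
      also have "0 \<le> ereal y1" using True by simp
      finally show ?thesis .
    qed
    then show ?thesis using eventually_ge_at_top[of "1::nat"] eventually_gt_at_top[of "0::real"] by blast
  next
    case False
    obtain y2 where y2: "- b < ereal y2" "ereal y2 < ereal y1" using ereal_dense2[OF y1(1)] by auto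
    define \<beta> where "\<beta> = - y1"
    define \<beta>' where "\<beta>' = - y2"
    have \<beta>: "0 < \<beta>" "\<beta> < \<beta>'" using False y2(2) by (auto simp: \<beta>_def \<beta>'_def)
    define \<delta> where "\<delta> = (\<beta>' - \<beta>) / (2 * (\<beta>' + \<beta>))"
    have \<delta>: "0 < \<delta>" "\<delta> < 1" using \<beta> by (auto simp: \<delta>_def field_simps)
    have \<delta>\<beta>: "\<beta> * (1 + \<delta>) < \<beta>' * (1 - \<delta>)"
    proof -
      have "\<delta> * (\<beta>' + \<beta>) = (\<beta>' - \<beta>) / 2" using \<beta> by (simp add: \<delta>_def field_simps)
      then have "\<delta> * (\<beta>' + \<beta>) < \<beta>' - \<beta>" using \<beta> by simp
      then show ?thesis by (simp add: algebra_simps)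
    qed
    \<comment> \<open>This \<open>\<eta>\<close> makes \<open>\<alpha> - 2 * \<eta> = (\<alpha> + 1) / 2\<close>, which exceeds \<open>1\<close>.\<close>
    define \<eta> where "\<eta> = (\<alpha> - 1) / 4"
    have \<eta>: "0 < \<eta>" "1 < \<alpha> - 2 * \<eta>" using \<alpha> by (auto simp: \<eta>_def field_simps)
    obtain S where S: "1 \<le> S" "\<And>i N. (\<Sum>l<N. real (Suc (nat_dist i l)) powr (- \<alpha>)) \<le> S"
      by (rule powr_row_sum_bounded[OF \<alpha>]) (rule that, assumption+)
    note scale = eventually_block_scale[OF \<alpha> \<eta> \<delta>(1) S(1)]
    have "\<forall>\<^sub>F l in at_top. (max 1 Lmin \<le> l \<and> 2 * l powr (- \<eta>) \<le> \<zeta>) \<and> (3 * l powr (- \<eta>) \<le> l powr (- (\<eta> / 2)) \<and>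
        S * (2 / (\<delta> * l)) powr \<alpha> \<le> 1 / 2) \<and> (\<tau>min \<le> \<delta> * l \<and>
        4 * exp (- (\<delta>\<^sup>2 * (\<delta> / 2) powr \<alpha> / (8 * S\<^sup>2)) * l powr (\<alpha> - 2 * \<eta>)) \<le> exp (- \<beta>' * l)) \<and>
        sup_lt N W 0 l (l powr (- (\<eta> / 2))) < exp (l * y2)"
      using \<eta>(1) by (intro eventually_conj scale[OF \<zeta>] eventually_ge_at_top ii y2(1)) auto
    then obtain l where l: "max 1 Lmin \<le> l" "2 * l powr (- \<eta>) \<le> \<zeta>" "3 * l powr (- \<eta>) \<le> l powr (- (\<eta> / 2))"
        "S * (2 / (\<delta> * l)) powr \<alpha> \<le> 1 / 2" "\<tau>min \<le> \<delta> * l"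
        "4 * exp (- (\<delta>\<^sup>2 * (\<delta> / 2) powr \<alpha> / (8 * S\<^sup>2)) * l powr (\<alpha> - 2 * \<eta>)) \<le> exp (- \<beta>' * l)"
        "sup_lt N W 0 l (l powr (- (\<eta> / 2))) < exp (l * y2)"
      using eventually_happens'[OF trivial_limit_at_top_linorder] by blast
    have l0: "0 < l" using l(1) by simp
    define z where "z = l powr (- \<eta>)"
    have z0: "0 < z" using l0 by (simp add: z_def)
    define p where "p = exp (- \<beta>' * l)"
    have p: "0 < p" "p \<le> 1" using \<beta> l0 by (auto simp: p_def)
    \<comment> \<open>The block comparison uses the threshold \<open>z\<close>, the convergence in \<open>k\<close> the threshold \<open>2 * z\<close>, and the
      hypothesis on the limit process the larger threshold \<open>l powr (- (\<eta> / 2))\<close>: passing between weak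
      and strict inequalities costs a little each time.\<close>
    have "sup_le N W 0 l (2 * z) \<le> sup_lt N W 0 l (l powr (- (\<eta> / 2)))"
      using l(3) z0 l0 by (intro sup_le_le_sup_lt[OF Q]) (auto simp: z_def[symmetric])
    also have "\<dots> < p" using l(7) by (simp add: p_def \<beta>'_def mult.commute)
    finally have "\<forall>\<^sub>F k in sequentially. \<forall>s\<ge>0. sup_lt (M k) (Z k) s (s + l) (2 * z) < p"
      using l(1,2) z0 by (intro conv) (auto simp: z_def)
    then have ek: "\<forall>\<^sub>F k in sequentially. max 1 kmin \<le> k \<and> (\<forall>s\<ge>0. sup_lt (M k) (Z k) s (s + l) (2 * z) < p)"
      using eventually_ge_at_top[of "max 1 kmin"] by (rule eventually_conj[rotated])
    define \<epsilon> where "\<epsilon> = S * (2 / (\<delta> * l)) powr \<alpha>"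
    have \<epsilon>: "0 < \<epsilon>" "\<epsilon> \<le> 1 / 2" using l(4) S(1) \<delta> l0 by (auto simp: \<epsilon>_def)
    define r where "r = 4 * exp (- (\<delta> * (z * sqrt (1 - \<epsilon>) / sqrt \<epsilon>))\<^sup>2 / (4 * S))"
    have tail: "r \<le> p"
    proof -
      have zz: "z\<^sup>2 = l powr (- (2 * \<eta>))" by (simp add: z_def power2_eq_square powr_add[symmetric])
      have ie: "1 / \<epsilon> = (\<delta> / 2) powr \<alpha> * l powr \<alpha> / S"
        using \<delta> l0 S(1) by (simp add: \<epsilon>_def powr_divide powr_mult field_simps)
      \<comment> \<open>As \<open>\<epsilon> \<le> 1 / 2\<close>, the factor \<open>1 - \<epsilon>\<close> may be replaced by \<open>1 / 2\<close>.\<close>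
      have "\<delta>\<^sup>2 * (\<delta> / 2) powr \<alpha> / (8 * S\<^sup>2) * l powr (\<alpha> - 2 * \<eta>) = \<delta>\<^sup>2 * (z\<^sup>2 * (1 / 2) * (1 / \<epsilon>)) / (4 * S)"
        unfolding ie zz using S(1) l0 by (simp add: powr_diff powr_minus field_simps power2_eq_square)
      also have "\<dots> \<le> \<delta>\<^sup>2 * (z\<^sup>2 * (1 - \<epsilon>) * (1 / \<epsilon>)) / (4 * S)"
        using \<epsilon> S(1) by (intro divide_right_mono mult_left_mono mult_right_mono) auto
      also have "\<dots> = (\<delta> * (z * sqrt (1 - \<epsilon>) / sqrt \<epsilon>))\<^sup>2 / (4 * S)"
        using \<epsilon> by (simp add: power_mult_distrib power_divide)
      finally have "exp (- (\<delta> * (z * sqrt (1 - \<epsilon>) / sqrt \<epsilon>))\<^sup>2 / (4 * S)) \<le>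
          exp (- (\<delta>\<^sup>2 * (\<delta> / 2) powr \<alpha> / (8 * S\<^sup>2)) * l powr (\<alpha> - 2 * \<eta>))" by simp
      then show ?thesis using l(6) unfolding p_def r_def by linarith
    qed
    define h where "h = (1 + \<delta>) * l"
    have h: "0 < h" using \<delta> l0 by (simp add: h_def)
    \<comment> \<open>The margin between the exponent available per unit of time and \<open>\<beta>\<close>.\<close>
    define c where "c = \<beta>' * l * (1 - \<delta>) / h - \<beta>"
    have "\<beta>' * l * (1 - \<delta>) / h = \<beta>' * (1 - \<delta>) / (1 + \<delta>)" using l0 by (simp add: h_def)
    moreover have "\<beta> < \<beta>' * (1 - \<delta>) / (1 + \<delta>)" using \<delta>\<beta> \<delta> by (simp add: pos_less_divide_eq)
    ultimately have c: "0 < c" by (simp add: c_def)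
    have eT: "\<forall>\<^sub>F T in at_top. max 0 ((ln 2 + \<beta>' * l * (1 - \<delta>)) / c) < T" by (rule eventually_gt_at_top)
    have "log_persistence_rate (M k) (Z k) T \<le> ereal y1"
      if k: "max 1 kmin \<le> k \<and> (\<forall>s\<ge>0. sup_lt (M k) (Z k) s (s + l) (2 * z) < p)" and T: "max 0 ((ln 2 + \<beta>' * l * (1 - \<delta>)) / c) < T" for k T
    proof -
      have T0: "0 < T" "ln 2 + \<beta>' * l * (1 - \<delta>) < c * T" using T c by (auto simp: field_simps)
      have k1: "1 \<le> k" "kmin \<le> k" using k by auto
      define n where "n = nat \<lfloor>T / h\<rfloor>"
      have n: "real n \<le> T / h" "T / h < real n + 1"
        unfolding n_def using T0 h by (auto simp: of_nat_nat)
      have "sup_lt (M k) (Z k) 0 T 0 \<le> p powr ((1 - \<delta>) * real n) + r ^ n"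
        unfolding r_def
      proof (rule sup_lt_block_upper[OF P[OF k1(1)] sym[OF k1(1)] diag[OF k1(1)] l0 \<delta>(1) _ _ S \<epsilon>_def])
        show "0 < \<alpha>" "\<epsilon> < 1" "0 \<le> z" "0 < p" "p \<le> 1" using \<alpha> \<epsilon> z0 p by auto
        show "K k s t \<le> (t - s) powr (- \<alpha>)" if "0 \<le> s" "\<delta> * l \<le> t - s" for s t
          using dec[OF k1(2), of "t - s" s] that l(5) by simp
        show "sup_le (M k) (Z k) s (s + l) z < p" if s: "0 \<le> s" for s
        proof -
          have "sup_le (M k) (Z k) s (s + l) z \<le> sup_lt (M k) (Z k) s (s + l) (2 * z)"
            using s l0 z0 by (intro sup_le_le_sup_lt[OF P[OF k1(1)]]) auto
          also have "\<dots> < p" using k s by blast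
          finally show ?thesis .
        qed
        have "real n * h \<le> T" using n(1) h by (simp add: field_simps)
        then show "real n * ((1 + \<delta>) * l) \<le> T" by (simp only: h_def)
      qed
      also have "r ^ n \<le> p powr ((1 - \<delta>) * real n)"
      proof -
        have "r ^ n \<le> p ^ n"
          by (intro power_mono tail) (simp add: r_def)
        also have "\<dots> = p powr real n" using p by (simp add: powr_realpow)
        also have "\<dots> \<le> p powr ((1 - \<delta>) * real n)"
          using p \<delta> by (intro powr_mono') (auto simp: algebra_simps)
        finally show ?thesis .
      qed
      also have "p powr ((1 - \<delta>) * real n) + p powr ((1 - \<delta>) * real n) = exp (ln 2 - \<beta>' * l * (1 - \<delta>) * real n)"
      proof -
        have "p powr ((1 - \<delta>) * real n) = exp (- (\<beta>' * l * (1 - \<delta>) * real n))"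
          by (simp add: p_def powr_def mult_ac)
        moreover have "exp (ln 2 - \<beta>' * l * (1 - \<delta>) * real n) = 2 * exp (- (\<beta>' * l * (1 - \<delta>) * real n))"
          unfolding diff_conv_add_uminus exp_add by simp
        ultimately show ?thesis by simp
      qed
      also have "\<dots> < exp (T * y1)"
      proof -
        have A: "0 < \<beta>' * l * (1 - \<delta>)" using \<beta> l0 \<delta> by simp
        have "\<beta>' * l * (1 - \<delta>) * (T / h - 1) \<le> \<beta>' * l * (1 - \<delta>) * real n"
          using n(2) A by (intro mult_left_mono) auto
        moreover have "\<beta>' * l * (1 - \<delta>) * (T / h - 1) = (c + \<beta>) * T - \<beta>' * l * (1 - \<delta>)"
        proof -
          have "a * (T / h - 1) = a / h * T - a" for a :: real by (simp add: right_diff_distrib)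
          then show ?thesis by (simp add: c_def)
        qed
        ultimately have "ln 2 - \<beta>' * l * (1 - \<delta>) * real n < T * y1"
          using T0(2) by (simp add: \<beta>_def algebra_simps)
        then show ?thesis by simp
      qed
      finally have "sup_lt (M k) (Z k) 0 T 0 < exp (T * y1)" by simp
      then show ?thesis unfolding log_persistence_rate_eq rate_less_iff[OF T0(1), symmetric] by (rule less_imp_le)
    qed
    then show ?thesis using ek eT by blast
  qed
  then obtain Pk PT where *: "eventually Pk sequentially" "eventually PT at_top"
     "\<And>k T. Pk k \<Longrightarrow> PT T \<Longrightarrow> log_persistence_rate (M k) (Z k) T \<le> ereal y1" by blast
  have "log_persistence_rate (M k) (Z k) T < y" if "Pk k" "PT T" for k T
    using *(3)[OF that] y1(2) by (rule le_less_trans)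
  then show ?thesis unfolding eventually_prod_filter using *(1,2) by (auto intro!: exI)
qed

lemma SUP_shift_interval:
  fixes f :: "real \<Rightarrow> 'b::complete_lattice"
  shows "(SUP t\<in>{0..L}. f (s + t)) = (SUP t\<in>{s..s + L}. f t)"
proof -
  have "(SUP t\<in>{s..s + L}. f t) = (SUP t\<in>(+) s ` {0..L}. f t)" by (simp add: add.commute)
  also have "\<dots> = (SUP t\<in>{0..L}. f (s + t))" unfolding image_image ..
  finally show ?thesis ..
qed

lemma sup_lt_shift:
  "\<P>(\<omega> in completion M. (SUP t\<in>{0..L}. ereal (Z (s + t) \<omega>)) < ereal z) = sup_lt M Z s (s + L) z"
  unfolding sup_lt_def SUP_shift_interval[of "\<lambda>t. ereal (Z t _)"] ..

lemma eln_div_ln_less: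
  assumes "1 < \<tau>" "eln x / ereal (ln \<tau>) < ereal c"
  shows "x < \<tau> powr c"
proof -
  have "0 < ln \<tau>" using assms(1) by simp
  then have "eln x < ereal (c * ln \<tau>)"
    using assms(2) by (cases "eln x") (simp_all add: field_simps)
  then show ?thesis using assms(1) by (simp add: eln_less_iff powr_def)
qed

text \<open>
  The supremum over \<open>s\<close> inside the upper limit makes the decay uniform in the starting time.
\<close>

lemma uniform_power_decay:
  fixes a :: "nat \<Rightarrow> real \<Rightarrow> real \<Rightarrow> real"
  assumes "Limsup (sequentially \<times>\<^sub>F at_top) (\<lambda>(k, \<tau>). SUP s\<in>{0..}. eln (a k s (s + \<tau>)) / ereal (ln \<tau>)) < -1"
  obtains \<alpha> k0 \<tau>0 where "1 < \<alpha>" "\<And>k \<tau> s. k0 \<le> k \<Longrightarrow> \<tau>0 \<le> \<tau> \<Longrightarrow> 0 \<le> s \<Longrightarrow> a k s (s + \<tau>) \<le> \<tau> powr (- \<alpha>)"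
proof -
  obtain c where c: "Limsup (sequentially \<times>\<^sub>F at_top) (\<lambda>(k, \<tau>). SUP s\<in>{0..}. eln (a k s (s + \<tau>)) / ereal (ln \<tau>)) < ereal c" "ereal c < -1"
    using ereal_dense2[OF assms] by auto
  have "\<forall>\<^sub>F x in sequentially \<times>\<^sub>F at_top. (case x of (k, \<tau>) \<Rightarrow> SUP s\<in>{0..}. eln (a k s (s + \<tau>)) / ereal (ln \<tau>)) < ereal c"
    by (rule Limsup_lessD[OF c(1)])
  then obtain Pk PT where *: "eventually Pk sequentially" "eventually PT at_top"
      "\<And>k \<tau>. Pk k \<Longrightarrow> PT \<tau> \<Longrightarrow> (SUP s\<in>{0..}. eln (a k s (s + \<tau>)) / ereal (ln \<tau>)) < ereal c"
    unfolding eventually_prod_filter by auto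
  obtain k0 where k0: "\<And>k. k0 \<le> k \<Longrightarrow> Pk k" using *(1) unfolding eventually_sequentially by blast
  obtain \<tau>0 where \<tau>0: "\<And>\<tau>. \<tau>0 \<le> \<tau> \<Longrightarrow> PT \<tau>" using *(2) unfolding eventually_at_top_linorder by blast
  show ?thesis
  proof (rule that[of "- c" k0 "max 2 \<tau>0"])
    show "1 < - c" using c(2) by (simp add: one_ereal_def)
    fix k \<tau> s assume k: "k0 \<le> k" and \<tau>: "max 2 \<tau>0 \<le> \<tau>" and s: "(0::real) \<le> s"
    have "eln (a k s (s + \<tau>)) / ereal (ln \<tau>) \<le> (SUP s\<in>{0..}. eln (a k s (s + \<tau>)) / ereal (ln \<tau>))"
      using s by (intro SUP_upper) auto
    also have "\<dots> < ereal c" using k \<tau> by (intro *(3) k0 \<tau>0) auto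
    finally have "a k s (s + \<tau>) < \<tau> powr c" using \<tau> by (intro eln_div_ln_less) auto
    then show "a k s (s + \<tau>) \<le> \<tau> powr (- (- c))" by simp
  qed
qed

lemma autocorr_unit_variance:
  assumes "unit_variance_process M Z" "0 \<le> s" "0 \<le> t"
  shows "autocorr M Z s t = cov M (Z s) (Z t)" "cov M (Z t) (Z t) = 1"
proof -
  have *: "cov M (Z t) (Z t) = 1" if "0 \<le> t" for t
    using assms(1) that by (simp add: cov_def unit_variance_process_def power2_eq_square)
  show "cov M (Z t) (Z t) = 1" by (rule *[OF assms(3)])
  show "autocorr M Z s t = cov M (Z s) (Z t)" using *[OF assms(2)] *[OF assms(3)] by (simp add: autocorr_def)
qed

lemma eventually_ge_of_liminf_INF:
  fixes f :: "nat \<Rightarrow> real \<Rightarrow> real"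
  assumes "ereal q < liminf (\<lambda>k. INF s\<in>{0..}. ereal (f k s))"
  shows "\<forall>\<^sub>F k in sequentially. \<forall>s\<ge>0. q \<le> f k s"
  using less_LiminfD[OF assms]
proof eventually_elim
  case (elim k)
  have "ereal q < ereal (f k s)" if "s \<in> {0..}" for s
    using elim INF_lower[OF that, of "\<lambda>s. ereal (f k s)"] by (rule less_le_trans)
  then show ?case by (simp add: less_imp_le)
qed

lemma eventually_less_of_limsup_SUP:
  fixes f :: "nat \<Rightarrow> real \<Rightarrow> real"
  assumes "limsup (\<lambda>k. SUP s\<in>{0..}. ereal (f k s)) < ereal q"
  shows "\<forall>\<^sub>F k in sequentially. \<forall>s\<ge>0. f k s < q"
  using Limsup_lessD[OF assms]
proof eventually_elim
  case (elim k)
  have "ereal (f k s) < ereal q" if "s \<in> {0..}" for s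
    using SUP_upper[OF that, of "\<lambda>s. ereal (f k s)"] elim by (rule le_less_trans)
  then show ?case by simp
qed

text \<open>
  The limit process is stationary, so that the first part of the theorem applies to it and yields the
  block probabilities needed for the lower bound.
\<close>

lemma joint_persistence_limit:
  fixes \<Omega> :: "enat \<Rightarrow> 'a measure" and Z :: "enat \<Rightarrow> real \<Rightarrow> 'a \<Rightarrow> real"
  assumes Z: "\<And>k. 1 \<le> k \<Longrightarrow> gaussian_process (\<Omega> k) (Z k) \<and> centered_process (\<Omega> k) (Z k) \<and>
               unit_variance_process (\<Omega> k) (Z k) \<and> separable_process (\<Omega> k) (Z k) \<and>
               (\<forall>s\<ge>0. \<forall>t\<ge>0. 0 \<le> autocorr (\<Omega> k) (Z k) s t)"
    and A: "A \<in> \<S>\<^sub>+" "has_stationary_autocorr (\<Omega> \<infinity>) (Z \<infinity>) A"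
    and i: "Limsup (sequentially \<times>\<^sub>F at_top)
         (\<lambda>(k, \<tau>). SUP s\<in>{0..}. eln (autocorr (\<Omega> (enat k)) (Z (enat k)) s (s + \<tau>)) / ereal (ln \<tau>)) < -1"
    and ii: "\<And>\<eta>. 0 < \<eta> \<Longrightarrow> Limsup at_top (\<lambda>M. ereal (1 / M) * eln (sup_lt (\<Omega> \<infinity>) (Z \<infinity>) 0 M (M powr (- \<eta>)))) = - persistence_exponent A"
    and \<zeta>: "0 < \<zeta>"
    and low: "\<And>L q. M\<^sub>1 \<le> L \<Longrightarrow> q < sup_lt (\<Omega> \<infinity>) (Z \<infinity>) 0 L 0 \<Longrightarrow>
       \<forall>\<^sub>F k in sequentially. \<forall>s\<ge>0. q \<le> sup_lt (\<Omega> (enat k)) (Z (enat k)) s (s + L) 0"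
    and up: "\<And>L q z. M\<^sub>1 \<le> L \<Longrightarrow> 0 \<le> z \<Longrightarrow> z \<le> \<zeta> \<Longrightarrow> sup_le (\<Omega> \<infinity>) (Z \<infinity>) 0 L z < q \<Longrightarrow>
       \<forall>\<^sub>F k in sequentially. \<forall>s\<ge>0. sup_lt (\<Omega> (enat k)) (Z (enat k)) s (s + L) z < q"
  shows "((\<lambda>(k, T). log_persistence_rate (\<Omega> (enat k)) (Z (enat k)) T) \<longlongrightarrow> - persistence_exponent A) (sequentially \<times>\<^sub>F at_top)"
proof -
  let ?b = "persistence_exponent A"
  define K where "K k s t = cov (\<Omega> k) (Z k s) (Z k t)" for k s t
  have ek: "1 \<le> enat k" if "1 \<le> k" for k using that by (simp add: one_enat_def)
  have ac: "autocorr (\<Omega> k) (Z k) s t = K k s t" if "1 \<le> k" "0 \<le> s" "0 \<le> t" for k s t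
    using autocorr_unit_variance(1)[of "\<Omega> k" "Z k" s t] Z[OF that(1)] that by (simp add: K_def)
  have P: "gauss_proc (\<Omega> k) (Z k) (K k)" if "1 \<le> k" for k
    unfolding K_def using Z[OF that] by (intro gauss_procI) auto
  have sym: "K k s t = K k t s" for k s t unfolding K_def by (rule cov_commute)
  have nonneg: "0 \<le> K k s t" if "1 \<le> k" "0 \<le> s" "0 \<le> t" for k s t
    unfolding ac[OF that, symmetric] using Z[OF that(1)] that by blast
  have diag: "K k t t = 1" if "1 \<le> k" "0 \<le> t" for k t
    using autocorr_unit_variance(2)[of "\<Omega> k" "Z k" t t] Z[OF that(1)] that by (simp add: K_def)
  have KA: "K \<infinity> s t = A \<bar>t - s\<bar>" if "0 \<le> s" "0 \<le> t" for s t
  proof (cases "s \<le> t")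
    case True then show ?thesis using A(2) ac[of \<infinity> s t] that by (simp add: has_stationary_autocorr_def)
  next
    case False
    then show ?thesis using A(2) ac[of \<infinity> t s] that sym[of \<infinity> s t] by (simp add: has_stationary_autocorr_def)
  qed
  have "stationary_process (\<Omega> \<infinity>) (Z \<infinity>)"
  proof (rule stationary_processI)
    show "cov (\<Omega> \<infinity>) (Z \<infinity> (s + h)) (Z \<infinity> (t + h)) = cov (\<Omega> \<infinity>) (Z \<infinity> s) (Z \<infinity> t)" if "0 \<le> s" "0 \<le> t" "0 \<le> h" for s t h
      using KA[of s t] KA[of "s + h" "t + h"] that by (simp add: K_def)
  qed (use Z[of \<infinity>] in auto)
  then have lim: "0 \<le> ?b" "(log_persistence_rate (\<Omega> \<infinity>) (Z \<infinity>) \<longlongrightarrow> - ?b) at_top"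
    using persistence_exponent_limit[OF A(1), of "\<Omega> \<infinity>" "Z \<infinity>"] Z[of \<infinity>] A(2) by auto
  obtain \<alpha> k0 \<tau>0 where \<alpha>: "1 < \<alpha>" and dec: "\<And>k \<tau> s. k0 \<le> k \<Longrightarrow> \<tau>0 \<le> \<tau> \<Longrightarrow> 0 \<le> s \<Longrightarrow>
       autocorr (\<Omega> (enat k)) (Z (enat k)) s (s + \<tau>) \<le> \<tau> powr (- \<alpha>)"
    using uniform_power_decay[OF i] by blast
  have ii': "\<forall>\<^sub>F l in at_top. sup_lt (\<Omega> \<infinity>) (Z \<infinity>) 0 l (l powr (- \<eta>)) < exp (l * y)" if "0 < \<eta>" "- ?b < ereal y" for \<eta> y
  proof -
    have "Limsup at_top (\<lambda>M. ereal (1 / M) * eln (sup_lt (\<Omega> \<infinity>) (Z \<infinity>) 0 M (M powr (- \<eta>)))) < ereal y"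
      using ii[OF that(1)] that(2) by simp
    then have "\<forall>\<^sub>F M in at_top. ereal (1 / M) * eln (sup_lt (\<Omega> \<infinity>) (Z \<infinity>) 0 M (M powr (- \<eta>))) < ereal y"
      by (rule Limsup_lessD)
    then show ?thesis using eventually_gt_at_top[of 0]
      by eventually_elim (simp only: rate_less_iff)
  qed
  show ?thesis
  proof (rule order_tendstoI)
    fix y assume "y < - ?b"
    then have "\<forall>\<^sub>F (k, T) in sequentially \<times>\<^sub>F at_top. y < log_persistence_rate (\<Omega> (enat k)) (Z (enat k)) T"
      by (intro persistence_lower[where M="\<lambda>k. \<Omega> (enat k)" and Z="\<lambda>k. Z (enat k)" and K="\<lambda>k. K (enat k)" and Lmin=M\<^sub>1,
            OF P[OF ek] sym nonneg[OF ek] lim(2,1) low])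
    then show "\<forall>\<^sub>F x in sequentially \<times>\<^sub>F at_top. y < (case x of (k, T) \<Rightarrow> log_persistence_rate (\<Omega> (enat k)) (Z (enat k)) T)"
      by (rule eventually_mono) (simp add: case_prod_beta)
  next
    fix y assume "- ?b < y"
    then have "\<forall>\<^sub>F (k, T) in sequentially \<times>\<^sub>F at_top. log_persistence_rate (\<Omega> (enat k)) (Z (enat k)) T < y"
    proof (intro persistence_upper[where M="\<lambda>k. \<Omega> (enat k)" and Z="\<lambda>k. Z (enat k)" and K="\<lambda>k. K (enat k)" and Lmin=M\<^sub>1 and kmin="max 1 k0" and \<tau>min="max 0 \<tau>0",
            OF P[OF ek] sym diag[OF ek] \<alpha> _ P[of \<infinity>] ii' \<zeta> up])
      show "K (enat k) s (s + \<tau>) \<le> \<tau> powr (- \<alpha>)" if "max 1 k0 \<le> k" "max 0 \<tau>0 \<le> \<tau>" "0 \<le> s" for k \<tau> s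
        using dec[of k \<tau> s] ac[OF ek, of k s "s + \<tau>"] that by simp
    qed simp_all
    then show "\<forall>\<^sub>F x in sequentially \<times>\<^sub>F at_top. (case x of (k, T) \<Rightarrow> log_persistence_rate (\<Omega> (enat k)) (Z (enat k)) T) < y"
      by (rule eventually_mono) (simp add: case_prod_beta)
  qed
qed

theorem theorem1p6:
  shows
   "(\<forall>A\<in>\<S>\<^sub>+. \<forall>(M :: 'b measure) Z.
       gaussian_process M Z \<and> centered_process M Z \<and> stationary_process M Z \<and>
       separable_process M Z \<and> has_stationary_autocorr M Z A \<longrightarrow>
       0 \<le> persistence_exponent A \<and>
       (log_persistence_rate M Z \<longlongrightarrow> - persistence_exponent A) at_top)
    \<and>
    (\<forall>(\<Omega> :: enat \<Rightarrow> 'a measure) (Z :: enat \<Rightarrow> real \<Rightarrow> 'a \<Rightarrow> real) (A :: real \<Rightarrow> real).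
       (\<forall>k\<ge>1. gaussian_process (\<Omega> k) (Z k) \<and> centered_process (\<Omega> k) (Z k) \<and>
               unit_variance_process (\<Omega> k) (Z k) \<and> separable_process (\<Omega> k) (Z k) \<and>
               (\<forall>s\<ge>0. \<forall>t\<ge>0. 0 \<le> autocorr (\<Omega> k) (Z k) s t)) \<and>
       A \<in> \<S>\<^sub>+ \<and> has_stationary_autocorr (\<Omega> \<infinity>) (Z \<infinity>) A \<and>
       Limsup (sequentially \<times>\<^sub>F at_top)
         (\<lambda>(k, \<tau>). SUP s\<in>{0..}. eln (autocorr (\<Omega> (enat k)) (Z (enat k)) s (s + \<tau>)) / ereal (ln \<tau>))
         < -1 \<and>
       (\<forall>\<eta>>0. Limsup at_top
          (\<lambda>M. ereal (1 / M) *
             eln \<P>(\<omega> in completion (\<Omega> \<infinity>). (SUP t\<in>{0..M}. ereal (Z \<infinity> t \<omega>)) < ereal (M powr (- \<eta>))))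
          = - persistence_exponent A) \<and>
       (\<exists>\<zeta>>0. \<exists>M\<^sub>1::real. \<forall>z\<in>{0..\<zeta>}. \<forall>M\<ge>M\<^sub>1.
          ereal \<P>(\<omega> in completion (\<Omega> \<infinity>). (SUP t\<in>{0..M}. ereal (Z \<infinity> t \<omega>)) < ereal z)
            \<le> liminf (\<lambda>k. INF s\<in>{0..}. ereal \<P>(\<omega> in completion (\<Omega> (enat k)).
                 (SUP t\<in>{0..M}. ereal (Z (enat k) (s + t) \<omega>)) < ereal z)) \<and>
          liminf (\<lambda>k. INF s\<in>{0..}. ereal \<P>(\<omega> in completion (\<Omega> (enat k)).
                 (SUP t\<in>{0..M}. ereal (Z (enat k) (s + t) \<omega>)) < ereal z))
            \<le> limsup (\<lambda>k. SUP s\<in>{0..}. ereal \<P>(\<omega> in completion (\<Omega> (enat k)).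
                 (SUP t\<in>{0..M}. ereal (Z (enat k) (s + t) \<omega>)) < ereal z)) \<and>
          limsup (\<lambda>k. SUP s\<in>{0..}. ereal \<P>(\<omega> in completion (\<Omega> (enat k)).
                 (SUP t\<in>{0..M}. ereal (Z (enat k) (s + t) \<omega>)) < ereal z))
            \<le> ereal \<P>(\<omega> in completion (\<Omega> \<infinity>). (SUP t\<in>{0..M}. ereal (Z \<infinity> t \<omega>)) \<le> ereal z))
       \<longrightarrow>
       ((\<lambda>(k, T). log_persistence_rate (\<Omega> (enat k)) (Z (enat k)) T)
          \<longlongrightarrow> - persistence_exponent A) (sequentially \<times>\<^sub>F at_top))"
proof (intro conjI allI ballI impI, goal_cases)
  case (1 A M Z)
  then show ?case using persistence_exponent_limit(1)[of A M Z] by blast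
next
  case (2 A M Z)
  then show ?case using persistence_exponent_limit(2)[of A M Z] by blast
next
  case H: (3 \<Omega> Z A)
  note H1 = H[THEN conjunct1] and H2 = H[THEN conjunct2, THEN conjunct1]
    and H3 = H[THEN conjunct2, THEN conjunct2, THEN conjunct1]
    and H4 = H[THEN conjunct2, THEN conjunct2, THEN conjunct2, THEN conjunct1]
    and H5 = H[THEN conjunct2, THEN conjunct2, THEN conjunct2, THEN conjunct2, THEN conjunct1, folded sup_lt_def]
    and H6 = H[THEN conjunct2, THEN conjunct2, THEN conjunct2, THEN conjunct2, THEN conjunct2,
      unfolded sup_lt_shift, folded sup_lt_def sup_le_def]
  from H6 show ?case
  proof (elim exE conjE, goal_cases)
    case (1 \<zeta> M\<^sub>1)
    note \<zeta> = 1(1)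
    have H7: "z \<in> {0..\<zeta>}" if "0 \<le> z" "z \<le> \<zeta>" for z using that by simp
    note conv = 1(2)[rule_format, OF H7]
    show ?case
    proof (rule joint_persistence_limit[OF _ H2 H3 H4 _ \<zeta>])
      show "gaussian_process (\<Omega> k) (Z k) \<and> centered_process (\<Omega> k) (Z k) \<and>
                 unit_variance_process (\<Omega> k) (Z k) \<and> separable_process (\<Omega> k) (Z k) \<and>
                 (\<forall>s\<ge>0. \<forall>t\<ge>0. 0 \<le> autocorr (\<Omega> k) (Z k) s t)" if "1 \<le> k" for k
        using H1 that by blast
      show "Limsup at_top (\<lambda>M. ereal (1 / M) * eln (sup_lt (\<Omega> \<infinity>) (Z \<infinity>) 0 M (M powr (- \<eta>)))) = - persistence_exponent A"
        if "0 < \<eta>" for \<eta>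
        using H5 that by blast
      fix L q assume L: "M\<^sub>1 \<le> L"
      show "\<forall>\<^sub>F k in sequentially. \<forall>s\<ge>0. q \<le> sup_lt (\<Omega> (enat k)) (Z (enat k)) s (s + L) 0"
        if "q < sup_lt (\<Omega> \<infinity>) (Z \<infinity>) 0 L 0"
      proof -
        have "ereal q < ereal (sup_lt (\<Omega> \<infinity>) (Z \<infinity>) 0 L 0)" using that by simp
        also note conv[THEN conjunct1, OF order_refl less_imp_le[OF \<zeta>] L]
        finally show ?thesis by (rule eventually_ge_of_liminf_INF)
      qed
      show "\<forall>\<^sub>F k in sequentially. \<forall>s\<ge>0. sup_lt (\<Omega> (enat k)) (Z (enat k)) s (s + L) z < q"
        if "0 \<le> z" "z \<le> \<zeta>" "sup_le (\<Omega> \<infinity>) (Z \<infinity>) 0 L z < q" for z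
      proof -
        note conv[THEN conjunct2, THEN conjunct2, OF that(1,2) L]
        also have "ereal (sup_le (\<Omega> \<infinity>) (Z \<infinity>) 0 L z) < ereal q" using that by simp
        finally show ?thesis by (rule eventually_less_of_limsup_SUP)
      qed
    qed
  qed
qed

end
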